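(* Let $1<p<\infty$. Let $\Omega_1$ and $\Omega_2$ be two open convex sets in $\mathbb{C}$ such that (i) $\Omega_1\cap\Omega_2$ is non-empty and bounded; (ii) the set $\tilde\partial(\partial\Omega_1\cap\partial\Omega_2)$ is finite. Then $$A^p(\Omega_1\cap\Omega_2)=A^p(\Omega_1)+A^p(\Omega_2).$$
   Context: For an open set $\Omega\subset\mathbb{C}$ and $1\le p<\infty$, the Bergman space $A^p(\Omega)$ consists of all holomorphic functions $f$ on $\Omega$ with $\int_\Omega |f(x+iy)|^p\,dx\,dy<+\infty$. Here $\partial\Omega$ denotes the (topological) boundary of the planar set $\Omega$. The boundaries $\partial\Omega_1$ and $\partial\Omega_2$ may meet in single points or along curves (arcs); $\tilde\partial E$ denotes the boundary of $E$ as a one-dimensional object, i.e. for $E=\partial\Omega_1\cap\partial\Omega_2$ the set formed by the single points and the endpoints of the arcs of $E$. Thus condition (ii) means that $\partial\Omega_1\cap\partial\Omega_2$ consists of only finitely many single points and arcs. The sum $A^p(\Omega_1)+A^p(\Omega_2)$ is the set of functions on $\Omega_1\cap\Omega_2$ of the form $f_1|_{\Omega_1\cap\Omega_2}+f_2|_{\Omega_1\cap\Omega_2}$ with $f_i\in A^p(\Omega_i)$. *)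

theory Defs
  imports "HOL-Analysis.Analysis" "HOL-Complex_Analysis.Complex_Analysis"
begin

text \<open>
  Elements of the Bergman space are functions on \<open>\<Omega>\<close>; they are represented by total functions
  that are \<^const>\<open>undefined\<close> off \<open>\<Omega>\<close>, so that equality of representatives is equality on \<open>\<Omega>\<close>.
  The measure \<^term>\<open>lborel :: complex measure\<close> is the area measure \<open>dx dy\<close>.
\<close>

definition bergman_space :: "real \<Rightarrow> complex set \<Rightarrow> (complex \<Rightarrow> complex) set" where
  "bergman_space p \<Omega> = {f \<in> extensional \<Omega>. f holomorphic_on \<Omega> \<and>
     (\<integral>\<^sup>+z\<in>\<Omega>. ennreal (cmod (f z) powr p) \<partial>lborel) < \<infinity>}"

definition bergman_sum :: "real \<Rightarrow> complex set \<Rightarrow> complex set \<Rightarrow> (complex \<Rightarrow> complex) set" where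
  "bergman_sum p \<Omega>1 \<Omega>2 =
     {(\<lambda>z\<in>\<Omega>1 \<inter> \<Omega>2. f1 z + f2 z) | f1 f2. f1 \<in> bergman_space p \<Omega>1 \<and> f2 \<in> bergman_space p \<Omega>2}"

text \<open>
  The boundary of \<open>E\<close> as a one-dimensional object: its single points (the one-point components)
  and the endpoints of its arcs (the components that are homeomorphic images of \<open>[0,1]\<close>).
  It is meant for \<open>E = \<partial>\<Omega>\<^sub>1 \<inter> \<partial>\<Omega>\<^sub>2\<close> with \<open>\<Omega>\<^sub>1\<close>, \<open>\<Omega>\<^sub>2\<close> open and convex and \<open>\<Omega>\<^sub>1 \<inter> \<Omega>\<^sub>2\<close> non-empty
  and bounded. Then the intersection of the closures is the closure of \<open>\<Omega>\<^sub>1 \<inter> \<Omega>\<^sub>2\<close>, so \<open>E\<close> is a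
  compact subset of a convex curve, and each component is a point, an arc or a closed curve
  (the last only if \<open>E = \<partial>\<Omega>\<^sub>1 = \<partial>\<Omega>\<^sub>2\<close>, and it has no endpoints).
\<close>

definition curve_boundary :: "complex set \<Rightarrow> complex set" where
  "curve_boundary E =
     {x. {x} \<in> components E} \<union>
     {x. \<exists>\<gamma>. arc \<gamma> \<and> path_image \<gamma> \<in> components E \<and> (x = pathstart \<gamma> \<or> x = pathfinish \<gamma>)}"

end

theory Submission imports Defs begin

text \<open>
  Write \<open>D = \<Omega>1 \<inter> \<Omega>2\<close>, fix \<open>c \<in> D\<close> and let \<open>T\<close> be the relative boundary of \<open>\<partial>D \<inter> \<Omega>2\<close> in \<open>\<partial>D\<close>.
  It is contained in the finite set of (ii). The segments \<open>[a, c]\<close>, \<open>a \<in> T\<close>, cut \<open>D\<close> into sectors;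
  let \<open>\<psi>\<close> be the indicator function of those over \<open>\<partial>D \<inter> \<Omega>2\<close>, so that \<open>\<psi>\<close> vanishes near
  \<open>\<partial>D \<inter> \<Omega>1\<close> and \<open>1 - \<psi>\<close> vanishes near \<open>\<partial>D \<inter> \<Omega>2\<close>. To repair the jumps of \<open>\<psi> f\<close> across the segments one
  subtracts multiples of
  \<open>C\<^sub>a(z) = 1 / (2 \<pi> i) \<integral> f(w) (1 / (w - z) - 1 / (2 a - w - z)) dw\<close>, integrated over \<open>[a, c]\<close>. By convexity the
  reflected pole \<open>2 a - w\<close> lies outside \<open>\<Omega>1 \<union> \<Omega>2\<close>, at a distance comparable to \<open>|w - a| + |z - a|\<close>.
  This makes the kernel integrable at \<open>a\<close> and at infinity for every \<open>p > 1\<close>, and a Schur test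
  gives \<open>C\<^sub>a \<in> L\<^sup>p\<close>. The corrected functions extend holomorphically across the segments; the point \<open>c\<close>
  is removable because an \<open>L\<^sup>p\<close> function has at most a simple pole there and the residue
  vanishes by a limit along a direction transversal to all segments.
\<close>

section \<open>Integration over the complex plane\<close>

text \<open>Two defects of the plain Cauchy integral of f over [a, c] force the reflected pole. The
  trace of f on the segment is controlled only with the weight t = |w - a|: the integral of t |f|^p
  is finite, and for p \<le> 2 this does not make the trace integrable at a. Moreover 1/z is not
  p-integrable at infinity on a sector when p \<le> 2. The two poles differ by 2 (w - a), so the
  difference of the two kernels has the missing factor t in its numerator and decays like |z|^-2.
  The extra pole does no harm because every a in T lies on both boundaries, hence outside both
  convex sets. Each transform may have a logarithmic singularity at c. The cancellation of these
  logarithms is never computed: once the corrected function is glued along the segments it is single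
  valued around c, so c is an isolated singularity. The two summands use complementary indicators
  and the same transforms with opposite signs, so they add up to f. Hypothesis (ii) enters as the
  finiteness of the number of segments, hence of correction terms.\<close>

lemma lborel_complex_eq:
  "(lborel :: complex measure) = distr (lborel \<Otimes>\<^sub>M lborel) borel (\<lambda>(x, y). Complex x y)"
proof (rule lborel_eqI)
  fix l u :: complex
  assume lu: "\<And>b. b \<in> Basis \<Longrightarrow> l \<bullet> b \<le> u \<bullet> b"
  have le: "Re l \<le> Re u" "Im l \<le> Im u"
    using lu[of 1] lu[of \<i>] by (simp_all add: Basis_complex_def)
  have meas: "(\<lambda>(x, y). Complex x y) \<in> borel_measurable (lborel \<Otimes>\<^sub>M lborel)"
    by (subst borel_measurable_complex_iff) (simp add: split_beta')
  have "(\<lambda>(x, y). Complex x y) -` box l u \<inter> space (lborel \<Otimes>\<^sub>M lborel)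
      = {Re l<..<Re u} \<times> {Im l<..<Im u}"
    by (auto simp: in_box_complex_iff space_pair_measure)
  then have "emeasure (distr (lborel \<Otimes>\<^sub>M lborel) borel (\<lambda>(x, y). Complex x y)) (box l u)
      = emeasure (lborel \<Otimes>\<^sub>M lborel) ({Re l<..<Re u} \<times> {Im l<..<Im u})"
    using meas by (subst emeasure_distr) (auto)
  also have "\<dots> = ennreal (Re u - Re l) * ennreal (Im u - Im l)"
    using le by (subst lborel.emeasure_pair_measure_Times) auto
  also have "\<dots> = ennreal (\<Prod>b\<in>Basis. (u - l) \<bullet> b)"
    using le by (simp add: Basis_complex_def ennreal_mult)
  finally show "emeasure (distr (lborel \<Otimes>\<^sub>M lborel) borel (\<lambda>(x, y). Complex x y)) (box l u)
      = ennreal (\<Prod>b\<in>Basis. (u - l) \<bullet> b)" .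
qed auto

lemma nn_integral_complex:
  fixes g :: "complex \<Rightarrow> ennreal"
  assumes [measurable]: "g \<in> borel_measurable borel"
  shows "(\<integral>\<^sup>+z. g z \<partial>lborel) = (\<integral>\<^sup>+y. (\<integral>\<^sup>+x. g (Complex x y) \<partial>lborel) \<partial>lborel)"
    and "(\<integral>\<^sup>+z. g z \<partial>lborel) = (\<integral>\<^sup>+x. (\<integral>\<^sup>+y. g (Complex x y) \<partial>lborel) \<partial>lborel)"
proof -
  have meas[measurable]: "(\<lambda>(x, y). Complex x y) \<in> borel_measurable (lborel \<Otimes>\<^sub>M lborel)"
    by (subst borel_measurable_complex_iff) (simp add: split_beta')
  have "(\<integral>\<^sup>+z. g z \<partial>lborel) = (\<integral>\<^sup>+z. g (case z of (x, y) \<Rightarrow> Complex x y) \<partial>(lborel \<Otimes>\<^sub>M lborel))"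
    by (subst lborel_complex_eq, subst nn_integral_distr) auto
  also have "\<dots> = (\<integral>\<^sup>+x. (\<integral>\<^sup>+y. g (Complex x y) \<partial>lborel) \<partial>lborel)"
    by (subst lborel.nn_integral_fst[symmetric]) (auto simp: split_beta')
  finally show 1: "(\<integral>\<^sup>+z. g z \<partial>lborel) = (\<integral>\<^sup>+x. (\<integral>\<^sup>+y. g (Complex x y) \<partial>lborel) \<partial>lborel)" .
  also have "\<dots> = (\<integral>\<^sup>+y. (\<integral>\<^sup>+x. g (Complex x y) \<partial>lborel) \<partial>lborel)"
    by (rule lborel_pair.Fubini'[symmetric]) (use measurable_compose[OF meas assms] in \<open>simp add: split_beta'\<close>)
  finally show "(\<integral>\<^sup>+z. g z \<partial>lborel) = (\<integral>\<^sup>+y. (\<integral>\<^sup>+x. g (Complex x y) \<partial>lborel) \<partial>lborel)" .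
qed

text \<open>Hoelder's inequality solved for the p-integral, which may be infinite. It comes from
  integrating Young's inequality with a free scale \<open>s\<close> distributed over the two
  factors.\<close>

lemma hoelder_bound:
  fixes X Y :: "'a \<Rightarrow> real"
  assumes pq: "1 < p" "1 < q" "1/p + 1/q = 1"
    and [measurable]: "X \<in> borel_measurable M" "Y \<in> borel_measurable M"
    and nonneg: "\<And>x. 0 \<le> X x" "\<And>x. 0 \<le> Y x" "0 \<le> c"
    and c: "ennreal c \<le> (\<integral>\<^sup>+x. ennreal (X x * Y x) \<partial>M)"
    and B: "(\<integral>\<^sup>+x. ennreal (Y x powr q) \<partial>M) \<le> ennreal B" "0 < B"
  shows "ennreal (c powr p) \<le> ennreal (B powr (p - 1)) * (\<integral>\<^sup>+x. ennreal (X x powr p) \<partial>M)"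
proof (cases "c = 0 \<or> (\<integral>\<^sup>+x. ennreal (X x powr p) \<partial>M) = \<infinity>")
  case True
  then show ?thesis using B pq by (auto simp: ennreal_mult_top)
next
  case False
  then obtain A where A: "0 \<le> A" "(\<integral>\<^sup>+x. ennreal (X x powr p) \<partial>M) = ennreal A"
    by (metis ennreal_cases infinity_ennreal_def)
  have c0: "c > 0" using False nonneg by auto
  \<comment> \<open>This scale turns the second Young term into \<open>c / q\<close>, which moves to
    the left side and leaves \<open>c / p\<close> there.\<close>
  define s where "s = c / B"
  have s: "s > 0" using c0 B by (simp add: s_def)
  have q: "1/q = 1 - 1/p" using pq by linarith
  have pow: "p / q = p - 1" using pq q by (simp add: field_simps)
  have young: "X x * Y x \<le> (s powr (1 - p) / p) * X x powr p + (s / q) * Y x powr q" for x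
  proof -
    have "(X x * s powr (- 1/q)) * (Y x * s powr (1/q))
        \<le> (X x * s powr (- 1/q)) powr p / p + (Y x * s powr (1/q)) powr q / q"
      using pq nonneg by (intro Youngs_inequality) auto
    moreover have "(X x * s powr (- 1/q)) * (Y x * s powr (1/q)) = X x * Y x"
      using s by (simp add: powr_minus divide_simps)
    moreover have "(X x * s powr (- 1/q)) powr p = s powr (1 - p) * X x powr p"
    proof -
      have "- 1 / q * p = 1 - p" using pow by (simp add: field_simps)
      then show ?thesis using nonneg by (simp add: powr_mult powr_powr mult.commute)
    qed
    moreover have "(Y x * s powr (1/q)) powr q = s * Y x powr q"
      using nonneg s pq by (simp add: powr_mult powr_powr)
    ultimately have "X x * Y x \<le> (s powr (1 - p) * X x powr p) / p + (s * Y x powr q) / q"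
      by (simp only:)
    then show ?thesis by simp
  qed
  have "ennreal c \<le> (\<integral>\<^sup>+x. ennreal (s powr (1 - p) / p) * ennreal (X x powr p)
       + ennreal (s / q) * ennreal (Y x powr q) \<partial>M)"
    using pq s young
    by (intro order_trans[OF c] nn_integral_mono)
       (simp add: ennreal_mult[symmetric] ennreal_plus[symmetric] ennreal_leI del: ennreal_plus)
  also have "\<dots> = ennreal (s powr (1 - p) / p) * ennreal A
       + ennreal (s / q) * (\<integral>\<^sup>+x. ennreal (Y x powr q) \<partial>M)"
    by (simp add: nn_integral_add nn_integral_cmult A)
  also have "\<dots> \<le> ennreal (s powr (1 - p) / p) * ennreal A + ennreal (s / q) * ennreal B"
    using B by (intro add_left_mono mult_left_mono) auto
  also have "\<dots> = ennreal (s powr (1 - p) / p * A + s / q * B)"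
    using A B s pq by (simp add: ennreal_mult[symmetric] ennreal_plus)
  finally have "c \<le> s powr (1 - p) / p * A + s / q * B"
    using A B s pq by (subst (asm) ennreal_le_iff) auto
  also have "s / q * B = c / q" using B by (simp add: s_def)
  also have "c / q = c - c / p"
    using q by (metis mult.right_neutral right_diff_distrib' times_divide_eq_right)
  finally have "c / p \<le> s powr (1 - p) * A / p" by simp
  then have "c \<le> s powr (1 - p) * A" using pq by (simp add: divide_le_cancel)
  then have "c * s powr (p - 1) \<le> s powr (1 - p) * A * s powr (p - 1)"
    by (intro mult_right_mono) auto
  also have "\<dots> = A" using s by (simp add: powr_diff)
  finally have "c * s powr (p - 1) * B powr (p - 1) \<le> A * B powr (p - 1)"
    by (intro mult_right_mono) auto
  moreover have "c * s powr (p - 1) * B powr (p - 1) = c powr p"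
    using c0 B by (simp add: s_def powr_divide powr_diff)
  ultimately have "c powr p \<le> B powr (p - 1) * A" by (simp add: mult.commute)
  then show ?thesis using A by (simp add: ennreal_mult[symmetric] ennreal_leI)
qed

text \<open>The segment is parametrised by signed distance from its midpoint, so that a later
  integration over \<open>s\<close> turns line integrals into an area integral.\<close>

lemma norm_contour_integral_linepath_le_nn_integral:
  fixes h :: "complex \<Rightarrow> complex"
  assumes cont: "continuous_on (closed_segment (c - of_real s * d) (c + of_real s * d)) h"
    and d: "norm d = 1" and s: "s > 0"
  shows "ennreal (norm (contour_integral (linepath (c - of_real s * d) (c + of_real s * d)) h))
    \<le> (\<integral>\<^sup>+u\<in>{-s..s}. ennreal (norm (h (c + of_real u * d))) \<partial>lborel)"
proof -
  define H where "H x = h (linepath (c - of_real s * d) (c + of_real s * d) x) * (2 * of_real s * d)" for x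
  have lp: "linepath (c - of_real s * d) (c + of_real s * d) x = c + of_real (-s + (2 * s) * x) * d" for x
    by (simp add: linepath_def scaleR_conv_of_real algebra_simps)
  have hm: "(\<lambda>u. ennreal (norm (h (c + of_real u * d))) * indicator {-s..s} u) \<in> borel_measurable borel"
  proof -
    have "continuous_on {-s..s} (\<lambda>u. h (c + of_real u * d))"
    proof (intro continuous_on_compose2[OF cont] continuous_intros image_subsetI)
      fix u assume u: "u \<in> {-s..s}"
      have "c + of_real u * d = linepath (c - of_real s * d) (c + of_real s * d) ((u + s) / (2 * s))"
        unfolding lp using s by (simp add: field_simps)
      moreover have "(u + s) / (2 * s) \<in> {0..1}" using u s by simp
      ultimately show "c + of_real u * d \<in> closed_segment (c - of_real s * d) (c + of_real s * d)"
        by (metis linepath_in_path)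
    qed
    then have "(\<lambda>u. indicator {-s..s} u *\<^sub>R h (c + of_real u * d)) \<in> borel_measurable borel"
      by (intro borel_measurable_continuous_on_indicator) auto
    then have "(\<lambda>u. ennreal (norm (indicator {-s..s} u *\<^sub>R h (c + of_real u * d)))) \<in> borel_measurable borel"
      by (intro measurable_compose[OF _ measurable_ennreal] measurable_compose[OF _ borel_measurable_norm])
    also have "(\<lambda>u. ennreal (norm (indicator {-s..s} u *\<^sub>R h (c + of_real u * d))))
       = (\<lambda>u. ennreal (norm (h (c + of_real u * d))) * indicator {-s..s} u)"
      by (auto simp: indicator_def)
    finally show ?thesis .
  qed
  have contH: "continuous_on {0..1} H" unfolding H_def
    by (intro continuous_intros continuous_on_compose2[OF cont]) (auto simp: linepath_in_path)
  then have int: "set_integrable lborel {0..1} H" by (rule borel_integrable_atLeastAtMost')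
  have "contour_integral (linepath (c - of_real s * d) (c + of_real s * d)) h = integral {0..1} H"
    unfolding contour_integral_integral H_def by (simp add: algebra_simps)
  also have "\<dots> = (LINT x:{0..1}|lborel. H x)"
    using set_borel_integral_eq_integral(2)[OF int] by simp
  finally have eq: "contour_integral (linepath (c - of_real s * d) (c + of_real s * d)) h = \<dots>" .
  have "ennreal (norm (LINT x:{0..1}|lborel. H x))
      \<le> (\<integral>\<^sup>+x. ennreal (norm (indicator {0..1} x *\<^sub>R H x)) \<partial>lborel)"
    unfolding set_lebesgue_integral_def
    by (rule integral_norm_bound_ennreal) (use int in \<open>simp add: set_integrable_def\<close>)
  also have "\<dots> = ennreal \<bar>2 * s\<bar> * (\<integral>\<^sup>+x. ennreal (norm (h (c + of_real (-s + (2 * s) * x) * d)))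
      * indicator {-s..s} (-s + (2 * s) * x) \<partial>lborel)"
  proof (subst nn_integral_cmult[symmetric])
    from hm show "(\<lambda>x. ennreal (norm (h (c + of_real (-s + (2 * s) * x) * d)))
      * indicator {-s..s} (-s + (2 * s) * x)) \<in> borel_measurable lborel"
      by (rule measurable_compose[rotated]) simp
    have "norm (indicator {0..1} x *\<^sub>R H x) = 2 * s * (norm (h (c + of_real (-s + (2 * s) * x) * d))
      * indicator {-s..s} (-s + (2 * s) * x))" for x
      using s d by (auto simp: H_def lp indicator_def norm_mult zero_le_mult_iff)
    then show "(\<integral>\<^sup>+x. ennreal (norm (indicator {0..1} x *\<^sub>R H x)) \<partial>lborel)
      = (\<integral>\<^sup>+x. ennreal \<bar>2 * s\<bar> * (ennreal (norm (h (c + of_real (-s + (2 * s) * x) * d)))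
      * indicator {-s..s} (-s + (2 * s) * x)) \<partial>lborel)"
      using s by (intro nn_integral_cong) (auto simp: ennreal_mult indicator_def)
  qed
  also have "\<dots> = (\<integral>\<^sup>+u\<in>{-s..s}. ennreal (norm (h (c + of_real u * d))) \<partial>lborel)"
    using s by (subst nn_integral_real_affine[OF hm, where c = "2 * s" and t = "-s"]) auto
  finally show ?thesis unfolding eq .
qed

lemma nn_integral_real_isometry:
  fixes f :: "real \<Rightarrow> ennreal"
  assumes "f \<in> borel_measurable borel"
  shows "(\<integral>\<^sup>+x. f (t + x) \<partial>lborel) = (\<integral>\<^sup>+x. f x \<partial>lborel)"
    and "(\<integral>\<^sup>+x. f (t - x) \<partial>lborel) = (\<integral>\<^sup>+x. f x \<partial>lborel)"
  using nn_integral_real_affine[OF assms, of 1 t] nn_integral_real_affine[OF assms, of "-1" t]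
  by (simp_all add: one_ennreal_def[symmetric])

text \<open>For these four \<open>d\<close> the map from (s, u) to the plane only translates,
  reflects or swaps the coordinates, so Fubini suffices and no general rotation occurs. The four
  values are the directions of the sides of a square.\<close>

lemma nn_integral_complex_axis:
  fixes g :: "complex \<Rightarrow> ennreal"
  assumes [measurable]: "g \<in> borel_measurable borel" and d: "d \<in> {1, \<i>, -1, -\<i>}"
  shows "(\<integral>\<^sup>+s. \<integral>\<^sup>+u. g ((z - \<i> * d * of_real s) + of_real u * d) \<partial>lborel \<partial>lborel) = (\<integral>\<^sup>+z. g z \<partial>lborel)"
proof -
  have mC: "(\<lambda>x. Complex (f x) (h x)) \<in> borel_measurable M"
    if "f \<in> borel_measurable M" "h \<in> borel_measurable M" for f h and M :: "'b measure"
    using that by (subst borel_measurable_complex_iff) simp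
  have m1[measurable]: "(\<lambda>x. g (Complex x y)) \<in> borel_measurable borel" for y
    by (intro measurable_compose[OF mC assms(1)]) auto
  have m2[measurable]: "(\<lambda>y. g (Complex x y)) \<in> borel_measurable borel" for x
    by (intro measurable_compose[OF mC assms(1)]) auto
  have m3: "(\<lambda>z. g (Complex (fst z) (snd z))) \<in> borel_measurable (borel \<Otimes>\<^sub>M lborel)"
    by (intro measurable_compose[OF mC assms(1)]) auto
  have m4: "(\<lambda>z. g (Complex (snd z) (fst z))) \<in> borel_measurable (borel \<Otimes>\<^sub>M lborel)"
    by (intro measurable_compose[OF mC assms(1)]) auto
  have m5[measurable]: "(\<lambda>x. \<integral>\<^sup>+y. g (Complex x y) \<partial>lborel) \<in> borel_measurable borel"
    using lborel.borel_measurable_nn_integral_fst[OF m3] by simp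
  have m6[measurable]: "(\<lambda>y. \<integral>\<^sup>+x. g (Complex x y) \<partial>lborel) \<in> borel_measurable borel"
    using lborel.borel_measurable_nn_integral_fst[OF m4] by simp
  consider "d = 1" | "d = \<i>" | "d = -1" | "d = -\<i>" using d by auto
  then show ?thesis
  proof cases
    case 1
    have "(z - \<i> * d * of_real s) + of_real u * d = Complex (Re z + u) (Im z - s)" for s u
      using 1 by (simp add: complex_eq_iff)
    then show ?thesis
      by (simp add: nn_integral_real_isometry[of "\<lambda>x. g (Complex x _)"]
          nn_integral_real_isometry[of "\<lambda>y. \<integral>\<^sup>+x. g (Complex x y) \<partial>lborel"] nn_integral_complex(1))
  next
    case 2
    have "(z - \<i> * d * of_real s) + of_real u * d = Complex (Re z + s) (Im z + u)" for s u
      using 2 by (simp add: complex_eq_iff)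
    then show ?thesis
      by (simp add: nn_integral_real_isometry[of "\<lambda>y. g (Complex _ y)"]
          nn_integral_real_isometry[of "\<lambda>x. \<integral>\<^sup>+y. g (Complex x y) \<partial>lborel"] nn_integral_complex(2))
  next
    case 3
    have "(z - \<i> * d * of_real s) + of_real u * d = Complex (Re z - u) (Im z + s)" for s u
      using 3 by (simp add: complex_eq_iff)
    then show ?thesis
      by (simp add: nn_integral_real_isometry[of "\<lambda>x. g (Complex x _)"]
          nn_integral_real_isometry[of "\<lambda>y. \<integral>\<^sup>+x. g (Complex x y) \<partial>lborel"] nn_integral_complex(1))
  next
    case 4
    have "(z - \<i> * d * of_real s) + of_real u * d = Complex (Re z - s) (Im z - u)" for s u
      using 4 by (simp add: complex_eq_iff)
    then show ?thesis
      by (simp add: nn_integral_real_isometry[of "\<lambda>y. g (Complex _ y)"]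
          nn_integral_real_isometry[of "\<lambda>x. \<integral>\<^sup>+y. g (Complex x y) \<partial>lborel"] nn_integral_complex(2))
  qed
qed

section \<open>Area bounds for holomorphic functions\<close>

lemma holomorphic_imp_borel_measurable_indicator:
  assumes "f holomorphic_on S" "open S"
  shows "(\<lambda>z. indicator S z *\<^sub>R f z) \<in> borel_measurable borel"
  using assms by (intro borel_measurable_continuous_on_indicator holomorphic_on_imp_continuous_on) auto

lemma borel_measurable_norm_powr_indicator:
  assumes "f holomorphic_on S" "open S"
  shows "(\<lambda>z. ennreal (norm (f z) powr p) * indicator S z) \<in> borel_measurable borel"
proof -
  note [measurable] = holomorphic_imp_borel_measurable_indicator[OF assms] borel_open[OF assms(2)]
  have "(\<lambda>z. ennreal (norm (indicator S z *\<^sub>R f z) powr p) * indicator S z) \<in> borel_measurable borel"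
    by measurable
  also have "(\<lambda>z. ennreal (norm (indicator S z *\<^sub>R f z) powr p) * indicator S z)
      = (\<lambda>z. ennreal (norm (f z) powr p) * indicator S z)"
    by (auto simp: indicator_def)
  finally show ?thesis .
qed

text \<open>Cauchy's formula on the boundary of the square with centre \<open>z\<close> and
  half-side \<open>s\<close>; the side with direction \<open>d\<close> has midpoint
  \<open>z - \<i> * d * of_real s\<close>. Squares rather than circles allow the averaging over
  \<open>s\<close> by Fubini in Cartesian coordinates. Boundary points are at distance between
  \<open>s\<close> and \<open>2 * s\<close> from \<open>z\<close>, which gives the factor
  \<open>S\<close> and the condition \<open>2 * s < r\<close>.\<close>

lemma norm_le_nn_integral_square:
  assumes hol: "f holomorphic_on ball z r" and s: "0 < S" "S \<le> s" "2 * s < r"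
  defines "g \<equiv> (\<lambda>w. ennreal (norm (f w)) * indicator (ball z r) w)"
  shows "ennreal (2 * pi * S * norm (f z)) \<le>
     (\<Sum>d\<in>{1, \<i>, -1, -\<i>}. \<integral>\<^sup>+u. g ((z - \<i> * d * of_real s) + of_real u * d) \<partial>lborel)"
proof -
  define c where "c d = z - \<i> * d * of_real s" for d
  define h where "h = (\<lambda>w. f w / (w - z))"
  define L where "L d = linepath (c d - of_real s * d) (c d + of_real s * d)" for d
  have s0: "s > 0" using s by simp
  have seg: "norm (w - z) \<ge> s \<and> w \<in> ball z r"
    if w: "w \<in> closed_segment (c d - of_real s * d) (c d + of_real s * d)" and d: "norm d = 1" for w d
  proof -
    obtain x where x: "0 \<le> x" "x \<le> 1"
      "w = (1 - x) *\<^sub>R (c d - of_real s * d) + x *\<^sub>R (c d + of_real s * d)"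
      using w unfolding in_segment by auto
    have "w - z = Complex ((2 * x - 1) * s) (- s) * d"
      unfolding x(3) c_def by (simp add: complex_eq_iff algebra_simps)
    then have n: "norm (w - z) = norm (Complex ((2 * x - 1) * s) (- s))"
      using d by (simp add: norm_mult)
    have a: "\<bar>(2 * x - 1) * s\<bar> \<le> s"
    proof -
      have "\<bar>2 * x - 1\<bar> * s \<le> 1 * s" using x s0 by (intro mult_right_mono) auto
      then show ?thesis using s0 by (simp add: abs_mult)
    qed
    have "norm (w - z) \<le> \<bar>(2 * x - 1) * s\<bar> + \<bar>s\<bar>"
      unfolding n using cmod_le[of "Complex ((2 * x - 1) * s) (- s)"] by simp
    moreover have "\<bar>- s\<bar> \<le> norm (w - z)"
      unfolding n using abs_Im_le_cmod[of "Complex ((2 * x - 1) * s) (- s)"] by simp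
    ultimately show ?thesis using a s s0 by (auto simp: dist_norm norm_minus_commute)
  qed
  have cont: "continuous_on (closed_segment (c d - of_real s * d) (c d + of_real s * d)) h"
    if "norm d = 1" for d
    unfolding h_def using seg[OF _ that] s0
    by (intro continuous_intros continuous_on_subset[OF holomorphic_on_imp_continuous_on[OF hol]])
       force+
  have bound: "ennreal (norm (contour_integral (L d) h))
      \<le> ennreal (1 / S) * (\<integral>\<^sup>+u. g (c d + of_real u * d) \<partial>lborel)" if d: "norm d = 1" for d
  proof -
    have "ennreal (norm (contour_integral (L d) h))
      \<le> (\<integral>\<^sup>+u\<in>{-s..s}. ennreal (norm (h (c d + of_real u * d))) \<partial>lborel)"
      unfolding L_def by (rule norm_contour_integral_linepath_le_nn_integral[OF cont[OF d] d s0])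
    also have "\<dots> \<le> (\<integral>\<^sup>+u. ennreal (1 / S) * g (c d + of_real u * d) \<partial>lborel)"
    proof (intro nn_integral_mono)
      fix u :: real
      show "ennreal (norm (h (c d + of_real u * d))) * indicator {-s..s} u
        \<le> ennreal (1 / S) * g (c d + of_real u * d)"
      proof (cases "u \<in> {-s..s}")
        case True
        define w where "w = c d + of_real u * d"
        have "w \<in> closed_segment (c d - of_real s * d) (c d + of_real s * d)"
          unfolding in_segment
        proof (intro exI[of _ "(u + s) / (2 * s)"] conjI)
          show "w = (1 - (u + s) / (2 * s)) *\<^sub>R (c d - of_real s * d) + ((u + s) / (2 * s)) *\<^sub>R (c d + of_real s * d)"
            using s0 by (simp add: w_def scaleR_conv_of_real field_simps)
        qed (use True s0 in auto)
        from seg[OF this d] have w: "norm (w - z) \<ge> s" "w \<in> ball z r" by auto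
        have "norm (h w) \<le> 1 / S * norm (f w)"
          using w s frac_le[of "norm (f w)" "norm (f w)" S "norm (w - z)"]
          by (simp add: h_def norm_divide)
        then show ?thesis using w True s
          by (simp add: g_def w_def[symmetric] ennreal_mult'[symmetric] ennreal_leI)
      qed auto
    qed
    also have "\<dots> = ennreal (1 / S) * (\<integral>\<^sup>+u. g (c d + of_real u * d) \<partial>lborel)"
    proof (rule nn_integral_cmult)
      have "(\<lambda>w. ennreal (norm (f w) powr 1) * indicator (ball z r) w) \<in> borel_measurable borel"
        by (rule borel_measurable_norm_powr_indicator[OF hol]) simp
      then have [measurable]: "g \<in> borel_measurable borel" by (simp add: g_def)
      show "(\<lambda>u. g (c d + of_real u * d)) \<in> borel_measurable lborel"
        by measurable
    qed
    finally show ?thesis .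
  qed
  define P where "P = rectpath (z - Complex s s) (z + Complex s s)"
  have Peq: "P = L 1 +++ L \<i> +++ L (-1) +++ L (-\<i>)"
    unfolding P_def rectpath_def L_def c_def Let_def
    by (intro arg_cong2[of _ _ _ _ joinpaths] arg_cong2[of _ _ _ _ linepath])
       (simp_all add: complex_eq_iff)
  have box: "z \<in> box (z - Complex s s) (z + Complex s s)" using s0 by (simp add: in_box_complex_iff)
  have pimg: "path_image P \<subseteq> ball z r - {z}"
  proof -
    have "path_image P = (\<Union>d\<in>{1, \<i>, -1, -\<i>}. path_image (L d))"
      unfolding Peq by (simp add: path_image_join L_def c_def algebra_simps Un_assoc)
    moreover have "path_image (L d) \<subseteq> ball z r - {z}" if "norm d = 1" for d
      using seg[OF _ that] s0 by (force simp: L_def)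
    ultimately show ?thesis by auto
  qed
  have "(h has_contour_integral (2 * pi * \<i> * winding_number P z * f z)) P"
    unfolding h_def
    by (rule Cauchy_integral_formula_convex_simple[OF convex_ball hol])
       (use pimg s s0 in \<open>auto simp: P_def\<close>)
  moreover have "winding_number P z = 1" unfolding P_def by (rule winding_number_rectpath[OF box])
  ultimately have "contour_integral P h = 2 * pi * \<i> * f z" by (simp add: contour_integral_unique)
  moreover have "contour_integral P h
      = contour_integral (L 1) h + (contour_integral (L \<i>) h + (contour_integral (L (-1)) h + contour_integral (L (-\<i>)) h))"
  proof -
    have ci: "h contour_integrable_on L d" if "norm d = 1" for d
      unfolding L_def by (rule contour_integrable_continuous_linepath[OF cont[OF that]])
    have ends: "pathfinish (L 1) = pathstart (L \<i>)" "pathfinish (L \<i>) = pathstart (L (-1))"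
      "pathfinish (L (-1)) = pathstart (L (-\<i>))" by (simp_all add: L_def c_def algebra_simps)
    have vp: "valid_path (L d)" for d by (simp add: L_def)
    show ?thesis unfolding Peq
      using ci[of 1] ci[of \<i>] ci[of "-1"] ci[of "-\<i>"] ends vp
      by (simp add: contour_integrable_joinI valid_path_join)
  qed
  ultimately have "2 * pi * norm (f z) \<le> norm (contour_integral (L 1) h) + (norm (contour_integral (L \<i>) h)
      + (norm (contour_integral (L (-1)) h) + norm (contour_integral (L (-\<i>)) h)))"
  proof -
    have "2 * pi * norm (f z) = norm (2 * pi * \<i> * f z)" by (simp add: norm_mult)
    also have "\<dots> = norm (contour_integral (L 1) h + (contour_integral (L \<i>) h + (contour_integral (L (-1)) h + contour_integral (L (-\<i>)) h)))"
      using \<open>contour_integral P h = 2 * pi * \<i> * f z\<close> \<open>contour_integral P h = _ + _\<close> by simp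
    finally show ?thesis by (metis add_left_mono norm_triangle_mono order_refl)
  qed
  also have "\<dots> = (\<Sum>d\<in>{1, \<i>, -1, -\<i>}. norm (contour_integral (L d) h))"
  proof -
    have "\<i> \<noteq> -1" "(1::complex) \<noteq> -\<i>" "1 \<noteq> \<i>" "\<i> \<noteq> - \<i>" "(-1::complex) \<noteq> -\<i>" "(1::complex) \<noteq> -1"
      by (auto simp: complex_eq_iff)
    then show ?thesis by simp
  qed
  finally have "ennreal (2 * pi * norm (f z)) \<le> ennreal (\<Sum>d\<in>{1, \<i>, -1, -\<i>}. norm (contour_integral (L d) h))"
    by (rule ennreal_leI)
  also have "\<dots> = (\<Sum>d\<in>{1, \<i>, -1, -\<i>}. ennreal (norm (contour_integral (L d) h)))"
    by (rule sum_ennreal[symmetric]) auto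
  also have "\<dots> \<le> (\<Sum>d\<in>{1, \<i>, -1, -\<i>}. ennreal (1 / S) * (\<integral>\<^sup>+u. g (c d + of_real u * d) \<partial>lborel))"
    by (rule sum_mono) (auto intro!: bound)
  also have "\<dots> = ennreal (1 / S) * (\<Sum>d\<in>{1, \<i>, -1, -\<i>}. \<integral>\<^sup>+u. g (c d + of_real u * d) \<partial>lborel)"
    by (rule sum_distrib_left[symmetric])
  finally have "ennreal S * ennreal (2 * pi * norm (f z))
      \<le> ennreal S * (ennreal (1 / S) * (\<Sum>d\<in>{1, \<i>, -1, -\<i>}. \<integral>\<^sup>+u. g (c d + of_real u * d) \<partial>lborel))"
    by (rule mult_left_mono) auto
  also have "\<dots> = (ennreal S * ennreal (1 / S)) * (\<Sum>d\<in>{1, \<i>, -1, -\<i>}. \<integral>\<^sup>+u. g (c d + of_real u * d) \<partial>lborel)"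
    by (simp only: mult.assoc)
  also have "ennreal S * ennreal (1 / S) = 1"
    using s by (simp add: ennreal_mult'[symmetric])
  also have "ennreal S * ennreal (2 * pi * norm (f z)) = ennreal (2 * pi * S * norm (f z))"
    using s by (simp add: ennreal_mult'[symmetric] mult_ac)
  finally show ?thesis by (simp add: c_def)
qed

text \<open>The square bound is averaged over \<open>s\<close> from \<open>S\<close> to
  \<open>2 * S\<close>. Each of the four sides then sweeps out an area, and each sweep costs at most
  the integral over the whole disc.\<close>

lemma holomorphic_L1_bound:
  assumes hol: "f holomorphic_on ball z r" and r: "0 < r"
  shows "ennreal (r\<^sup>2 * norm (f z)) \<le> 16 * (\<integral>\<^sup>+w\<in>ball z r. ennreal (norm (f w)) \<partial>lborel)"
proof -
  define g where "g = (\<lambda>w. ennreal (norm (f w)) * indicator (ball z r) w)"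
  have "(\<lambda>w. ennreal (norm (f w) powr 1) * indicator (ball z r) w) \<in> borel_measurable borel"
    by (rule borel_measurable_norm_powr_indicator[OF hol]) simp
  then have g[measurable]: "g \<in> borel_measurable borel" by (simp add: g_def)
  \<comment> \<open>The largest square has half-side \<open>2 * S\<close> and needs
    \<open>4 * S < r\<close>. With a fifth of \<open>r\<close> the factor \<open>8 * pi / 25\<close>
    still exceeds 1, so the constant 16, a product of two factors 4, is enough.\<close>
  define S where "S = r / 5"
  have S: "S > 0" using r by (simp add: S_def)
  have meas: "(\<lambda>s. \<integral>\<^sup>+u. g ((z - \<i> * d * of_real s) + of_real u * d) \<partial>lborel) \<in> borel_measurable lborel" for d
    by measurable
  have "ennreal S * ennreal (2 * pi * S * norm (f z)) = (\<integral>\<^sup>+s\<in>{S..2 * S}. ennreal (2 * pi * S * norm (f z)) \<partial>lborel)"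
    using S by (subst nn_integral_cmult_indicator) (auto simp: mult.commute)
  also have "\<dots> \<le> (\<integral>\<^sup>+s. (\<Sum>d\<in>{1, \<i>, -1, -\<i>}. \<integral>\<^sup>+u. g ((z - \<i> * d * of_real s) + of_real u * d) \<partial>lborel) \<partial>lborel)"
  proof (rule nn_integral_mono)
    fix s show "ennreal (2 * pi * S * norm (f z)) * indicator {S..2 * S} s
       \<le> (\<Sum>d\<in>{1, \<i>, -1, -\<i>}. \<integral>\<^sup>+u. g ((z - \<i> * d * of_real s) + of_real u * d) \<partial>lborel)"
    proof (cases "s \<in> {S..2 * S}")
      case True
      then show ?thesis
        using norm_le_nn_integral_square[OF hol S, of s] r unfolding g_def by (auto simp: S_def)
    qed auto
  qed
  also have "\<dots> = (\<Sum>d\<in>{1, \<i>, -1, -\<i>}. \<integral>\<^sup>+s. \<integral>\<^sup>+u. g ((z - \<i> * d * of_real s) + of_real u * d) \<partial>lborel \<partial>lborel)"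
    by (rule nn_integral_sum) (rule meas)
  also have "\<dots> = (\<Sum>d\<in>{1, \<i>, -1, -\<i>::complex}. \<integral>\<^sup>+w. g w \<partial>lborel)"
    by (rule sum.cong[OF refl], rule nn_integral_complex_axis[OF g])
  also have "\<dots> \<le> 4 * (\<integral>\<^sup>+w. g w \<partial>lborel)"
  proof -
    have "card {1, \<i>, -1, -\<i>} \<le> 4" by (intro card_insert_le_m1) auto
    then have "of_nat (card {1, \<i>, -1, -\<i>}) \<le> (of_nat 4 :: ennreal)" by (rule of_nat_mono)
    then have "of_nat (card {1, \<i>, -1, -\<i>}) * (\<integral>\<^sup>+w. g w \<partial>lborel) \<le> of_nat 4 * (\<integral>\<^sup>+w. g w \<partial>lborel)"
      by (rule mult_right_mono) auto
    then show ?thesis by simp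
  qed
  finally have *: "ennreal S * ennreal (2 * pi * S * norm (f z)) \<le> 4 * (\<integral>\<^sup>+w. g w \<partial>lborel)" .
  have "r\<^sup>2 * norm (f z) \<le> 4 * (S * (2 * pi * S * norm (f z)))"
  proof -
    have "r\<^sup>2 * 1 \<le> r\<^sup>2 * (8 * pi / 25)"
      using pi_approx by (intro mult_left_mono) auto
    then have "r\<^sup>2 * 1 * norm (f z) \<le> r\<^sup>2 * (8 * pi / 25) * norm (f z)"
      by (intro mult_right_mono) auto
    then show ?thesis by (simp add: S_def power2_eq_square field_simps)
  qed
  then have "ennreal (r\<^sup>2 * norm (f z)) \<le> 4 * (ennreal S * ennreal (2 * pi * S * norm (f z)))"
    using S
    by (subst (asm) ennreal_le_iff[symmetric], simp, subst (asm) (2) ennreal_mult', simp,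
        subst (asm) (2) ennreal_mult', simp_all only: ennreal_numeral)
  also have "\<dots> \<le> 4 * (4 * (\<integral>\<^sup>+w. g w \<partial>lborel))" by (rule mult_left_mono[OF *]) simp
  finally show ?thesis by (simp add: g_def mult.assoc[symmetric])
qed

text \<open>Hoelder's inequality against the constant 1 on the disc, whose area
  \<open>pi * r\<^sup>2\<close> plays the role of \<open>B\<close> in \<open>hoelder_bound\<close>.
  The powers of \<open>r\<close> combine to the single factor that makes the bound scale
  invariant.\<close>

lemma holomorphic_Lp_bound:
  assumes hol: "f holomorphic_on ball z r" and r: "0 < r" and p: "1 < p"
  shows "ennreal (r\<^sup>2 * norm (f z) powr p)
    \<le> ennreal (16 powr p * pi powr (p - 1)) * (\<integral>\<^sup>+w\<in>ball z r. ennreal (norm (f w) powr p) \<partial>lborel)"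
proof -
  define q where "q = p / (p - 1)"
  have q: "1 < q" "1 / p + 1 / q = 1" using p by (auto simp: q_def field_simps)
  define X where "X w = norm (indicator (ball z r) w *\<^sub>R f w)" for w
  note [measurable] = holomorphic_imp_borel_measurable_indicator[OF hol open_ball]
  define c where "c = r\<^sup>2 * norm (f z) / 16"
  have XY: "(\<integral>\<^sup>+w. ennreal (X w * indicator (ball z r) w) \<partial>lborel)
      = (\<integral>\<^sup>+w\<in>ball z r. ennreal (norm (f w)) \<partial>lborel)"
    by (intro nn_integral_cong) (auto simp: X_def indicator_def)
  have Xp: "(\<integral>\<^sup>+w. ennreal (X w powr p) \<partial>lborel)
      = (\<integral>\<^sup>+w\<in>ball z r. ennreal (norm (f w) powr p) \<partial>lborel)"
    using p by (intro nn_integral_cong) (auto simp: X_def indicator_def)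
  have "ennreal (c powr p) \<le> ennreal ((pi * r\<^sup>2) powr (p - 1)) * (\<integral>\<^sup>+w. ennreal (X w powr p) \<partial>lborel)"
  proof (rule hoelder_bound[OF p q])
    show "ennreal c \<le> (\<integral>\<^sup>+w. ennreal (X w * indicator (ball z r) w) \<partial>lborel)"
    proof -
      have "ennreal 16 * ennreal c \<le> ennreal 16 * (\<integral>\<^sup>+w\<in>ball z r. ennreal (norm (f w)) \<partial>lborel)"
      proof -
        have "ennreal 16 * ennreal c = ennreal (r\<^sup>2 * norm (f z))"
          by (subst ennreal_mult'[symmetric]) (auto simp: c_def)
        then show ?thesis using holomorphic_L1_bound[OF hol r] by simp
      qed
      then show ?thesis unfolding XY by (subst (asm) ennreal_mult_le_mult_iff) auto
    qed
    have "(\<integral>\<^sup>+w. ennreal (indicator (ball z r) w powr q) \<partial>lborel) = (\<integral>\<^sup>+w. indicator (ball z r) w \<partial>lborel)"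
      by (intro nn_integral_cong) (auto simp: indicator_def)
    also have "\<dots> = ennreal (pi * r\<^sup>2)"
      using r by (simp add: emeasure_ball unit_ball_vol_2)
    finally show "(\<integral>\<^sup>+w. ennreal (indicator (ball z r) w powr q) \<partial>lborel) \<le> ennreal (pi * r\<^sup>2)" by simp
    show "X \<in> borel_measurable lborel" unfolding X_def by measurable
    show "(indicator (ball z r) :: complex \<Rightarrow> real) \<in> borel_measurable lborel"
      by (intro borel_measurable_indicator) simp
  qed (use r in \<open>auto simp: X_def c_def\<close>)
  then have *: "ennreal (c powr p) \<le> ennreal ((pi * r\<^sup>2) powr (p - 1)) * (\<integral>\<^sup>+w\<in>ball z r. ennreal (norm (f w) powr p) \<partial>lborel)"
    unfolding Xp .
  define k where "k = 16 powr p * (r\<^sup>2) powr (1 - p)"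
  have k: "k > 0" using r by (simp add: k_def)
  have "r\<^sup>2 * norm (f z) powr p = k * c powr p"
    using r by (simp add: k_def c_def powr_mult powr_divide powr_diff)
  then have "ennreal (r\<^sup>2 * norm (f z) powr p) = ennreal k * ennreal (c powr p)"
    using k by (simp add: ennreal_mult')
  also have "\<dots> \<le> ennreal k * (ennreal ((pi * r\<^sup>2) powr (p - 1)) * (\<integral>\<^sup>+w\<in>ball z r. ennreal (norm (f w) powr p) \<partial>lborel))"
    by (rule mult_left_mono[OF *]) simp
  also have "\<dots> = ennreal (k * (pi * r\<^sup>2) powr (p - 1)) * (\<integral>\<^sup>+w\<in>ball z r. ennreal (norm (f w) powr p) \<partial>lborel)"
    using k by (simp add: ennreal_mult' mult.assoc)
  also have "k * (pi * r\<^sup>2) powr (p - 1) = 16 powr p * pi powr (p - 1)"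
    using r by (simp add: k_def powr_mult powr_diff)
  finally show ?thesis .
qed

section \<open>Integral estimates for the ray kernel\<close>

lemma nn_integral_abs_le:
  fixes g :: "real \<Rightarrow> ennreal"
  assumes [measurable]: "g \<in> borel_measurable borel"
  shows "(\<integral>\<^sup>+x. g \<bar>x\<bar> \<partial>lborel) \<le> 2 * (\<integral>\<^sup>+x\<in>{0..}. g x \<partial>lborel)"
proof -
  have "(\<integral>\<^sup>+x. g \<bar>x\<bar> \<partial>lborel)
      \<le> (\<integral>\<^sup>+x. g x * indicator {0..} x + g (0 - x) * indicator {0..} (0 - x) \<partial>lborel)"
    by (intro nn_integral_mono) (auto simp: indicator_def abs_if)
  also have "\<dots> = (\<integral>\<^sup>+x\<in>{0..}. g x \<partial>lborel) + (\<integral>\<^sup>+x. g (0 - x) * indicator {0..} (0 - x) \<partial>lborel)"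
    by (rule nn_integral_add) measurable
  also have "(\<integral>\<^sup>+x. g (0 - x) * indicator {0..} (0 - x) \<partial>lborel) = (\<integral>\<^sup>+x\<in>{0..}. g x \<partial>lborel)"
    by (rule nn_integral_real_isometry(2)[of "\<lambda>x. g x * indicator {0..} x" 0]) measurable
  finally show ?thesis by (simp add: mult_2)
qed

lemma nn_integral_complex_product:
  fixes g :: "real \<Rightarrow> ennreal"
  assumes [measurable]: "g \<in> borel_measurable borel"
  shows "(\<integral>\<^sup>+z. g (Re z) * g (Im z) \<partial>lborel) = (\<integral>\<^sup>+x. g x \<partial>lborel) * (\<integral>\<^sup>+x. g x \<partial>lborel)"
  by (subst nn_integral_complex) (simp_all add: nn_integral_cmult nn_integral_multc)

lemma nn_integral_powr_unit_interval:
  fixes a :: real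
  assumes "a > -1"
  shows "(\<integral>\<^sup>+x\<in>{0..1}. ennreal (x powr a) \<partial>lborel) < \<infinity>"
proof -
  have "(\<integral>\<^sup>+x. ennreal (x powr a) * indicator {0..1} x \<partial>lborel) = ennreal (1 powr (a + 1) / (a + 1))"
    by (rule nn_integral_has_integral_lebesgue'[OF _ has_integral_powr_from_0]) (use assms in auto)
  then show ?thesis by simp
qed

lemma nn_integral_powr_tail:
  fixes e :: real
  assumes "e < -1"
  shows "(\<integral>\<^sup>+x\<in>{0..}. ennreal ((1 + x) powr e) \<partial>lborel) < \<infinity>"
proof -
  define F where "F y = ennreal (y powr e) * indicator {1..} y" for y :: real
  have [measurable]: "F \<in> borel_measurable borel" unfolding F_def by measurable
  have "(\<integral>\<^sup>+x\<in>{0..}. ennreal ((1 + x) powr e) \<partial>lborel) = (\<integral>\<^sup>+x. F (1 + x) \<partial>lborel)"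
    by (intro nn_integral_cong) (auto simp: F_def indicator_def)
  also have "\<dots> = (\<integral>\<^sup>+x. F x \<partial>lborel)" by (rule nn_integral_real_isometry) measurable
  also have "\<dots> = ennreal (- (1 powr (e + 1)) / (e + 1))" unfolding F_def
    by (rule nn_integral_has_integral_lebesgue'[OF _ has_integral_powr_to_inf]) (use assms in auto)
  finally show ?thesis by simp
qed

text \<open>Since \<open>norm z\<close> dominates both coordinates, the integrand is at most a
  product of one-variable powers with exponent \<open>- \<kappa> / 2\<close>, which is above
  -1.\<close>

lemma nn_integral_norm_powr_unit_ball:
  fixes \<kappa> :: real
  assumes k: "0 < \<kappa>" "\<kappa> < 2"
  shows "(\<integral>\<^sup>+z\<in>ball (0::complex) 1. ennreal (norm z powr - \<kappa>) \<partial>lborel) < \<infinity>"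
proof -
  \<comment> \<open>A real power of 0 has the default value 0, so the product bound would fail on
    the two axes. The value \<infinity> at 0 repairs this and does not change the integral.\<close>
  define g :: "real \<Rightarrow> ennreal" where
    "g x = ennreal (x powr (- \<kappa> / 2)) * indicator {0..1} x + \<infinity> * indicator {0} x" for x
  have [measurable]: "g \<in> borel_measurable borel" unfolding g_def by measurable
  have "(\<integral>\<^sup>+x\<in>{0..}. g x \<partial>lborel) \<le> (\<integral>\<^sup>+x. g x \<partial>lborel)"
    by (intro nn_integral_mono) (auto simp: indicator_def)
  also have "\<dots> = (\<integral>\<^sup>+x\<in>{0..1}. ennreal (x powr (- \<kappa> / 2)) \<partial>lborel)"
    unfolding g_def by (subst nn_integral_add) (auto simp: nn_integral_cmult_indicator)
  also have "\<dots> < \<infinity>" using nn_integral_powr_unit_interval[of "- \<kappa> / 2"] k by simp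
  finally have fin: "(\<integral>\<^sup>+x. g \<bar>x\<bar> \<partial>lborel) < \<infinity>"
    by (intro le_less_trans[OF nn_integral_abs_le]) (simp_all add: ennreal_mult_less_top)
  have "(\<integral>\<^sup>+z\<in>ball (0::complex) 1. ennreal (norm z powr - \<kappa>) \<partial>lborel)
      \<le> (\<integral>\<^sup>+z. g \<bar>Re z\<bar> * g \<bar>Im z\<bar> \<partial>lborel)"
  proof (intro nn_integral_mono)
    fix z :: complex
    show "ennreal (norm z powr - \<kappa>) * indicator (ball 0 1) z \<le> g \<bar>Re z\<bar> * g \<bar>Im z\<bar>"
    proof (cases "norm z < 1 \<and> z \<noteq> 0")
      case True
      then have b: "\<bar>Re z\<bar> < 1" "\<bar>Im z\<bar> < 1" using abs_Re_le_cmod[of z] abs_Im_le_cmod[of z] by auto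
      have g0: "g x \<noteq> 0" if "x \<ge> 0" "x < 1" for x
        using that by (auto simp: g_def indicator_def)
      show ?thesis
      proof (cases "Re z = 0 \<or> Im z = 0")
        case True
        then have "g \<bar>Re z\<bar> * g \<bar>Im z\<bar> = \<infinity>"
        proof
          assume "Re z = 0" then have "g \<bar>Re z\<bar> = \<infinity>" by (simp add: g_def)
          then show ?thesis using g0[of "\<bar>Im z\<bar>"] b by (simp add: ennreal_top_mult)
        next
          assume "Im z = 0" then have "g \<bar>Im z\<bar> = \<infinity>" by (simp add: g_def)
          then show ?thesis using g0[of "\<bar>Re z\<bar>"] b by (simp add: ennreal_mult_top)
        qed
        then show ?thesis by simp
      next
        case False
        have "norm z powr - \<kappa> = norm z powr (- \<kappa> / 2) * norm z powr (- \<kappa> / 2)"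
          by (simp add: powr_add[symmetric])
        also have "\<dots> \<le> \<bar>Re z\<bar> powr (- \<kappa> / 2) * \<bar>Im z\<bar> powr (- \<kappa> / 2)"
          using False k by (intro mult_mono powr_mono2' abs_Re_le_cmod abs_Im_le_cmod) auto
        finally show ?thesis using False True b
          by (simp add: g_def ennreal_mult[symmetric] ennreal_leI)
      qed
    qed (auto simp: indicator_def)
  qed
  also have "\<dots> = (\<integral>\<^sup>+x. g \<bar>x\<bar> \<partial>lborel) * (\<integral>\<^sup>+x. g \<bar>x\<bar> \<partial>lborel)"
    by (rule nn_integral_complex_product) measurable
  also have "\<dots> < \<infinity>" using fin by (simp add: ennreal_mult_less_top)
  finally show ?thesis .
qed

lemma nn_integral_norm_powr_plane:
  fixes s :: real
  assumes s: "s > 2"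
  shows "(\<integral>\<^sup>+z. ennreal ((1 + norm (z::complex)) powr - s) \<partial>lborel) < \<infinity>"
proof -
  define g :: "real \<Rightarrow> ennreal" where "g x = ennreal ((1 + x) powr (- s / 2))" for x
  have [measurable]: "g \<in> borel_measurable borel" unfolding g_def by measurable
  have "(\<integral>\<^sup>+x\<in>{0..}. g x \<partial>lborel) < \<infinity>"
    unfolding g_def by (rule nn_integral_powr_tail) (use s in auto)
  then have fin: "(\<integral>\<^sup>+x. g \<bar>x\<bar> \<partial>lborel) < \<infinity>"
    by (intro le_less_trans[OF nn_integral_abs_le]) (simp_all add: ennreal_mult_less_top)
  have "(\<integral>\<^sup>+z. ennreal ((1 + norm (z::complex)) powr - s) \<partial>lborel)
      \<le> (\<integral>\<^sup>+z. g \<bar>Re z\<bar> * g \<bar>Im z\<bar> \<partial>lborel)"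
  proof (intro nn_integral_mono)
    fix z :: complex
    have "(1 + norm z) powr - s = (1 + norm z) powr (- s / 2) * (1 + norm z) powr (- s / 2)"
      by (simp add: powr_add[symmetric])
    also have "\<dots> \<le> (1 + \<bar>Re z\<bar>) powr (- s / 2) * (1 + \<bar>Im z\<bar>) powr (- s / 2)"
      using s by (intro mult_mono powr_mono2' add_left_mono abs_Re_le_cmod abs_Im_le_cmod) auto
    finally show "ennreal ((1 + norm z) powr - s) \<le> g \<bar>Re z\<bar> * g \<bar>Im z\<bar>"
      by (simp add: g_def ennreal_mult[symmetric] ennreal_leI)
  qed
  also have "\<dots> = (\<integral>\<^sup>+x. g \<bar>x\<bar> \<partial>lborel) * (\<integral>\<^sup>+x. g \<bar>x\<bar> \<partial>lborel)"
    by (rule nn_integral_complex_product) measurable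
  also have "\<dots> < \<infinity>" using fin by (simp add: ennreal_mult_less_top)
  finally show ?thesis .
qed

lemma nn_integral_complex_affine:
  fixes g :: "complex \<Rightarrow> ennreal"
  assumes [measurable]: "g \<in> borel_measurable borel" and t: "t > 0"
  shows "(\<integral>\<^sup>+z. g z \<partial>lborel) = ennreal (t\<^sup>2) * (\<integral>\<^sup>+z. g (a + t *\<^sub>R z) \<partial>lborel)"
proof -
  have "(\<integral>\<^sup>+z. g z \<partial>lborel) = (\<integral>\<^sup>+z. g z \<partial>density (distr lborel borel (\<lambda>x. a + t *\<^sub>R x)) (\<lambda>_. \<bar>t\<bar>^DIM(complex)))"
    using lborel_affine[of t a] t by simp
  also have "\<dots> = (\<integral>\<^sup>+z. ennreal (t\<^sup>2) * g (a + t *\<^sub>R z) \<partial>lborel)"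
    by (subst nn_integral_density) (auto simp: nn_integral_distr)
  also have "\<dots> = ennreal (t\<^sup>2) * (\<integral>\<^sup>+z. g (a + t *\<^sub>R z) \<partial>lborel)"
    by (rule nn_integral_cmult) measurable
  finally show ?thesis .
qed

text \<open>The exponents are those of local integrability in the plane at 0 and at
  \<open>e\<close>, where 1 and \<kappa> are below 2, and of integrability at infinity, where
  \<open>1 + \<kappa> + m\<close> is above 2.\<close>

lemma nn_integral_two_poles:
  fixes e :: complex and \<kappa> m :: real
  assumes e: "norm e = 1" and k: "0 < \<kappa>" "\<kappa> < 2" "0 \<le> m" "\<kappa> + m > 1"
  shows "(\<integral>\<^sup>+z. ennreal (norm z powr -1 * norm (z - e) powr - \<kappa> * (1 + norm z) powr - m) \<partial>lborel) < \<infinity>"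
proof -
  \<comment> \<open>One summand per region. Near 0 the distance to \<open>e\<close> is at least 1/2,
    near \<open>e\<close> the norm is at least 1/2, and away from both
    \<open>u \<ge> (1 + u) / 3\<close> and \<open>v \<ge> (1 + u) / 5\<close>.\<close>
  define C where "C = 2 powr \<kappa> + 2 + 3 * 5 powr \<kappa>"
  have C: "2 powr \<kappa> \<le> C" "2 \<le> C" "3 * 5 powr \<kappa> \<le> C" "C > 0" by (auto simp: C_def add_pos_nonneg)
  define G1 where "G1 z = ennreal (norm z powr -1) * indicator (ball 0 1) z" for z :: complex
  define G2 where "G2 z = ennreal (norm z powr - \<kappa>) * indicator (ball 0 1) z" for z :: complex
  define G3 where "G3 z = ennreal ((1 + norm z) powr - (1 + \<kappa> + m))" for z :: complex
  have [measurable]: "ball (0::complex) 1 \<in> sets borel" by simp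
  have [measurable]: "G1 \<in> borel_measurable borel" "G2 \<in> borel_measurable borel" "G3 \<in> borel_measurable borel"
    unfolding G1_def G2_def G3_def by measurable
  have fin: "(\<integral>\<^sup>+z. G1 z \<partial>lborel) < \<infinity>" "(\<integral>\<^sup>+z. G2 z \<partial>lborel) < \<infinity>" "(\<integral>\<^sup>+z. G3 z \<partial>lborel) < \<infinity>"
    unfolding G1_def G2_def G3_def
    using nn_integral_norm_powr_unit_ball[of 1] nn_integral_norm_powr_unit_ball[OF k(1,2)]
      nn_integral_norm_powr_plane[of "1 + \<kappa> + m"] k by auto
  have "(\<integral>\<^sup>+z. ennreal (norm z powr -1 * norm (z - e) powr - \<kappa> * (1 + norm z) powr - m) \<partial>lborel)
      \<le> (\<integral>\<^sup>+z. ennreal C * (G1 z + G2 (- e + 1 *\<^sub>R z) + G3 z) \<partial>lborel)"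
  proof (intro nn_integral_mono)
    fix z :: complex
    define u where "u = norm z"
    define v where "v = norm (z - e)"
    have uv: "u \<ge> 0" "v \<ge> 0" "u + v \<ge> 1" "u \<le> v + 1"
      using e norm_triangle_ineq2[of z "z - e"] norm_triangle_ineq4[of z "z - e"] norm_triangle_ineq[of "z - e" e]
      by (auto simp: u_def v_def)
    have m1: "(1 + u) powr - m \<le> 1" using uv k by (simp add: powr_minus field_simps ge_one_powr_ge_zero)
    have G: "ennreal (u powr -1) * indicator {..<1} u \<le> G1 z"
      "ennreal (v powr - \<kappa>) * indicator {..<1} v \<le> G2 (- e + 1 *\<^sub>R z)"
      "ennreal ((1 + u) powr - (1 + \<kappa> + m)) \<le> G3 z"
      by (auto simp: G1_def G2_def G3_def u_def v_def indicator_def)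
    consider "u \<le> 1/2" | "v \<le> 1/2" | "u > 1/2" "v > 1/2" by linarith
    then have "ennreal (u powr -1 * v powr - \<kappa> * (1 + u) powr - m) \<le> ennreal C * (G1 z + G2 (- e + 1 *\<^sub>R z) + G3 z)"
    proof cases
      case 1
      have "v powr - \<kappa> \<le> (1/2) powr - \<kappa>" using 1 uv k by (intro powr_mono2') auto
      also have "\<dots> = 2 powr \<kappa>" by (simp add: powr_minus powr_divide)
      finally have "u powr -1 * v powr - \<kappa> * (1 + u) powr - m \<le> u powr -1 * C * 1"
        using m1 C(1,4) uv by (intro mult_mono) auto
      then have "ennreal (u powr -1 * v powr - \<kappa> * (1 + u) powr - m) \<le> ennreal C * ennreal (u powr -1)"
        using C by (simp add: ennreal_mult'[symmetric] mult.commute ennreal_leI)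
      also have "\<dots> \<le> ennreal C * (G1 z + G2 (- e + 1 *\<^sub>R z) + G3 z)"
        using G(1) 1 by (intro mult_left_mono add_increasing2) auto
      finally show ?thesis .
    next
      case 2
      have "u powr - 1 \<le> (1/2) powr - 1" using 2 uv by (intro powr_mono2') auto
      also have "\<dots> = 2" by (simp add: powr_minus)
      finally have "u powr -1 * v powr - \<kappa> * (1 + u) powr - m \<le> C * v powr - \<kappa> * 1"
        using m1 C(2,4) uv by (intro mult_mono) auto
      then have "ennreal (u powr -1 * v powr - \<kappa> * (1 + u) powr - m) \<le> ennreal C * ennreal (v powr - \<kappa>)"
        using C by (simp add: ennreal_mult'[symmetric] ennreal_leI)
      also have "\<dots> \<le> ennreal C * (G1 z + G2 (- e + 1 *\<^sub>R z) + G3 z)"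
        using G(2) 2 by (intro mult_left_mono add_increasing2[OF _ add_increasing]) auto
      finally show ?thesis .
    next
      case 3
      have "u powr - 1 \<le> ((1 + u) / 3) powr - 1" using 3 by (intro powr_mono2') auto
      also have "\<dots> = 3 * (1 + u) powr - 1" using 3 by (simp add: powr_minus field_simps)
      finally have a: "u powr - 1 \<le> 3 * (1 + u) powr - 1" .
      have "v powr - \<kappa> \<le> ((1 + u) / 5) powr - \<kappa>" using 3 uv k by (intro powr_mono2') auto
      also have "\<dots> = 5 powr \<kappa> * (1 + u) powr - \<kappa>" using 3 by (simp add: powr_minus powr_divide field_simps)
      finally have "u powr -1 * v powr - \<kappa> * (1 + u) powr - m
          \<le> (3 * (1 + u) powr - 1) * (5 powr \<kappa> * (1 + u) powr - \<kappa>) * (1 + u) powr - m"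
        using a by (intro mult_mono) auto
      also have "\<dots> = (3 * 5 powr \<kappa>) * (1 + u) powr - (1 + \<kappa> + m)"
      proof -
        have "- (1 + \<kappa> + m) = - 1 + - \<kappa> + - m" by simp
        then have "(1 + u) powr - (1 + \<kappa> + m) = (1 + u) powr - 1 * (1 + u) powr - \<kappa> * (1 + u) powr - m"
          by (simp only: powr_add)
        then show ?thesis by (simp only: mult_ac)
      qed
      also have "\<dots> \<le> C * (1 + u) powr - (1 + \<kappa> + m)" using C by (intro mult_right_mono) auto
      finally have "ennreal (u powr -1 * v powr - \<kappa> * (1 + u) powr - m) \<le> ennreal C * ennreal ((1 + u) powr - (1 + \<kappa> + m))"
        using C by (simp add: ennreal_mult'[symmetric] ennreal_leI)
      also have "\<dots> \<le> ennreal C * (G1 z + G2 (- e + 1 *\<^sub>R z) + G3 z)"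
        using G(3) by (intro mult_left_mono add_increasing) auto
      finally show ?thesis .
    qed
    then show "ennreal (norm z powr -1 * norm (z - e) powr - \<kappa> * (1 + norm z) powr - m)
      \<le> ennreal C * (G1 z + G2 (- e + 1 *\<^sub>R z) + G3 z)" by (simp add: u_def v_def)
  qed
  also have "\<dots> = ennreal C * ((\<integral>\<^sup>+z. G1 z \<partial>lborel) + (\<integral>\<^sup>+z. G2 (- e + 1 *\<^sub>R z) \<partial>lborel) + (\<integral>\<^sup>+z. G3 z \<partial>lborel))"
    by (simp add: nn_integral_cmult nn_integral_add)
  also have "(\<integral>\<^sup>+z. G2 (- e + 1 *\<^sub>R z) \<partial>lborel) = (\<integral>\<^sup>+z. G2 z \<partial>lborel)"
    using nn_integral_complex_affine[of G2 1 "- e"] by simp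
  finally show ?thesis
    by (rule le_less_trans) (use fin in \<open>simp add: ennreal_mult_less_top\<close>)
qed

text \<open>Homogeneity: the exponent is 2 from the area element minus the three degrees 1, \<kappa>
  and m.\<close>

lemma nn_integral_two_poles_scaled:
  fixes e a :: complex and \<kappa> m t :: real
  assumes t: "t > 0"
  shows "(\<integral>\<^sup>+z. ennreal (norm (z - a) powr -1 * norm (z - (a + of_real t * e)) powr - \<kappa> * (t + norm (z - a)) powr - m) \<partial>lborel)
     = ennreal (t powr (1 - \<kappa> - m)) *
       (\<integral>\<^sup>+z. ennreal (norm z powr -1 * norm (z - e) powr - \<kappa> * (1 + norm z) powr - m) \<partial>lborel)"
proof -
  have *: "norm ((a + t *\<^sub>R z) - a) powr -1 * norm ((a + t *\<^sub>R z) - (a + of_real t * e)) powr - \<kappa> * (t + norm ((a + t *\<^sub>R z) - a)) powr - m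
     = t powr (- 1 - \<kappa> - m) * (norm z powr -1 * norm (z - e) powr - \<kappa> * (1 + norm z) powr - m)" for z
  proof -
    have d: "(a + t *\<^sub>R z) - (a + of_real t * e) = t *\<^sub>R (z - e)"
      by (simp add: scaleR_conv_of_real algebra_simps)
    have n1: "norm ((a + t *\<^sub>R z) - a) = t * norm z"
      and n2: "norm ((a + t *\<^sub>R z) - (a + of_real t * e)) = t * norm (z - e)"
      unfolding d using t by simp_all
    have n3: "t + t * norm z = t * (1 + norm z)" by (simp add: algebra_simps)
    show ?thesis unfolding n1 n2 n3 using t
      by (simp add: powr_mult powr_diff powr_minus divide_inverse)
  qed
  have "t\<^sup>2 * t powr (- 1 - \<kappa> - m) = t powr (1 - \<kappa> - m)"
    using t by (simp add: powr_diff powr_minus power2_eq_square field_simps)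
  then have tt: "ennreal (t\<^sup>2) * ennreal (t powr (- 1 - \<kappa> - m)) = ennreal (t powr (1 - \<kappa> - m))"
    by (simp add: ennreal_mult'[symmetric])
  show ?thesis
    by (subst nn_integral_complex_affine[OF _ t, of _ a], measurable)
       (simp only: *, subst ennreal_mult', simp, subst nn_integral_cmult, measurable,
        simp only: mult.assoc[symmetric] tt)
qed

text \<open>Scaling by \<rho> reduces to \<rho> = 1. There \<open>k1 < 1\<close> handles the
  singularity at the point 1 and \<open>k1 + k2 > 1\<close> the tail.\<close>

lemma nn_integral_ray_kernel:
  fixes k1 k2 :: real
  assumes k: "0 \<le> k1" "k1 < 1" "0 \<le> k2" "k1 + k2 > 1"
  obtains S where "S > 0"
    "\<And>\<rho>. \<rho> > 0 \<Longrightarrow> (\<integral>\<^sup>+t\<in>{0<..}. ennreal (\<bar>\<rho> - t\<bar> powr - k1 * (t + \<rho>) powr - k2) \<partial>lborel) \<le> ennreal (S * \<rho> powr (1 - (k1 + k2)))"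
proof -
  define I where "I = (\<integral>\<^sup>+s\<in>{0<..}. ennreal (\<bar>1 - s\<bar> powr - k1 * (s + 1) powr - k2) \<partial>lborel)"
  define g where "g x = ennreal (x powr - k1) * indicator {0..1} x" for x :: real
  have [measurable]: "g \<in> borel_measurable borel" unfolding g_def by measurable
  have "I \<le> (\<integral>\<^sup>+s. g \<bar>1 - s\<bar> + ennreal (3 powr k1) * (ennreal ((1 + s) powr - (k1 + k2)) * indicator {0..} s) \<partial>lborel)"
    unfolding I_def
  proof (intro nn_integral_mono)
    fix s :: real
    consider "s \<le> 0" | "0 < s" "s \<le> 2" | "s > 2" by linarith
    then show "ennreal (\<bar>1 - s\<bar> powr - k1 * (s + 1) powr - k2) * indicator {0<..} s
      \<le> g \<bar>1 - s\<bar> + ennreal (3 powr k1) * (ennreal ((1 + s) powr - (k1 + k2)) * indicator {0..} s)"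
    proof cases
      case 2
      have "(s + 1) powr - k2 \<le> 1" using 2 k by (simp add: powr_minus field_simps ge_one_powr_ge_zero)
      then have "\<bar>1 - s\<bar> powr - k1 * (s + 1) powr - k2 \<le> \<bar>1 - s\<bar> powr - k1 * 1"
        by (intro mult_left_mono) auto
      moreover have "\<bar>1 - s\<bar> \<in> {0..1}" using 2 by auto
      ultimately show ?thesis using 2 by (auto simp: g_def intro!: add_increasing2 ennreal_leI)
    next
      case 3
      have "\<bar>1 - s\<bar> powr - k1 \<le> ((1 + s) / 3) powr - k1" using 3 k by (intro powr_mono2') auto
      also have "\<dots> = 3 powr k1 * (1 + s) powr - k1" using 3 by (simp add: powr_minus powr_divide field_simps)
      finally have "\<bar>1 - s\<bar> powr - k1 * (s + 1) powr - k2 \<le> 3 powr k1 * (1 + s) powr - k1 * (s + 1) powr - k2"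
        by (intro mult_right_mono) auto
      also have "\<dots> = 3 powr k1 * (1 + s) powr - (k1 + k2)"
        using 3 by (simp add: powr_add[symmetric] add.commute)
      finally show ?thesis using 3 by (simp add: ennreal_mult'[symmetric] add_increasing ennreal_leI)
    qed auto
  qed
  also have "\<dots> = (\<integral>\<^sup>+s. g \<bar>1 - s\<bar> \<partial>lborel) + ennreal (3 powr k1) * (\<integral>\<^sup>+s\<in>{0..}. ennreal ((1 + s) powr - (k1 + k2)) \<partial>lborel)"
    by (subst nn_integral_add) (auto simp: nn_integral_cmult)
  also have "(\<integral>\<^sup>+s. g \<bar>1 - s\<bar> \<partial>lborel) = (\<integral>\<^sup>+s. g \<bar>s\<bar> \<partial>lborel)"
    by (rule nn_integral_real_isometry(2)[of "\<lambda>x. g \<bar>x\<bar>"]) measurable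
  also have "\<dots> \<le> 2 * (\<integral>\<^sup>+x\<in>{0..}. g x \<partial>lborel)" by (rule nn_integral_abs_le) measurable
  also have "(\<integral>\<^sup>+x\<in>{0..}. g x \<partial>lborel) = (\<integral>\<^sup>+x\<in>{0..1}. ennreal (x powr - k1) \<partial>lborel)"
    by (intro nn_integral_cong) (auto simp: g_def indicator_def)
  finally have "I \<le> 2 * (\<integral>\<^sup>+x\<in>{0..1}. ennreal (x powr - k1) \<partial>lborel)
    + ennreal (3 powr k1) * (\<integral>\<^sup>+s\<in>{0..}. ennreal ((1 + s) powr - (k1 + k2)) \<partial>lborel)" by simp
  also have "\<dots> < \<infinity>"
    using nn_integral_powr_unit_interval[of "- k1"] nn_integral_powr_tail[of "- (k1 + k2)"] k
    by (auto simp: ennreal_mult_less_top)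
  finally obtain S0 where S0: "S0 \<ge> 0" "I = ennreal S0"
    by (metis ennreal_cases infinity_ennreal_def less_irrefl)
  show thesis
  proof (rule that[of "S0 + 1"])
    fix \<rho> :: real assume r: "\<rho> > 0"
    have *: "\<bar>\<rho> - (0 + \<rho> * s)\<bar> powr - k1 * ((0 + \<rho> * s) + \<rho>) powr - k2
       = \<rho> powr - (k1 + k2) * (\<bar>1 - s\<bar> powr - k1 * (s + 1) powr - k2)" if "s > 0" for s
    proof -
      have A: "\<bar>\<rho> - (0 + \<rho> * s)\<bar> = \<rho> * \<bar>1 - s\<bar>"
        using r abs_mult[of \<rho> "1 - s"] by (simp add: right_diff_distrib')
      have B: "(0 + \<rho> * s) + \<rho> = \<rho> * (s + 1)" by (simp add: algebra_simps)
      show ?thesis unfolding A B using r that by (simp add: powr_mult powr_diff powr_minus divide_inverse)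
    qed
    have "(\<integral>\<^sup>+t\<in>{0<..}. ennreal (\<bar>\<rho> - t\<bar> powr - k1 * (t + \<rho>) powr - k2) \<partial>lborel)
       = ennreal \<bar>\<rho>\<bar> * (\<integral>\<^sup>+s. ennreal (\<bar>\<rho> - (0 + \<rho> * s)\<bar> powr - k1 * ((0 + \<rho> * s) + \<rho>) powr - k2) * indicator {0<..} (0 + \<rho> * s) \<partial>lborel)"
      by (rule nn_integral_real_affine) (use r in auto)
    also have "(\<integral>\<^sup>+s. ennreal (\<bar>\<rho> - (0 + \<rho> * s)\<bar> powr - k1 * ((0 + \<rho> * s) + \<rho>) powr - k2) * indicator {0<..} (0 + \<rho> * s) \<partial>lborel)
      = (\<integral>\<^sup>+s. ennreal (\<rho> powr - (k1 + k2)) * (ennreal (\<bar>1 - s\<bar> powr - k1 * (s + 1) powr - k2) * indicator {0<..} s) \<partial>lborel)"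
    proof (intro nn_integral_cong)
      fix s :: real
      show "ennreal (\<bar>\<rho> - (0 + \<rho> * s)\<bar> powr - k1 * ((0 + \<rho> * s) + \<rho>) powr - k2) * indicator {0<..} (0 + \<rho> * s)
        = ennreal (\<rho> powr - (k1 + k2)) * (ennreal (\<bar>1 - s\<bar> powr - k1 * (s + 1) powr - k2) * indicator {0<..} s)"
      proof (cases "s > 0")
        case True
        then show ?thesis using r unfolding *[OF True] by (simp add: ennreal_mult')
      next
        case False
        then have "\<rho> * s \<le> 0" using r by (simp add: mult_nonneg_nonpos)
        then show ?thesis using False by simp
      qed
    qed
    also have "\<dots> = ennreal (\<rho> powr - (k1 + k2)) * I" unfolding I_def
      by (rule nn_integral_cmult) measurable
    also have "ennreal \<bar>\<rho>\<bar> * (ennreal (\<rho> powr - (k1 + k2)) * I) = ennreal (\<rho> * \<rho> powr - (k1 + k2) * S0)"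
      using r S0 by (simp add: ennreal_mult' mult.assoc)
    also have "\<rho> * \<rho> powr - (k1 + k2) = \<rho> powr (1 - (k1 + k2))"
      using r by (simp add: powr_diff powr_minus field_simps powr_add)
    also have "ennreal (\<rho> powr (1 - (k1 + k2)) * S0) \<le> ennreal ((S0 + 1) * \<rho> powr (1 - (k1 + k2)))"
      by (intro ennreal_leI) (simp add: algebra_simps)
    finally show "(\<integral>\<^sup>+t\<in>{0<..}. ennreal (\<bar>\<rho> - t\<bar> powr - k1 * (t + \<rho>) powr - k2) \<partial>lborel) \<le> ennreal ((S0 + 1) * \<rho> powr (1 - (k1 + k2)))" .
  qed (use S0 in simp)
qed

text \<open>A Schur test between the ray and the plane. The kernel is split into two factors in
  which the exponents \<open>l\<close> and \<mu> are interchanged. Hoelder in \<open>t\<close> turns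
  one factor into a power of the distance to \<open>a\<close>, and Fubini leaves an area integral
  that is homogeneous in \<open>t\<close>. The weight \<open>t\<close> on the right side is produced
  by this homogeneity; it is the weight in which the trace of \<open>f\<close> on the ray is
  controlled.\<close>

lemma ray_kernel_Lp_bound:
  fixes a e :: complex and p :: real
  assumes p: "1 < p" and e: "norm e = 1"
  obtains K where "K > 0"
    "\<And>F Z c. F \<in> borel_measurable borel \<Longrightarrow> (\<And>t. 0 \<le> F t) \<Longrightarrow> (\<And>t. t \<le> 0 \<Longrightarrow> F t = 0) \<Longrightarrow>
      (\<And>z. z \<in> Z \<Longrightarrow> 0 \<le> c z \<and> (\<forall>t\<ge>0. z \<noteq> a + of_real t * e) \<and>
         ennreal (c z) \<le> (\<integral>\<^sup>+t. ennreal (F t * t / (norm (z - (a + of_real t * e)) * (t + norm (z - a)))) \<partial>lborel)) \<Longrightarrow>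
      (\<integral>\<^sup>+z\<in>Z. ennreal (c z powr p) \<partial>lborel) \<le> ennreal K * (\<integral>\<^sup>+t. ennreal (F t powr p * t) \<partial>lborel)"
proof -
  define q where "q = p / (p - 1)"
  have q: "1 < q" "1 / p + 1 / q = 1" using p by (auto simp: q_def field_simps)
  \<comment> \<open>The line integral needs \<open>\<mu> * q < 1\<close>, that is l > 1/p, and the
    area integral needs \<open>l * p < 2\<close>, that is l < 2/p. This value lies strictly between
    the two bounds for every p > 1, and \<open>l + \<mu> = 1\<close> recombines the kernel.\<close>
  define l where "l = 2 / (p + 1)"
  define \<mu> where "\<mu> = (p - 1) / (p + 1)"
  have lm: "l + \<mu> = 1" "l > 0" "\<mu> > 0" using p by (simp_all add: l_def \<mu>_def add_divide_distrib[symmetric])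
  have "\<mu> * q = p / (p + 1)" using p by (simp add: \<mu>_def q_def)
  then have k1: "0 \<le> \<mu> * q" "\<mu> * q < 1" using p by auto
  have kq: "\<mu> * q + l * q = q" using lm by (metis add.commute distrib_right mult_1)
  have k2: "0 \<le> l * q" using lm q by simp
  obtain S where S: "S > 0" "\<And>\<rho>. \<rho> > 0 \<Longrightarrow> (\<integral>\<^sup>+t\<in>{0<..}. ennreal (\<bar>\<rho> - t\<bar> powr - (\<mu> * q) * (t + \<rho>) powr - (l * q)) \<partial>lborel)
       \<le> ennreal (S * \<rho> powr (1 - q))"
    using nn_integral_ray_kernel[OF k1 k2] kq q by auto
  have "l * p = 2 * p / (p + 1)" by (simp add: l_def)
  moreover have "2 * p / (p + 1) < 2" using p by (simp add: field_simps)
  moreover have "l * p + \<mu> * p = p" using lm by (metis distrib_right mult_1)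
  ultimately have lp: "0 < l * p" "l * p < 2" "0 \<le> \<mu> * p" "l * p + \<mu> * p > 1"
    using p lm \<open>2 * p / (p + 1) < 2\<close> by auto
  define I where "I = (\<integral>\<^sup>+z. ennreal (norm z powr -1 * norm (z - e) powr - (l * p) * (1 + norm z) powr - (\<mu> * p)) \<partial>lborel)"
  have "I < \<infinity>" unfolding I_def by (rule nn_integral_two_poles[OF e lp])
  then obtain I0 where I0: "I0 \<ge> 0" "I = ennreal I0"
    by (metis ennreal_cases infinity_ennreal_def less_irrefl)
  show thesis
  proof (rule that[of "S powr (p - 1) * (I0 + 1)"])
    show "S powr (p - 1) * (I0 + 1) > 0" using S I0 by simp
  next
    fix F :: "real \<Rightarrow> real" and Z :: "complex set" and c :: "complex \<Rightarrow> real"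
    assume F[measurable]: "F \<in> borel_measurable borel" and F0: "\<And>t. 0 \<le> F t" "\<And>t. t \<le> 0 \<Longrightarrow> F t = 0"
      and c: "\<And>z. z \<in> Z \<Longrightarrow> 0 \<le> c z \<and> (\<forall>t\<ge>0. z \<noteq> a + of_real t * e) \<and>
         ennreal (c z) \<le> (\<integral>\<^sup>+t. ennreal (F t * t / (norm (z - (a + of_real t * e)) * (t + norm (z - a)))) \<partial>lborel)"
    define k where "k z t = norm (z - a) powr -1 * norm (z - (a + of_real t * e)) powr - (l * p) * (t + norm (z - a)) powr - (\<mu> * p)" for z t
    have pointwise: "ennreal (c z powr p) \<le> ennreal (S powr (p - 1)) * (\<integral>\<^sup>+t. ennreal ((F t * t) powr p * k z t) \<partial>lborel)"
      if z: "z \<in> Z" for z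
    proof -
      define \<rho> where "\<rho> = norm (z - a)"
      have rho: "\<rho> > 0" using c[OF z] by (auto simp: \<rho>_def dest: spec[of _ 0])
      define d where "d t = norm (z - (a + of_real t * e))" for t
      have d: "d t > 0" if "t > 0" for t using c[OF z] that by (auto simp: d_def)
      have d_ge: "\<bar>\<rho> - t\<bar> \<le> d t" if "t > 0" for t
        using norm_triangle_ineq3[of "z - a" "of_real t * e"] e that
        by (simp add: d_def \<rho>_def norm_mult diff_diff_eq)
      define X where "X t = F t * t * (d t powr - l * (t + \<rho>) powr - \<mu>)" for t
      define Y where "Y t = indicator {0<..} t * (d t powr - \<mu> * (t + \<rho>) powr - l)" for t
      have Xp: "X t powr p = (F t * t) powr p * (d t powr - (l * p) * (t + \<rho>) powr - (\<mu> * p))" for t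
        using F0(1)[of t] F0(2)[of t] by (cases "t > 0") (simp_all add: X_def powr_mult powr_powr)
      have "ennreal (c z powr p) \<le> ennreal ((S * \<rho> powr (1 - q)) powr (p - 1)) * (\<integral>\<^sup>+t. ennreal (X t powr p) \<partial>lborel)"
      proof (rule hoelder_bound[OF p q])
        show "X \<in> borel_measurable lborel" "Y \<in> borel_measurable lborel"
          unfolding X_def Y_def d_def by measurable
        show "0 \<le> X t" for t using F0(1)[of t] F0(2)[of t] by (cases "t > 0") (simp_all add: X_def)
        show "0 \<le> Y t" for t by (simp add: Y_def)
        show "0 \<le> c z" using c[OF z] by simp
        show "0 < S * \<rho> powr (1 - q)" using S rho by simp
        have "(\<integral>\<^sup>+t. ennreal (F t * t / (d t * (t + \<rho>))) \<partial>lborel) \<le> (\<integral>\<^sup>+t. ennreal (X t * Y t) \<partial>lborel)"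
        proof (intro nn_integral_mono ennreal_leI)
          fix t :: real
          show "F t * t / (d t * (t + \<rho>)) \<le> X t * Y t"
          proof (cases "t > 0")
            case True
            have "d t powr - l * d t powr - \<mu> = d t powr - (l + \<mu>)"
              by (simp add: powr_add[symmetric])
            moreover have "(t + \<rho>) powr - \<mu> * (t + \<rho>) powr - l = (t + \<rho>) powr - (l + \<mu>)"
              by (simp add: powr_add[symmetric] add.commute)
            moreover have "X t * Y t = F t * t * (d t powr - l * d t powr - \<mu>) * ((t + \<rho>) powr - \<mu> * (t + \<rho>) powr - l)"
              using True by (simp add: X_def Y_def)
            ultimately have "X t * Y t = F t * t * d t powr - 1 * (t + \<rho>) powr - 1"
              unfolding lm by simp
            also have "\<dots> = F t * t / (d t * (t + \<rho>))"
              using d[OF True] True rho by (simp add: powr_minus divide_inverse)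
            finally show ?thesis by simp
          qed (simp add: F0 X_def)
        qed
        then show "ennreal (c z) \<le> (\<integral>\<^sup>+t. ennreal (X t * Y t) \<partial>lborel)"
          using c[OF z] unfolding d_def \<rho>_def by (blast intro: order_trans)
        \<comment> \<open>At this one point the majorant has the default value 0 of a power of 0, so
          the comparison holds only almost everywhere.\<close>
        have ae: "AE t in lborel. t \<noteq> \<rho>" by (rule AE_lborel_singleton)
        have "(\<integral>\<^sup>+t. ennreal (Y t powr q) \<partial>lborel)
          \<le> (\<integral>\<^sup>+t\<in>{0<..}. ennreal (\<bar>\<rho> - t\<bar> powr - (\<mu> * q) * (t + \<rho>) powr - (l * q)) \<partial>lborel)"
        proof (rule nn_integral_mono_AE, use ae in eventually_elim)
          fix t assume t: "t \<noteq> \<rho>"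
          show "ennreal (Y t powr q) \<le> ennreal (\<bar>\<rho> - t\<bar> powr - (\<mu> * q) * (t + \<rho>) powr - (l * q)) * indicator {0<..} t"
          proof (cases "t > 0")
            case True
            have "Y t powr q = d t powr - (\<mu> * q) * (t + \<rho>) powr - (l * q)"
              using True by (simp add: Y_def powr_mult powr_powr)
            also have "\<dots> \<le> \<bar>\<rho> - t\<bar> powr - (\<mu> * q) * (t + \<rho>) powr - (l * q)"
              using d_ge[OF True] t k1 by (intro mult_right_mono powr_mono2') auto
            finally show ?thesis using True by (simp add: ennreal_leI)
          qed (use q in \<open>simp add: Y_def\<close>)
        qed
        also have "\<dots> \<le> ennreal (S * \<rho> powr (1 - q))" by (rule S(2)[OF rho])
        finally show "(\<integral>\<^sup>+t. ennreal (Y t powr q) \<partial>lborel) \<le> ennreal (S * \<rho> powr (1 - q))" .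
      qed
      \<comment> \<open>Because p and q are conjugate, Hoelder contributes exactly 1/\<rho>, a
        singularity at \<open>a\<close> that is integrable with respect to area.\<close>
      also have "(S * \<rho> powr (1 - q)) powr (p - 1) = S powr (p - 1) * \<rho> powr - 1"
      proof -
        have "(1 - q) * (p - 1) = - 1" using p by (simp add: q_def field_simps)
        then show ?thesis using S rho by (simp add: powr_mult powr_powr)
      qed
      also have "ennreal (S powr (p - 1) * \<rho> powr - 1) * (\<integral>\<^sup>+t. ennreal (X t powr p) \<partial>lborel)
        = ennreal (S powr (p - 1)) * (ennreal (\<rho> powr - 1) * (\<integral>\<^sup>+t. ennreal (X t powr p) \<partial>lborel))"
        by (subst ennreal_mult') (simp_all only: powr_ge_zero mult.assoc)
      also have "ennreal (\<rho> powr - 1) * (\<integral>\<^sup>+t. ennreal (X t powr p) \<partial>lborel)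
        = (\<integral>\<^sup>+t. ennreal (\<rho> powr - 1) * ennreal (X t powr p) \<partial>lborel)"
        by (rule nn_integral_cmult[symmetric]) (unfold X_def d_def, measurable)
      also have "\<dots> = (\<integral>\<^sup>+t. ennreal ((F t * t) powr p * k z t) \<partial>lborel)"
        by (intro nn_integral_cong, subst ennreal_mult'[symmetric])
           (simp_all add: Xp k_def d_def \<rho>_def mult_ac)
      finally show ?thesis .
    qed
    have Km: "(\<lambda>x. ennreal ((F (snd x) * snd x) powr p * k (fst x) (snd x))) \<in> borel_measurable (lborel \<Otimes>\<^sub>M lborel)"
      unfolding k_def by measurable
    have Km2[measurable]: "(\<lambda>z. ennreal (k z t)) \<in> borel_measurable borel" for t
      unfolding k_def by measurable
    have Km1: "(\<lambda>z. \<integral>\<^sup>+t. ennreal ((F t * t) powr p * k z t) \<partial>lborel) \<in> borel_measurable lborel"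
      using lborel.borel_measurable_nn_integral_fst[OF Km] by simp
    have "(\<integral>\<^sup>+z\<in>Z. ennreal (c z powr p) \<partial>lborel)
      \<le> (\<integral>\<^sup>+z. ennreal (S powr (p - 1)) * (\<integral>\<^sup>+t. ennreal ((F t * t) powr p * k z t) \<partial>lborel) \<partial>lborel)"
      using pointwise by (intro nn_integral_mono) (auto simp: indicator_def)
    also have "\<dots> = ennreal (S powr (p - 1)) * (\<integral>\<^sup>+z. (\<integral>\<^sup>+t. ennreal ((F t * t) powr p * k z t) \<partial>lborel) \<partial>lborel)"
      by (rule nn_integral_cmult[OF Km1])
    also have "(\<integral>\<^sup>+z. (\<integral>\<^sup>+t. ennreal ((F t * t) powr p * k z t) \<partial>lborel) \<partial>lborel)
      = (\<integral>\<^sup>+t. (\<integral>\<^sup>+z. ennreal ((F t * t) powr p * k z t) \<partial>lborel) \<partial>lborel)"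
      by (rule lborel_pair.Fubini'[symmetric]) (use Km in \<open>simp add: split_beta'\<close>)
    also have "\<dots> = (\<integral>\<^sup>+t. ennreal (F t powr p * t) * I \<partial>lborel)"
    proof (intro nn_integral_cong)
      fix t :: real
      show "(\<integral>\<^sup>+z. ennreal ((F t * t) powr p * k z t) \<partial>lborel) = ennreal (F t powr p * t) * I"
      proof (cases "t > 0")
        case True
        have "(\<integral>\<^sup>+z. ennreal ((F t * t) powr p * k z t) \<partial>lborel) = ennreal ((F t * t) powr p) * (\<integral>\<^sup>+z. ennreal (k z t) \<partial>lborel)"
          by (subst ennreal_mult') (simp_all add: nn_integral_cmult)
        also have "(\<integral>\<^sup>+z. ennreal (k z t) \<partial>lborel) = ennreal (t powr (1 - l * p - \<mu> * p)) * I"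
          unfolding k_def I_def by (rule nn_integral_two_poles_scaled[OF True])
        also have "1 - l * p - \<mu> * p = 1 - p" using \<open>l * p + \<mu> * p = p\<close> by simp
        also have "ennreal ((F t * t) powr p) * (ennreal (t powr (1 - p)) * I) = ennreal ((F t * t) powr p * t powr (1 - p)) * I"
          by (subst ennreal_mult') (simp_all add: mult.assoc)
        also have "(F t * t) powr p * t powr (1 - p) = F t powr p * t"
          using True F0(1)[of t] by (simp add: powr_mult powr_diff)
        finally show ?thesis .
      qed (use F0 p in simp)
    qed
    also have "\<dots> = (\<integral>\<^sup>+t. ennreal (F t powr p * t) \<partial>lborel) * I"
      by (rule nn_integral_multc) measurable
    also have "ennreal (S powr (p - 1)) * ((\<integral>\<^sup>+t. ennreal (F t powr p * t) \<partial>lborel) * I)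
      = ennreal (S powr (p - 1) * I0) * (\<integral>\<^sup>+t. ennreal (F t powr p * t) \<partial>lborel)"
      using I0 by (subst ennreal_mult') (simp_all add: mult_ac)
    also have "\<dots> \<le> ennreal (S powr (p - 1) * (I0 + 1)) * (\<integral>\<^sup>+t. ennreal (F t powr p * t) \<partial>lborel)"
      by (intro mult_right_mono ennreal_leI mult_left_mono) auto
    finally show "(\<integral>\<^sup>+z\<in>Z. ennreal (c z powr p) \<partial>lborel)
      \<le> ennreal (S powr (p - 1) * (I0 + 1)) * (\<integral>\<^sup>+t. ennreal (F t powr p * t) \<partial>lborel)" .
  qed
qed

section \<open>The transform along a boundary ray\<close>

lemma has_field_derivative_quadratic_remainder:
  fixes H :: "complex \<Rightarrow> complex"
  assumes "d > 0" and rem: "\<And>y. dist z y < d \<Longrightarrow> norm (H y - H z - (y - z) * L) \<le> M * (norm (y - z))\<^sup>2"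
  shows "(H has_field_derivative L) (at z)"
  unfolding has_field_derivative_def
proof (rule has_derivativeI_sandwich[of d])
  show "((\<lambda>y. \<bar>M\<bar> * norm (y - z)) \<longlongrightarrow> 0) (at z)"
    by (rule tendsto_eq_intros refl | simp)+
  fix y assume y: "y \<in> UNIV" "y \<noteq> z" "dist y z < d"
  have "norm (H y - H z - L * (y - z)) \<le> M * (norm (y - z))\<^sup>2"
    using rem[of y] y by (simp add: dist_commute mult.commute)
  also have "\<dots> \<le> \<bar>M\<bar> * (norm (y - z))\<^sup>2" by (intro mult_right_mono) auto
  finally show "norm (H y - H z - L * (y - z)) / norm (y - z) \<le> \<bar>M\<bar> * norm (y - z)"
    using y by (simp add: field_simps power2_eq_square)
qed (use assms in \<open>auto intro: bounded_linear_mult_right\<close>)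

text \<open>The derivative is found by an explicit second-order expansion of the kernel, with a
  remainder that is uniform in \<open>t\<close>, so that integrability of \<phi> is enough.
  Separation is required only where \<phi> is non-zero, which allows \<phi> to carry the indicator
  of a piece of the ray.\<close>

lemma holomorphic_on_two_pole_integral:
  fixes \<phi> w b :: "'a \<Rightarrow> complex"
  assumes \<phi>: "integrable M \<phi>" and [measurable]: "w \<in> borel_measurable M" "b \<in> borel_measurable M"
    and sep: "\<And>z. z \<in> U \<Longrightarrow> \<exists>\<delta>>0. \<forall>t. \<phi> t \<noteq> 0 \<longrightarrow> \<delta> \<le> norm (w t - z) \<and> \<delta> \<le> norm (b t - z)"
  shows "(\<lambda>z. \<integral>t. \<phi> t / ((w t - z) * (b t - z)) \<partial>M) holomorphic_on U"
proof (rule holomorphic_onI)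
  note [measurable] = borel_measurable_integrable[OF \<phi>]
  fix z assume "z \<in> U"
  then obtain \<delta> where \<delta>: "\<delta> > 0" "\<And>t. \<phi> t \<noteq> 0 \<Longrightarrow> \<delta> \<le> norm (w t - z) \<and> \<delta> \<le> norm (b t - z)"
    using sep by blast
  define A where "A y t = 1 / (w t - y)" for y t
  define B where "B y t = 1 / (b t - y)" for y t
  define H where "H y = (\<integral>t. \<phi> t * (A y t * B y t) \<partial>M)" for y
  define L where "L = (\<integral>t. \<phi> t * ((A z t)\<^sup>2 * B z t + A z t * (B z t)\<^sup>2) \<partial>M)"
  have near: "norm (A y t) \<le> 2 / \<delta> \<and> norm (B y t) \<le> 2 / \<delta> \<and> w t \<noteq> y \<and> b t \<noteq> y"
    if "dist z y < \<delta> / 2" "\<phi> t \<noteq> 0" for y t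
  proof -
    have *: "\<delta> / 2 \<le> norm (x - y)" if "\<delta> \<le> norm (x - z)" for x
      using that \<open>dist z y < \<delta> / 2\<close> norm_triangle_ineq[of "x - y" "y - z"] by (simp add: dist_norm norm_minus_commute)
    have "\<delta> / 2 \<le> norm (w t - y)" "\<delta> / 2 \<le> norm (b t - y)" using \<delta>(2)[OF that(2)] * by auto
    moreover have "1 / x \<le> 2 / \<delta>" if "\<delta> / 2 \<le> x" for x :: real
      using frac_le[of 1 1 "\<delta> / 2" x] that \<delta>(1) by simp
    ultimately show ?thesis using \<delta>(1) by (auto simp: A_def B_def norm_divide)
  qed
  have int: "integrable M (\<lambda>t. \<phi> t * g t)"
    if [measurable]: "g \<in> borel_measurable M" and "\<And>t. \<phi> t \<noteq> 0 \<Longrightarrow> norm (g t) \<le> N" for g and N :: real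
  proof (rule Bochner_Integration.integrable_bound)
    show "integrable M (\<lambda>t. N *\<^sub>R \<phi> t)" using \<phi> by simp
    have "norm (\<phi> t * g t) \<le> norm (N *\<^sub>R \<phi> t)" for t
    proof (cases "\<phi> t = 0")
      case False
      then have "norm (\<phi> t) * norm (g t) \<le> norm (\<phi> t) * \<bar>N\<bar>" using that(2)[of t] by (intro mult_left_mono) auto
      then show ?thesis by (simp add: norm_mult mult.commute)
    qed auto
    then show "AE t in M. norm (\<phi> t * g t) \<le> norm (N *\<^sub>R \<phi> t)" by simp
  qed measurable
  have mA[measurable]: "A y \<in> borel_measurable M" "B y \<in> borel_measurable M" for y
    unfolding A_def B_def by measurable
  have bnd: "norm (A y t * B y t) \<le> (2 / \<delta>) * (2 / \<delta>)" if "dist z y < \<delta> / 2" "\<phi> t \<noteq> 0" for y t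
    unfolding norm_mult using near[OF that] \<delta>(1) by (intro mult_mono) auto
  have intH: "integrable M (\<lambda>t. \<phi> t * (A y t * B y t))" if "dist z y < \<delta> / 2" for y
    by (rule int[OF _ bnd[OF that]]) (use bnd[OF that] in measurable)
  define N where "N = (2 / \<delta>) ^ 3"
  have zz: "dist z z < \<delta> / 2" using \<delta> by simp
  have intL: "integrable M (\<lambda>t. \<phi> t * ((A z t)\<^sup>2 * B z t + A z t * (B z t)\<^sup>2))"
  proof (rule int[where N = "N + N"])
    fix t assume t: "\<phi> t \<noteq> 0"
    have "norm ((A z t)\<^sup>2 * B z t) \<le> N"
      unfolding norm_mult norm_power N_def power3_eq_cube power2_eq_square using near[OF zz t] \<delta>(1)
      by (intro mult_mono) auto
    moreover have "norm (A z t * (B z t)\<^sup>2) \<le> N"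
      unfolding norm_mult norm_power N_def power3_eq_cube power2_eq_square mult.assoc[symmetric] using near[OF zz t] \<delta>(1)
      by (intro mult_mono) auto
    ultimately show "norm ((A z t)\<^sup>2 * B z t + A z t * (B z t)\<^sup>2) \<le> N + N"
      by (rule order_trans[OF norm_triangle_ineq add_mono])
  qed measurable
  define Q where "Q = (2 / \<delta>) ^ 4"
  have Q0: "Q \<ge> 0" by (simp add: Q_def)
  have "(H has_field_derivative L) (at z)"
  proof (rule has_field_derivative_quadratic_remainder[of "\<delta> / 2"])
    show "\<delta> / 2 > 0" using \<delta> by simp
    fix y assume y: "dist z y < \<delta> / 2"
    define R where "R t = \<phi> t * (A y t * B y t) - \<phi> t * (A z t * B z t) - (y - z) * (\<phi> t * ((A z t)\<^sup>2 * B z t + A z t * (B z t)\<^sup>2))" for t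
    have intR: "integrable M R" unfolding R_def
      by (intro Bochner_Integration.integrable_diff intH y zz integrable_mult_right intL)
    have "H y - H z - (y - z) * L = (\<integral>t. R t \<partial>M)"
      unfolding H_def L_def R_def using intH[OF y] intH[OF zz] intL by simp
    also have "norm \<dots> \<le> (\<integral>t. norm (R t) \<partial>M)" by (rule integral_norm_bound)
    also have "\<dots> \<le> (\<integral>t. (3 * Q * (norm (y - z))\<^sup>2) * norm (\<phi> t) \<partial>M)"
    proof (rule integral_mono)
      show "integrable M (\<lambda>t. norm (R t))" "integrable M (\<lambda>t. (3 * Q * (norm (y - z))\<^sup>2) * norm (\<phi> t))"
        using intR \<phi> by auto
      fix t
      show "norm (R t) \<le> (3 * Q * (norm (y - z))\<^sup>2) * norm (\<phi> t)"
      proof (cases "\<phi> t = 0")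
        case False
        have b4: "norm (x1 * x2 * x3 * x4) \<le> Q" if "norm x1 \<le> 2/\<delta>" "norm x2 \<le> 2/\<delta>" "norm x3 \<le> 2/\<delta>" "norm x4 \<le> 2/\<delta>" for x1 x2 x3 x4 :: complex
          unfolding norm_mult Q_def power4_eq_xxxx using that \<delta>(1) by (intro mult_mono) auto
        \<comment> \<open>Two applications of the resolvent identity
          \<open>A y t - A z t = (y - z) * (A y t * A z t)\<close> leave these three products of
          four reciprocals, each bounded by \<open>Q\<close>.\<close>
        define s where "s = A y t * A z t * A z t * B y t + A z t * A z t * B y t * B z t + A z t * B z t * B z t * B y t"
        have "norm s \<le> Q + Q + Q" unfolding s_def
          using near[OF y False] near[OF zz False] by (intro order_trans[OF norm_triangle_ineq] add_mono b4) auto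
        have A1: "A y t - A z t = (y - z) * (A y t * A z t)" and B1: "B y t - B z t = (y - z) * (B y t * B z t)"
          using near[OF y False] near[OF zz False] by (auto simp: A_def B_def field_simps)
        have A2: "A y t = A z t + (y - z) * (A y t * A z t)" and B2: "B y t = B z t + (y - z) * (B y t * B z t)"
          using A1 B1 by (simp_all add: algebra_simps)
        have "A y t * B y t - A z t * B z t - (y - z) * ((A z t)\<^sup>2 * B z t + A z t * (B z t)\<^sup>2) = (y - z)\<^sup>2 * s"
        proof -
          have "A y t * B y t - A z t * B z t = (A y t - A z t) * B y t + A z t * (B y t - B z t)"
            by (simp add: algebra_simps)
          also have "\<dots> = (y - z) * (A z t * (A y t * B y t) + A z t * (B y t * B z t))"
            unfolding A1 B1 by (simp add: algebra_simps)
          finally have 1: "A y t * B y t - A z t * B z t = \<dots>" .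
          have 2: "A z t * (A y t * B y t) - (A z t)\<^sup>2 * B z t = (y - z) * (A y t * A z t * A z t * B y t + A z t * A z t * B y t * B z t)"
          proof -
            have "A z t * (A y t * B y t) - (A z t)\<^sup>2 * B z t = A z t * ((A y t - A z t) * B y t + A z t * (B y t - B z t))"
              by (simp add: algebra_simps power2_eq_square)
            then show ?thesis unfolding A1 B1 by (simp add: algebra_simps)
          qed
          have 3: "A z t * (B y t * B z t) - A z t * (B z t)\<^sup>2 = (y - z) * (A z t * B z t * B z t * B y t)"
          proof -
            have "A z t * (B y t * B z t) - A z t * (B z t)\<^sup>2 = A z t * B z t * (B y t - B z t)"
              by (simp add: algebra_simps power2_eq_square)
            then show ?thesis unfolding B1 by (simp add: algebra_simps)
          qed
          have "A y t * B y t - A z t * B z t - (y - z) * ((A z t)\<^sup>2 * B z t + A z t * (B z t)\<^sup>2)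
            = (y - z) * ((A z t * (A y t * B y t) - (A z t)\<^sup>2 * B z t) + (A z t * (B y t * B z t) - A z t * (B z t)\<^sup>2))"
            unfolding 1 by (simp add: algebra_simps)
          also have "\<dots> = (y - z)\<^sup>2 * s" unfolding 2 3 s_def by (simp add: algebra_simps power2_eq_square)
          finally show ?thesis .
        qed
        then have "R t = \<phi> t * ((y - z)\<^sup>2 * s)"
          unfolding R_def by (metis (no_types, opaque_lifting) mult.left_commute right_diff_distrib')
        then have "norm (R t) = norm (\<phi> t) * ((norm (y - z))\<^sup>2 * norm s)" by (simp add: norm_mult norm_power)
        also have "\<dots> \<le> norm (\<phi> t) * ((norm (y - z))\<^sup>2 * (Q + Q + Q))"
          using \<open>norm s \<le> Q + Q + Q\<close> by (intro mult_left_mono) auto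
        finally show ?thesis by (simp add: mult_ac)
      qed (simp add: R_def)
    qed
    also have "\<dots> = (3 * Q * (\<integral>t. norm (\<phi> t) \<partial>M)) * (norm (y - z))\<^sup>2" by (simp add: mult_ac)
    finally show "norm (H y - H z - (y - z) * L) \<le> (3 * Q * (\<integral>t. norm (\<phi> t) \<partial>M)) * (norm (y - z))\<^sup>2" .
  qed
  moreover have "H = (\<lambda>z. \<integral>t. \<phi> t / ((w t - z) * (b t - z)) \<partial>M)"
    by (simp add: H_def A_def B_def fun_eq_iff)
  ultimately show "(\<lambda>z. \<integral>t. \<phi> t / ((w t - z) * (b t - z)) \<partial>M) field_differentiable at z within U"
    by (metis field_differentiable_at_within field_differentiable_def)
qed

section \<open>The segment from a boundary point to an interior point, and the trace of f on
  it\<close>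

locale boundary_ray =
  fixes D :: "complex set" and f :: "complex \<Rightarrow> complex" and p :: real and a c :: complex and r :: real
  assumes open_D: "open D" and convex_D: "convex D" and r: "0 < r" and ball_D: "ball c r \<subseteq> D"
    and a_clo: "a \<in> closure D" and a_notin: "a \<notin> D" and p: "1 < p"
    and hol: "f holomorphic_on D" and Lp: "(\<integral>\<^sup>+z\<in>D. ennreal (norm (f z) powr p) \<partial>lborel) < \<infinity>"
begin

definition l :: real where "l = norm (c - a)"
definition e :: complex where "e = (c - a) / of_real l"
definition w :: "real \<Rightarrow> complex" where "w t = a + of_real t * e"
definition b :: "real \<Rightarrow> complex" where "b t = a - of_real t * e"

lemma r_le_l: "r \<le> l"
proof (rule ccontr)
  assume "\<not> r \<le> l"
  then have "a \<in> ball c r" by (simp add: l_def dist_norm)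
  then show False using ball_D a_notin by auto
qed

lemma l_pos: "l > 0" using r r_le_l by simp

lemma norm_e: "norm e = 1" using l_pos by (simp add: e_def norm_divide l_def)

lemma w_l: "w l = c" using l_pos by (simp add: w_def e_def)

text \<open>The homothety with centre \<open>a\<close> and ratio \<open>t / l\<close> maps the ball
  around \<open>c\<close> onto this ball. Convexity keeps every point strictly between a point of
  the open set \<open>D\<close> and a point of its closure inside \<open>D\<close>, so
  \<open>D\<close> contains a cone with apex \<open>a\<close>.\<close>

lemma ball_w:
  assumes t: "0 < t" "t \<le> l"
  shows "ball (w t) (t * r / l) \<subseteq> D"
proof
  fix y assume y: "y \<in> ball (w t) (t * r / l)"
  define \<zeta> where "\<zeta> = a + of_real (l / t) * (y - a)"
  have "\<zeta> - c = of_real (l / t) * (y - w t)"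
  proof -
    have "of_real (l / t) * (w t - a) = c - a" using l_pos t by (simp add: w_def e_def)
    moreover have "of_real (l / t) * (y - w t) = of_real (l / t) * (y - a) - of_real (l / t) * (w t - a)"
      by (simp only: right_diff_distrib[symmetric]) simp
    ultimately show ?thesis by (simp add: \<zeta>_def)
  qed
  then have "norm (\<zeta> - c) = l / t * norm (y - w t)" using t l_pos by (simp add: norm_mult norm_divide)
  also have "\<dots> < l / t * (t * r / l)"
    using y t l_pos by (intro mult_strict_left_mono) (auto simp: dist_norm norm_minus_commute)
  also have "\<dots> = r" using t l_pos by simp
  finally have \<zeta>: "\<zeta> \<in> D" using ball_D by (auto simp: dist_norm norm_minus_commute)
  have yeq: "y = a + of_real (t / l) * (\<zeta> - a)" using t l_pos by (simp add: \<zeta>_def)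
  show "y \<in> D"
  proof (cases "t = l")
    case True then show ?thesis using yeq \<zeta> l_pos by simp
  next
    case False
    have "open_segment \<zeta> a \<subseteq> interior D"
      using in_interior_closure_convex_segment[OF convex_D _ a_clo] \<zeta> open_D by (simp add: interior_open)
    moreover have "y \<in> open_segment \<zeta> a"
      unfolding in_segment
    proof (intro conjI exI[of _ "1 - t / l"])
      show "\<zeta> \<noteq> a" using \<zeta> a_notin by auto
      show "y = (1 - (1 - t / l)) *\<^sub>R \<zeta> + (1 - t / l) *\<^sub>R a"
        unfolding yeq by (simp add: scaleR_conv_of_real algebra_simps diff_divide_distrib)
    qed (use False t l_pos in auto)
    ultimately show ?thesis using interior_subset by blast
  qed
qed

lemma w_in: "0 < t \<Longrightarrow> t \<le> l \<Longrightarrow> w t \<in> D"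
  using ball_w[of t] r l_pos by (auto dest!: subsetD[of _ _ "w t"])

text \<open>The mean value bound on a disc around \<open>w t\<close> with radius proportional to
  \<open>t\<close> gives \<open>t * norm (f (w t)) powr p\<close> at most a constant times 1/t times
  the integral over the disc. After exchanging the integrals, a point z is met only for t between
  2/3 and 2 times |z - a|, an interval on which 1/t has integral at most 3.\<close>

lemma ray_Lp: "(\<integral>\<^sup>+t\<in>{0<..l}. ennreal (t * norm (f (w t)) powr p) \<partial>lborel) < \<infinity>"
proof -
  define K where "K = 16 powr p * pi powr (p - 1)"
  define g where "g = (\<lambda>z. ennreal (norm (f z) powr p) * indicator D z)"
  have g[measurable]: "g \<in> borel_measurable borel" unfolding g_def
    by (rule borel_measurable_norm_powr_indicator[OF hol open_D])
  define h where "h t z = ennreal (1 / t) * (indicator {z. norm (z - w t) < t * r / (2 * l)} z * g z)" for t z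
  define C where "C = K * (4 * l\<^sup>2 / r\<^sup>2)"
  have K: "K > 0" by (simp add: K_def)
  have C: "C > 0" using K l_pos r by (simp add: C_def)
  have hm: "(\<lambda>x. indicator {0<..l} (fst x) * h (fst x) (snd x)) \<in> borel_measurable (lborel \<Otimes>\<^sub>M lborel)"
  proof -
    have "(\<lambda>x. norm (snd x - w (fst x)) < fst x * r / (2 * l)) \<in> measurable (lborel \<Otimes>\<^sub>M lborel) (count_space UNIV)"
      unfolding w_def by measurable
    then show ?thesis unfolding h_def w_def by simp
  qed
  have "(\<integral>\<^sup>+t\<in>{0<..l}. ennreal (t * norm (f (w t)) powr p) \<partial>lborel)
     \<le> (\<integral>\<^sup>+t. ennreal C * (\<integral>\<^sup>+z. indicator {0<..l} t * h t z \<partial>lborel) \<partial>lborel)"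
  proof (intro nn_integral_mono)
    fix t
    show "ennreal (t * norm (f (w t)) powr p) * indicator {0<..l} t
       \<le> ennreal C * (\<integral>\<^sup>+z. indicator {0<..l} t * h t z \<partial>lborel)"
    proof (cases "t \<in> {0<..l}")
      case True
      then have t: "0 < t" "t \<le> l" by auto
      \<comment> \<open>Half of the radius provided by \<open>ball_w\<close>: with
        \<open>r \<le> l\<close> it is at most \<open>t / 2\<close>, so for all points z of the disc
        |z - a| is comparable to t.\<close>
      define s where "s = t * r / (2 * l)"
      have s: "s > 0" using t r l_pos by (simp add: s_def)
      have sub: "ball (w t) s \<subseteq> D"
        using ball_w[OF t] subset_ball[of s "t * r / l" "w t"] t r l_pos by (auto simp: s_def field_simps)
      have "ennreal (s\<^sup>2 * norm (f (w t)) powr p)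
         \<le> ennreal K * (\<integral>\<^sup>+z\<in>ball (w t) s. ennreal (norm (f z) powr p) \<partial>lborel)"
        unfolding K_def by (rule holomorphic_Lp_bound[OF holomorphic_on_subset[OF hol sub] s p])
      also have "(\<integral>\<^sup>+z\<in>ball (w t) s. ennreal (norm (f z) powr p) \<partial>lborel)
        = (\<integral>\<^sup>+z. indicator {z. norm (z - w t) < t * r / (2 * l)} z * g z \<partial>lborel)"
        using sub by (intro nn_integral_cong)
          (auto simp: g_def s_def[symmetric] indicator_def dist_norm norm_minus_commute)
      finally have 1: "ennreal (s\<^sup>2 * norm (f (w t)) powr p)
         \<le> ennreal K * (\<integral>\<^sup>+z. indicator {z. norm (z - w t) < t * r / (2 * l)} z * g z \<partial>lborel)" .
      have "t * norm (f (w t)) powr p = (4 * l\<^sup>2 / (r\<^sup>2 * t)) * (s\<^sup>2 * norm (f (w t)) powr p)"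
        using t l_pos r by (simp add: s_def power2_eq_square field_simps)
      then have "ennreal (t * norm (f (w t)) powr p) = ennreal (4 * l\<^sup>2 / (r\<^sup>2 * t)) * ennreal (s\<^sup>2 * norm (f (w t)) powr p)"
        using t by (subst ennreal_mult'[symmetric]) simp_all
      also have "\<dots> \<le> ennreal (4 * l\<^sup>2 / (r\<^sup>2 * t)) * (ennreal K * (\<integral>\<^sup>+z. indicator {z. norm (z - w t) < t * r / (2 * l)} z * g z \<partial>lborel))"
        by (rule mult_left_mono[OF 1]) simp
      also have "\<dots> = ennreal (C * (1 / t)) * (\<integral>\<^sup>+z. indicator {z. norm (z - w t) < t * r / (2 * l)} z * g z \<partial>lborel)"
      proof -
        have "C * (1 / t) = 4 * l\<^sup>2 / (r\<^sup>2 * t) * K" by (simp add: C_def)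
        then show ?thesis using t by (simp only:, subst ennreal_mult') (simp_all add: mult.assoc)
      qed
      also have "\<dots> = ennreal C * (ennreal (1 / t) * (\<integral>\<^sup>+z. indicator {z. norm (z - w t) < t * r / (2 * l)} z * g z \<partial>lborel))"
        using C t by (subst ennreal_mult') (simp_all add: mult.assoc)
      also have "ennreal (1 / t) * (\<integral>\<^sup>+z. indicator {z. norm (z - w t) < t * r / (2 * l)} z * g z \<partial>lborel)
        = (\<integral>\<^sup>+z. indicator {0<..l} t * h t z \<partial>lborel)"
        using True unfolding h_def by (subst nn_integral_cmult[symmetric]) simp_all
      finally show ?thesis using True by simp
    qed auto
  qed
  also have "\<dots> = ennreal C * (\<integral>\<^sup>+t. (\<integral>\<^sup>+z. indicator {0<..l} t * h t z \<partial>lborel) \<partial>lborel)"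
    by (rule nn_integral_cmult) (use lborel.borel_measurable_nn_integral_fst[OF hm] in simp)
  also have "(\<integral>\<^sup>+t. (\<integral>\<^sup>+z. indicator {0<..l} t * h t z \<partial>lborel) \<partial>lborel)
     = (\<integral>\<^sup>+z. (\<integral>\<^sup>+t. indicator {0<..l} t * h t z \<partial>lborel) \<partial>lborel)"
    by (rule lborel_pair.Fubini'[symmetric]) (use hm in \<open>simp add: split_beta'\<close>)
  also have "\<dots> \<le> (\<integral>\<^sup>+z. 3 * g z \<partial>lborel)"
  proof (intro nn_integral_mono)
    fix z
    define \<rho> where "\<rho> = norm (z - a)"
    have range: "2 / 3 * \<rho> \<le> t \<and> t \<le> 2 * \<rho> \<and> 0 < \<rho>" if "0 < t" "norm (z - w t) < t * r / (2 * l)" for t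
    proof -
      have "t * r / (2 * l) \<le> t / 2" using that r_le_l l_pos by (simp add: field_simps)
      moreover have "\<bar>\<rho> - t\<bar> \<le> norm (z - w t)"
        using norm_triangle_ineq3[of "z - a" "of_real t * e"] norm_e that
        by (simp add: w_def \<rho>_def norm_mult diff_diff_eq)
      ultimately have "\<bar>\<rho> - t\<bar> < t / 2" using that(2) by (meson le_less_trans less_le_trans)
      then show ?thesis using that(1) by (intro conjI; linarith)
    qed
    have "(\<integral>\<^sup>+t. indicator {0<..l} t * h t z \<partial>lborel)
      \<le> (\<integral>\<^sup>+t. (ennreal (3 / (2 * \<rho>)) * g z) * indicator {0..2 * \<rho>} t \<partial>lborel)"
    proof (intro nn_integral_mono)
      fix t
      show "indicator {0<..l} t * h t z \<le> (ennreal (3 / (2 * \<rho>)) * g z) * indicator {0..2 * \<rho>} t"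
      proof (cases "0 < t \<and> norm (z - w t) < t * r / (2 * l)")
        case True
        then have t: "2 / 3 * \<rho> \<le> t" "t \<le> 2 * \<rho>" "0 < \<rho>" using range by auto
        have "1 / t \<le> 3 / (2 * \<rho>)" using t True by (simp add: field_simps)
        then show ?thesis using t True
          by (auto simp: h_def indicator_def intro!: mult_right_mono ennreal_leI)
      qed (auto simp: h_def indicator_def)
    qed
    also have "\<dots> = (ennreal (3 / (2 * \<rho>)) * g z) * ennreal (2 * \<rho>)"
      by (subst nn_integral_cmult_indicator) (auto simp: \<rho>_def)
    also have "\<dots> = ennreal (3 / (2 * \<rho>) * (2 * \<rho>)) * g z"
      by (subst ennreal_mult) (auto simp: \<rho>_def mult_ac)
    also have "\<dots> \<le> ennreal 3 * g z" by (intro mult_right_mono ennreal_leI) auto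
    finally show "(\<integral>\<^sup>+t. indicator {0<..l} t * h t z \<partial>lborel) \<le> 3 * g z" by simp
  qed
  also have "\<dots> = 3 * (\<integral>\<^sup>+z. g z \<partial>lborel)" by (rule nn_integral_cmult) measurable
  finally have "(\<integral>\<^sup>+t\<in>{0<..l}. ennreal (t * norm (f (w t)) powr p) \<partial>lborel) \<le> ennreal C * (3 * (\<integral>\<^sup>+z. g z \<partial>lborel))"
    by (simp add: mult_left_mono)
  also have "\<dots> < \<infinity>" using Lp by (simp add: g_def ennreal_mult_less_top)
  finally show ?thesis .
qed

lemma continuous_fw: "continuous_on {0<..l} (\<lambda>t. f (w t))"
  unfolding w_def
  by (intro continuous_on_compose2[OF holomorphic_on_imp_continuous_on[OF hol]] continuous_intros)
     (use w_in in \<open>auto simp: w_def\<close>)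

text \<open>The factor \<open>t\<close>, which the reflected kernel supplies, is kept inside because
  for p \<le> 2 the trace alone need not be integrable at \<open>a\<close>. The bound comes from
  \<open>ray_Lp\<close> through \<open>x \<le> x powr p + 1\<close>.\<close>

lemma integrable_ray: "set_integrable lborel {0<..l} (\<lambda>t. of_real t * f (w t))"
  unfolding set_integrable_def
proof (rule integrableI_bounded)
  show "(\<lambda>t. indicator {0<..l} t *\<^sub>R (of_real t * f (w t))) \<in> borel_measurable lborel"
    using borel_measurable_continuous_on_indicator[of "{0<..l}" "\<lambda>t. of_real t * f (w t)"]
    by (simp add: continuous_intros continuous_fw)
  have "(\<integral>\<^sup>+t. ennreal (norm (indicator {0<..l} t *\<^sub>R (of_real t * f (w t)))) \<partial>lborel)
    \<le> (\<integral>\<^sup>+t. ennreal (t * norm (f (w t)) powr p) * indicator {0<..l} t + ennreal l * indicator {0<..l} t \<partial>lborel)"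
  proof (intro nn_integral_mono)
    fix t
    show "ennreal (norm (indicator {0<..l} t *\<^sub>R (of_real t * f (w t))))
      \<le> ennreal (t * norm (f (w t)) powr p) * indicator {0<..l} t + ennreal l * indicator {0<..l} t"
    proof (cases "t \<in> {0<..l}")
      case True
      have "x \<le> x powr p + 1" if "x \<ge> 0" for x :: real
        using that p powr_mono[of 1 p x] by (cases "x \<le> 1") (auto simp: add_increasing)
      from this[of "norm (f (w t))"] have "t * norm (f (w t)) \<le> t * (norm (f (w t)) powr p + 1)"
        using True by (intro mult_left_mono) auto
      then have "t * norm (f (w t)) \<le> t * norm (f (w t)) powr p + l"
        using True by (simp add: algebra_simps)
      then show ?thesis using True l_pos
        by (simp add: norm_mult ennreal_plus[symmetric] ennreal_leI del: ennreal_plus)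
    qed auto
  qed
  also have "\<dots> = (\<integral>\<^sup>+t\<in>{0<..l}. ennreal (t * norm (f (w t)) powr p) \<partial>lborel) + (\<integral>\<^sup>+t. ennreal l * indicator {0<..l} t \<partial>lborel)"
  proof (rule nn_integral_add)
    have "(\<lambda>t. indicator {0<..l} t *\<^sub>R f (w t)) \<in> borel_measurable borel"
      by (intro borel_measurable_continuous_on_indicator continuous_fw) auto
    then have "(\<lambda>t. ennreal (t * norm (indicator {0<..l} t *\<^sub>R f (w t)) powr p) * indicator {0<..l} t) \<in> borel_measurable lborel"
      by measurable
    also have "(\<lambda>t. ennreal (t * norm (indicator {0<..l} t *\<^sub>R f (w t)) powr p) * indicator {0<..l} t)
       = (\<lambda>t. ennreal (t * norm (f (w t)) powr p) * indicator {0<..l} t)"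
      by (auto simp: indicator_def)
    finally show "(\<lambda>t. ennreal (t * norm (f (w t)) powr p) * indicator {0<..l} t) \<in> borel_measurable lborel" .
  qed simp
  also have "\<dots> < \<infinity>" using ray_Lp l_pos by (simp add: nn_integral_cmult_indicator ennreal_mult_less_top)
  finally show "(\<integral>\<^sup>+t. ennreal (norm (indicator {0<..l} t *\<^sub>R (of_real t * f (w t)))) \<partial>lborel) < \<infinity>" .
qed

end

section \<open>The Cauchy transform with reflected pole: holomorphy and p-integrability\<close>

context boundary_ray
begin

text \<open>The difference of the kernels with poles \<open>w t\<close> and \<open>b t\<close> has
  numerator \<open>b t - w t = - 2 * t * e\<close>. Together with dw = e dt and the Cauchy factor 1
  / (2 \<pi> i) this gives the constant behind the integral. The set \<open>I\<close> is variable so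
  that the part of the segment near a point of interest can be split off.\<close>

definition transform_on :: "real set \<Rightarrow> complex \<Rightarrow> complex" where
  "transform_on I z = (\<integral>t. indicator I t *\<^sub>R (of_real t * f (w t)) / ((w t - z) * (b t - z)) \<partial>lborel)
     * (\<i> * e\<^sup>2 / of_real pi)"

definition transform :: "complex \<Rightarrow> complex" where
  "transform = transform_on {0<..l}"

lemma integrable_ray_subset:
  assumes "I \<in> sets borel" "I \<subseteq> {0<..l}"
  shows "integrable lborel (\<lambda>t. indicator I t *\<^sub>R (of_real t * f (w t)))"
  using set_integrable_subset[OF integrable_ray _ assms(2)] assms(1) by (simp add: set_integrable_def)

lemma holomorphic_transform_on:
  assumes I: "I \<in> sets borel" "I \<subseteq> {0<..l}"
    and sep: "\<And>z. z \<in> U \<Longrightarrow> \<exists>\<delta>>0. \<forall>t\<in>I. \<delta> \<le> norm (w t - z) \<and> \<delta> \<le> norm (b t - z)"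
  shows "transform_on I holomorphic_on U"
  unfolding transform_on_def
proof (intro holomorphic_on_mult holomorphic_on_const holomorphic_on_two_pole_integral)
  show "integrable lborel (\<lambda>t. indicator I t *\<^sub>R (of_real t * f (w t)))"
    by (rule integrable_ray_subset[OF I])
  show "w \<in> borel_measurable lborel" "b \<in> borel_measurable lborel"
    unfolding w_def b_def by measurable
  fix z assume "z \<in> U"
  then obtain \<delta> where "\<delta> > 0" "\<forall>t\<in>I. \<delta> \<le> norm (w t - z) \<and> \<delta> \<le> norm (b t - z)" using sep by blast
  then show "\<exists>\<delta>>0. \<forall>t. indicator I t *\<^sub>R (of_real t * f (w t)) \<noteq> 0 \<longrightarrow> \<delta> \<le> norm (w t - z) \<and> \<delta> \<le> norm (b t - z)"
    by (intro exI[of _ \<delta>]) (auto simp: indicator_def)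
qed

text \<open>The reflected point \<open>b t = 2 a - w t\<close> stays outside any convex set that contains \<open>D\<close> but
  not \<open>a\<close>, since \<open>a\<close> would otherwise be the midpoint of two points of that set.\<close>

lemma reflected_dist:
  assumes "convex \<Omega>" "D \<subseteq> \<Omega>" "a \<notin> \<Omega>" "z \<in> \<Omega>" "0 < t" "t \<le> l"
  shows "t * r / l \<le> norm (b t - z)"
proof (rule ccontr)
  assume "\<not> t * r / l \<le> norm (b t - z)"
  moreover have "norm (b t - z) = norm (w t - (2 * a - z))"
  proof -
    have "w t - (2 * a - z) = - (b t - z)" by (simp add: w_def b_def)
    then show ?thesis by (simp only: norm_minus_cancel)
  qed
  ultimately have "2 * a - z \<in> ball (w t) (t * r / l)" by (simp add: dist_norm)
  then have "2 * a - z \<in> \<Omega>" using ball_w[OF assms(5,6)] assms(2) by auto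
  then have "(1/2) *\<^sub>R z + (1/2) *\<^sub>R (2 * a - z) \<in> \<Omega>"
    using assms(1,4) by (intro convexD) auto
  moreover have "(1/2) *\<^sub>R z + (1/2) *\<^sub>R (2 * a - z) = a" by (simp add: scaleR_conv_of_real algebra_simps)
  ultimately show False using assms(3) by simp
qed

text \<open>The cone around the segment bounds \<open>t\<close> by the distance to the reflected
  pole, and the triangle inequality then bounds |z - a|. Thus the reflected pole may be replaced by
  \<open>t + norm (z - a)\<close>, the form of the kernel in
  \<open>ray_kernel_Lp_bound\<close>.\<close>

lemma reflected_dist2:
  assumes "convex \<Omega>" "D \<subseteq> \<Omega>" "a \<notin> \<Omega>" "z \<in> \<Omega>" "0 < t" "t \<le> l"
  shows "t + norm (z - a) \<le> (1 + 2 * l / r) * norm (b t - z)"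
proof -
  have 1: "t \<le> l / r * norm (b t - z)"
    using reflected_dist[OF assms] l_pos r by (simp add: field_simps)
  have "norm (z - a) \<le> norm (b t - z) + norm (b t - a)"
    using norm_triangle_ineq[of "z - b t" "b t - a"] by (simp add: norm_minus_commute)
  also have "norm (b t - a) = t" using norm_e assms by (simp add: b_def norm_mult)
  finally have "t + norm (z - a) \<le> norm (b t - z) + 2 * (l / r * norm (b t - z))" using 1 by linarith
  then show ?thesis by (simp add: algebra_simps)
qed

lemma segment_eq: "closed_segment a c = w ` {0..l}"
proof (intro equalityI subsetI)
  fix x assume "x \<in> closed_segment a c"
  then obtain u where u: "0 \<le> u" "u \<le> 1" "x = (1 - u) *\<^sub>R a + u *\<^sub>R c" unfolding in_segment by auto
  have "of_real (u * l) * e = of_real u * (c - a)" using l_pos by (simp add: e_def)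
  moreover have "x = a + of_real u * (c - a)" using u by (simp add: scaleR_conv_of_real algebra_simps)
  ultimately have "x = w (u * l)" by (simp only: w_def)
  then show "x \<in> w ` {0..l}" using u l_pos by (auto intro!: image_eqI[of _ _ "u * l"] simp: mult_left_le_one_le)
next
  fix x assume "x \<in> w ` {0..l}"
  then obtain t where t: "0 \<le> t" "t \<le> l" "x = w t" by auto
  show "x \<in> closed_segment a c" unfolding in_segment
  proof (intro exI[of _ "t / l"] conjI)
    show "x = (1 - t / l) *\<^sub>R a + (t / l) *\<^sub>R c"
      using t l_pos by (simp add: w_def e_def scaleR_conv_of_real algebra_simps diff_divide_distrib)
  qed (use t l_pos in auto)
qed

lemma reflected_separation:
  assumes "convex \<Omega>" "D \<subseteq> \<Omega>" "a \<notin> \<Omega>" "z \<in> \<Omega>"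
  shows "\<exists>\<delta>>0. \<forall>t\<in>{0<..l}. \<delta> \<le> norm (b t - z)"
proof (intro exI[of _ "norm (z - a) / (1 + 2 * l / r)"] conjI ballI)
  have pos: "1 + 2 * l / r > 0" using l_pos r by (simp add: add_pos_pos)
  have "norm (z - a) > 0" using assms by auto
  then show "norm (z - a) / (1 + 2 * l / r) > 0" using pos by (rule divide_pos_pos)
  fix t assume "t \<in> {0<..l}"
  then have "norm (z - a) \<le> (1 + 2 * l / r) * norm (b t - z)"
    using reflected_dist2[OF assms, of t] by auto
  then show "norm (z - a) / (1 + 2 * l / r) \<le> norm (b t - z)" using pos by (simp add: divide_le_eq mult.commute)
qed

lemma holomorphic_transform:
  assumes "convex \<Omega>" "D \<subseteq> \<Omega>" "a \<notin> \<Omega>"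
  shows "transform holomorphic_on (\<Omega> - closed_segment a c)"
  unfolding transform_def
proof (rule holomorphic_transform_on)
  fix z assume z: "z \<in> \<Omega> - closed_segment a c"
  obtain \<delta> where \<delta>: "\<delta> > 0" "\<forall>t\<in>{0<..l}. \<delta> \<le> norm (b t - z)"
    using reflected_separation[OF assms] z by blast
  define \<eta> where "\<eta> = infdist z (closed_segment a c)"
  have "\<eta> > 0" unfolding \<eta>_def
    using z infdist_pos_not_in_closed[of "closed_segment a c" z] by auto
  moreover have "\<eta> \<le> norm (w t - z)" if "t \<in> {0<..l}" for t
  proof -
    have "w t \<in> closed_segment a c" unfolding segment_eq using that by auto
    then show ?thesis unfolding \<eta>_def using infdist_le[of "w t" "closed_segment a c" z]
      by (simp add: dist_norm norm_minus_commute)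
  qed
  ultimately show "\<exists>\<delta>>0. \<forall>t\<in>{0<..l}. \<delta> \<le> norm (w t - z) \<and> \<delta> \<le> norm (b t - z)"
    using \<delta> by (intro exI[of _ "min \<delta> \<eta>"]) (auto simp: min_le_iff_disj)
qed auto

text \<open>By \<open>reflected_dist2\<close> the integrand is dominated by the Schur kernel applied
  to the trace extended by 0, and \<open>ray_Lp\<close> makes the bound finite. The set
  \<open>Z\<close> avoids the whole ray, as \<open>ray_kernel_Lp_bound\<close> demands; this removes
  only a null set.\<close>

lemma transform_Lp:
  assumes \<Omega>: "convex \<Omega>" "D \<subseteq> \<Omega>" "a \<notin> \<Omega>"
    and Z: "Z \<subseteq> \<Omega>" "\<And>t z. t \<ge> 0 \<Longrightarrow> z \<in> Z \<Longrightarrow> z \<noteq> w t"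
  shows "(\<integral>\<^sup>+z\<in>Z. ennreal (norm (transform z) powr p) \<partial>lborel) < \<infinity>"
proof -
  define Q where "Q = 1 + 2 * l / r"
  have Q: "Q > 0" using l_pos r by (simp add: Q_def add_pos_pos)
  define F0 where "F0 t = norm (indicator {0<..l} t *\<^sub>R f (w t))" for t
  define F where "F t = Q / pi * F0 t" for t
  have Fm0[measurable]: "F0 \<in> borel_measurable borel" unfolding F0_def
    by (intro measurable_compose[OF _ borel_measurable_norm] borel_measurable_continuous_on_indicator continuous_fw) auto
  have Fm[measurable]: "F \<in> borel_measurable borel" unfolding F_def by measurable
  obtain K where K: "K > 0"
    "\<And>F Z c. F \<in> borel_measurable borel \<Longrightarrow> (\<And>t. 0 \<le> F t) \<Longrightarrow> (\<And>t. t \<le> 0 \<Longrightarrow> F t = 0) \<Longrightarrow>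
      (\<And>z. z \<in> Z \<Longrightarrow> 0 \<le> c z \<and> (\<forall>t\<ge>0. z \<noteq> a + of_real t * e) \<and>
         ennreal (c z) \<le> (\<integral>\<^sup>+t. ennreal (F t * t / (norm (z - (a + of_real t * e)) * (t + norm (z - a)))) \<partial>lborel)) \<Longrightarrow>
      (\<integral>\<^sup>+z\<in>Z. ennreal (c z powr p) \<partial>lborel) \<le> ennreal K * (\<integral>\<^sup>+t. ennreal (F t powr p * t) \<partial>lborel)"
    using ray_kernel_Lp_bound[OF p norm_e, of a] by blast
  have "(\<integral>\<^sup>+z\<in>Z. ennreal (norm (transform z) powr p) \<partial>lborel) \<le> ennreal K * (\<integral>\<^sup>+t. ennreal (F t powr p * t) \<partial>lborel)"
  proof (rule K(2)[OF Fm])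
    fix z assume z: "z \<in> Z"
    define G where "G t = indicator {0<..l} t *\<^sub>R (of_real t * f (w t)) / ((w t - z) * (b t - z)) * (\<i> * e\<^sup>2 / of_real pi)" for t
    have "transform z = (\<integral>t. G t \<partial>lborel)"
      unfolding transform_def transform_on_def G_def by (rule integral_mult_left_zero[symmetric])
    \<comment> \<open>A non-integrable \<open>G\<close> has Bochner integral 0, so the estimate
      holds in that case too.\<close>
    then have "ennreal (norm (transform z)) \<le> (\<integral>\<^sup>+t. ennreal (norm (G t)) \<partial>lborel)"
      using integral_norm_bound_ennreal[of lborel G]
      by (cases "integrable lborel G") (simp_all add: not_integrable_integral_eq)
    also have "\<dots> \<le> (\<integral>\<^sup>+t. ennreal (F t * t / (norm (z - (a + of_real t * e)) * (t + norm (z - a)))) \<partial>lborel)"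
    proof (intro nn_integral_mono ennreal_leI)
      fix t
      show "norm (G t) \<le> F t * t / (norm (z - (a + of_real t * e)) * (t + norm (z - a)))"
      proof (cases "t \<in> {0<..l}")
        case True
        then have t: "0 < t" "t \<le> l" by auto
        define d where "d = norm (w t - z)"
        define m where "m = norm (b t - z)"
        have d: "d > 0" using Z(2)[of t z] t z by (auto simp: d_def)
        have m: "t + norm (z - a) \<le> Q * m"
          unfolding Q_def m_def using reflected_dist2[OF \<Omega> _ t] z Z(1) by blast
        have tp: "t + norm (z - a) > 0" using t by (simp add: add_pos_nonneg)
        have "(t + norm (z - a)) / Q \<le> m" using m Q by (simp add: divide_le_eq mult.commute)
        moreover have "(t + norm (z - a)) / Q > 0" using tp Q by simp
        ultimately have m1: "1 / m \<le> 1 / ((t + norm (z - a)) / Q)" by (intro frac_le) auto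
        have "norm (G t) = F0 t * t / (pi * d) * (1 / m)"
          using True norm_e by (simp add: G_def F0_def d_def m_def norm_divide norm_mult norm_power mult_ac)
        also have "\<dots> \<le> F0 t * t / (pi * d) * (1 / ((t + norm (z - a)) / Q))"
          using m1 t d by (intro mult_left_mono) (simp_all add: F0_def)
        also have "\<dots> = F t * t / (norm (z - (a + of_real t * e)) * (t + norm (z - a)))"
          by (simp add: d_def w_def F_def norm_minus_commute mult_ac)
        finally show ?thesis .
      qed (simp add: G_def F_def F0_def)
    qed
    finally show "0 \<le> norm (transform z) \<and> (\<forall>t\<ge>0. z \<noteq> a + of_real t * e) \<and>
         ennreal (norm (transform z)) \<le> (\<integral>\<^sup>+t. ennreal (F t * t / (norm (z - (a + of_real t * e)) * (t + norm (z - a)))) \<partial>lborel)"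
      using Z(2)[OF _ z] by (auto simp: w_def)
  qed (use Q in \<open>auto simp: F_def F0_def\<close>)
  also have "(\<integral>\<^sup>+t. ennreal (F t powr p * t) \<partial>lborel) = (\<integral>\<^sup>+t. ennreal ((Q / pi) powr p) * ennreal (F0 t powr p * t) \<partial>lborel)"
    using Q by (intro nn_integral_cong, subst ennreal_mult'[symmetric]) (simp_all add: F_def F0_def powr_mult powr_divide mult_ac)
  also have "\<dots> = ennreal ((Q / pi) powr p) * (\<integral>\<^sup>+t. ennreal (F0 t powr p * t) \<partial>lborel)"
    by (rule nn_integral_cmult) measurable
  also have "(\<integral>\<^sup>+t. ennreal (F0 t powr p * t) \<partial>lborel) = (\<integral>\<^sup>+t\<in>{0<..l}. ennreal (t * norm (f (w t)) powr p) \<partial>lborel)"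
    using p by (intro nn_integral_cong) (auto simp: F0_def indicator_def mult.commute)
  finally show ?thesis
    by (rule le_less_trans) (use ray_Lp in \<open>simp add: ennreal_mult_less_top\<close>)
qed

end

text \<open>Reduced to two poles: an artificial constant pole \<open>K\<close> at distance at least
  1 from a small disc is inserted, and its factor \<open>K - z\<close> is multiplied back.\<close>

lemma holomorphic_on_pole_integral:
  fixes \<phi> b :: "'a \<Rightarrow> complex"
  assumes \<phi>: "integrable M \<phi>" and [measurable]: "b \<in> borel_measurable M"
    and sep: "\<And>z. z \<in> U \<Longrightarrow> \<exists>\<delta>>0. \<forall>t. \<phi> t \<noteq> 0 \<longrightarrow> \<delta> \<le> norm (b t - z)"
  shows "(\<lambda>z. \<integral>t. \<phi> t / (b t - z) \<partial>M) holomorphic_on U"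
proof (rule holomorphic_onI)
  fix z0 assume "z0 \<in> U"
  then obtain \<delta> where \<delta>: "\<delta> > 0" "\<And>t. \<phi> t \<noteq> 0 \<Longrightarrow> \<delta> \<le> norm (b t - z0)" using sep by blast
  define V where "V = ball z0 (min 1 (\<delta> / 2))"
  define K where "K = z0 + 2"
  have K: "norm (K - z) \<ge> 1" if "z \<in> V" for z
    using that norm_triangle_ineq2[of 2 "z - z0"] by (simp add: V_def K_def dist_norm norm_minus_commute algebra_simps)
  have bb: "\<delta> / 2 \<le> norm (b t - z)" if "z \<in> V" "\<phi> t \<noteq> 0" for z t
    using that \<delta>(2)[OF that(2)] norm_triangle_ineq[of "b t - z" "z - z0"] by (simp add: V_def dist_norm norm_minus_commute)
  have "(\<lambda>z. (K - z) * (\<integral>t. \<phi> t / ((K - z) * (b t - z)) \<partial>M)) holomorphic_on V"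
  proof (intro holomorphic_intros holomorphic_on_two_pole_integral[OF \<phi>])
    fix z assume "z \<in> V"
    then show "\<exists>\<delta>>0. \<forall>t. \<phi> t \<noteq> 0 \<longrightarrow> \<delta> \<le> norm (K - z) \<and> \<delta> \<le> norm (b t - z)"
      using K bb \<delta>(1) by (intro exI[of _ "min 1 (\<delta> / 2)"]) (auto simp: min_le_iff_disj)
  qed auto
  moreover have "(K - z) * (\<integral>t. \<phi> t / ((K - z) * (b t - z)) \<partial>M) = (\<integral>t. \<phi> t / (b t - z) \<partial>M)" if "z \<in> V" for z
  proof -
    have "K - z \<noteq> 0" using K[OF that] by auto
    then show ?thesis by (subst integral_mult_right_zero[symmetric]) simp
  qed
  ultimately have "(\<lambda>z. \<integral>t. \<phi> t / (b t - z) \<partial>M) holomorphic_on V"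
    by (simp cong: holomorphic_cong)
  then have "(\<lambda>z. \<integral>t. \<phi> t / (b t - z) \<partial>M) field_differentiable at z0"
    by (rule holomorphic_on_imp_differentiable_at) (use \<delta>(1) in \<open>auto simp: V_def\<close>)
  then show "(\<lambda>z. \<integral>t. \<phi> t / (b t - z) \<partial>M) field_differentiable at z0 within U"
    by (rule field_differentiable_at_within)
qed

lemma integrable_two_pole:
  fixes \<phi> w b :: "'a \<Rightarrow> complex"
  assumes \<phi>: "integrable M \<phi>" and [measurable]: "w \<in> borel_measurable M" "b \<in> borel_measurable M"
    and \<delta>: "\<delta> > 0" "\<And>t. \<phi> t \<noteq> 0 \<Longrightarrow> \<delta> \<le> norm (w t - z) \<and> \<delta> \<le> norm (b t - z)"
  shows "integrable M (\<lambda>t. \<phi> t / ((w t - z) * (b t - z)))"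
proof (rule Bochner_Integration.integrable_bound)
  note [measurable] = borel_measurable_integrable[OF \<phi>]
  show "(\<lambda>t. \<phi> t / ((w t - z) * (b t - z))) \<in> borel_measurable M" by measurable
  show "integrable M (\<lambda>t. (1 / (\<delta> * \<delta>)) *\<^sub>R \<phi> t)" using \<phi> by simp
  have "norm (\<phi> t / ((w t - z) * (b t - z))) \<le> norm ((1 / (\<delta> * \<delta>)) *\<^sub>R \<phi> t)" for t
  proof (cases "\<phi> t = 0")
    case False
    have "\<delta> * \<delta> \<le> norm (w t - z) * norm (b t - z)"
      using \<delta>(2)[OF False] \<delta>(1) by (intro mult_mono) auto
    then have "norm (\<phi> t) / (norm (w t - z) * norm (b t - z)) \<le> norm (\<phi> t) / (\<delta> * \<delta>)"
      using \<delta>(1) by (intro divide_left_mono) (auto intro: mult_pos_pos less_le_trans)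
    then show ?thesis by (simp add: norm_divide norm_mult)
  qed auto
  then show "AE t in M. norm (\<phi> t / ((w t - z) * (b t - z))) \<le> norm ((1 / (\<delta> * \<delta>)) *\<^sub>R \<phi> t)" by simp
qed

lemma holomorphic_on_contour_integral_linepath:
  assumes "continuous_on (closed_segment x y) g" "open U" "closed_segment x y \<inter> U = {}"
  shows "(\<lambda>z. contour_integral (linepath x y) (\<lambda>u. g u / (u - z))) holomorphic_on U"
proof (rule holomorphic_onI)
  fix z assume z: "z \<in> U"
  have int: "((\<lambda>u. g u / (u - z) ^ 1) has_contour_integral contour_integral (linepath x y) (\<lambda>u. g u / (u - z))) (linepath x y)"
    if "z \<in> U" for z
  proof -
    have "(\<lambda>u. g u / (u - z)) contour_integrable_on linepath x y"
      using that assms by (intro contour_integrable_continuous_linepath continuous_intros) auto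
    then show ?thesis by (simp add: has_contour_integral_integral)
  qed
  have "((\<lambda>z. contour_integral (linepath x y) (\<lambda>u. g u / (u - z))) has_field_derivative
    (of_nat 1 * contour_integral (linepath x y) (\<lambda>u. g u / (u - z) ^ (Suc 1)))) (at z)"
  proof (rule Cauchy_next_derivative(2)[where S = U and B = "norm (y - x)"])
    show "\<And>t. t \<in> {0..1} \<Longrightarrow> norm (vector_derivative (linepath x y) (at t)) \<le> norm (y - x)" by simp
  qed (use assms z int in auto)
  then show "(\<lambda>z. contour_integral (linepath x y) (\<lambda>u. g u / (u - z))) field_differentiable at z within U"
    by (metis field_differentiable_at_within field_differentiable_def)
qed

text \<open>The Plemelj jump relation. Closing the segment to the triangle -1, 1, i makes the Cauchy
  integral equal to \<open>f\<close> above the segment and 0 below it, while the two added sides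
  stay away from the small disc and contribute a function holomorphic across the segment.\<close>

lemma segment_jump_normalized:
  assumes hol: "f holomorphic_on ball 0 2"
  obtains J where "J holomorphic_on ball 0 (1/2)"
    "\<And>z. z \<in> ball 0 (1/2) \<Longrightarrow> Im z \<noteq> 0 \<Longrightarrow>
      contour_integral (linepath (-1) 1) (\<lambda>u. f u / (u - z)) = 2 * pi * \<i> * (J z + (if Im z > 0 then f z else 0))"
proof -
  define J where "J z = - (contour_integral (linepath 1 \<i>) (\<lambda>u. f u / (u - z)) + contour_integral (linepath \<i> (-1)) (\<lambda>u. f u / (u - z))) / (2 * pi * \<i>)" for z
  have in2: "1 \<in> ball (0::complex) 2" "\<i> \<in> ball 0 2" "-1 \<in> ball (0::complex) 2" by auto
  have segs: "closed_segment 1 \<i> \<subseteq> ball 0 2" "closed_segment \<i> (-1) \<subseteq> ball 0 2" "closed_segment (-1) 1 \<subseteq> ball (0::complex) 2"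
    using in2 by (metis closed_segment_subset convex_ball)+
  have cont: "continuous_on (ball 0 2) f" using hol by (rule holomorphic_on_imp_continuous_on)
  have small: "\<bar>Re z\<bar> < 1/2" "\<bar>Im z\<bar> < 1/2" if "z \<in> ball 0 (1/2)" for z :: complex
    using that abs_Re_le_cmod[of z] abs_Im_le_cmod[of z] by auto
  have off1: "z \<notin> closed_segment 1 \<i>" if "z \<in> ball 0 (1/2)" for z
  proof
    assume "z \<in> closed_segment 1 \<i>"
    then obtain u where "z = (1 - u) *\<^sub>R 1 + u *\<^sub>R \<i>" unfolding in_segment by auto
    then have "Re z + Im z = 1" by simp
    then show False using small[OF that] by linarith
  qed
  have off2: "z \<notin> closed_segment \<i> (-1)" if "z \<in> ball 0 (1/2)" for z
  proof
    assume "z \<in> closed_segment \<i> (-1)"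
    then obtain u where "z = (1 - u) *\<^sub>R \<i> + u *\<^sub>R (-1)" unfolding in_segment by auto
    then have "- Re z + Im z = 1" by simp
    then show False using small[OF that] by linarith
  qed
  have off3: "z \<notin> closed_segment (-1) 1" if "Im z \<noteq> 0" for z
  proof
    assume "z \<in> closed_segment (-1) 1"
    then obtain u where "z = (1 - u) *\<^sub>R (-1) + u *\<^sub>R 1" unfolding in_segment by auto
    then show False using that by simp
  qed
  define P where "P = linepath (-1) 1 +++ linepath 1 \<i> +++ linepath \<i> (-1)"
  have P: "valid_path P" "pathfinish P = pathstart P"
    "path_image P = closed_segment (-1) 1 \<union> closed_segment 1 \<i> \<union> closed_segment \<i> (-1)"
    by (auto simp: P_def path_image_join valid_path_join)
  show thesis
  proof (rule that[of J])
    show "J holomorphic_on ball 0 (1/2)"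
      unfolding J_def
      by (intro holomorphic_intros holomorphic_on_contour_integral_linepath continuous_on_subset[OF cont] segs)
         (use off1 off2 in auto)
    fix z :: complex assume z: "z \<in> ball 0 (1/2)" "Im z \<noteq> 0"
    have ci: "(\<lambda>u. f u / (u - z)) contour_integrable_on linepath (-1) 1"
      "(\<lambda>u. f u / (u - z)) contour_integrable_on linepath 1 \<i>"
      "(\<lambda>u. f u / (u - z)) contour_integrable_on linepath \<i> (-1)"
      using off1[OF z(1)] off2[OF z(1)] off3[OF z(2)]
      by (auto intro!: contour_integrable_continuous_linepath continuous_intros continuous_on_subset[OF cont] segs
          simp del: mem_ball)
    have sum: "contour_integral P (\<lambda>u. f u / (u - z)) = contour_integral (linepath (-1) 1) (\<lambda>u. f u / (u - z))
      + (contour_integral (linepath 1 \<i>) (\<lambda>u. f u / (u - z)) + contour_integral (linepath \<i> (-1)) (\<lambda>u. f u / (u - z)))"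
      unfolding P_def using ci by (simp add: contour_integrable_joinI valid_path_join)
    have "contour_integral P (\<lambda>u. f u / (u - z)) = 2 * pi * \<i> * (if Im z > 0 then f z else 0)"
    proof (cases "Im z > 0")
      case True
      have "{z. Im z > 0} \<inter> ball 0 (1/2) \<subseteq> convex hull {-1, 1, \<i>}"
      proof
        fix x assume x: "x \<in> {z. Im z > 0} \<inter> ball 0 (1/2)"
        \<comment> \<open>Barycentric coordinates: the vertex i must carry the weight
          \<open>Im x\<close>, and the rest is shared between -1 and 1 to match the real
          part.\<close>
        define u1 where "u1 = ((1 - Im x) - Re x) / 2"
        define u2 where "u2 = ((1 - Im x) + Re x) / 2"
        have "u1 \<ge> 0" "u2 \<ge> 0" "Im x \<ge> 0" using x small[of x] by (auto simp: u1_def u2_def)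
        moreover have "u1 + u2 + Im x = 1" by (simp add: u1_def u2_def field_simps)
        moreover have "x = u1 *\<^sub>R (-1) + u2 *\<^sub>R 1 + Im x *\<^sub>R \<i>"
          by (simp add: complex_eq_iff u1_def u2_def field_simps)
        ultimately show "x \<in> convex hull {-1, 1, \<i>}" unfolding convex_hull_3 by blast
      qed
      then have "{z. Im z > 0} \<inter> ball 0 (1/2) \<subseteq> interior (convex hull {-1, 1, \<i>})"
        by (rule interior_maximal) (intro open_Int open_halfspace_Im_gt open_ball)
      then have "z \<in> interior (convex hull {-1, 1, \<i>})" using True z by auto
      from winding_number_triangle[OF this] have "winding_number P z = 1"
        using True by (simp add: P_def)
      moreover have "((\<lambda>u. f u / (u - z)) has_contour_integral (2 * pi * \<i> * winding_number P z * f z)) P"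
      proof (rule Cauchy_integral_formula_convex_simple[OF convex_ball hol])
        show "path_image P \<subseteq> ball 0 2 - {z}"
          unfolding P using segs off1[OF z(1)] off2[OF z(1)] off3[OF z(2)] by blast
      qed (use P z in auto)
      ultimately show ?thesis using True by (simp add: contour_integral_unique)
    next
      case False
      \<comment> \<open>Here \<open>z\<close> lies below the real axis, so the triangle is contained
        in this convex set, on which the integrand has no pole.\<close>
      define S where "S = {u. Im u > Im z} \<inter> ball 0 2"
      have "closed_segment x y \<subseteq> S" if "x \<in> {-1, 1, \<i>}" "y \<in> {-1, 1, \<i>}" for x y
        using that False z by (intro closed_segment_subset)
          (auto simp: S_def intro!: convex_Int convex_halfspace_Im_gt)
      then have "path_image P \<subseteq> S" unfolding P by simp
      then have "((\<lambda>u. f u / (u - z)) has_contour_integral 0) P"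
        using P by (intro Cauchy_theorem_convex_simple[of _ S])
          (auto simp: S_def intro!: convex_Int convex_halfspace_Im_gt holomorphic_intros holomorphic_on_subset[OF hol])
      then show ?thesis using False by (simp add: contour_integral_unique)
    qed
    then have "contour_integral (linepath (-1) 1) (\<lambda>u. f u / (u - z)) = 2 * pi * \<i> * (if Im z > 0 then f z else 0)
      - (contour_integral (linepath 1 \<i>) (\<lambda>u. f u / (u - z)) + contour_integral (linepath \<i> (-1)) (\<lambda>u. f u / (u - z)))"
      unfolding sum by (simp add: algebra_simps)
    also have "\<dots> = 2 * pi * \<i> * (J z + (if Im z > 0 then f z else 0))"
      unfolding J_def by (simp add: field_simps)
    finally show "contour_integral (linepath (-1) 1) (\<lambda>u. f u / (u - z)) = 2 * pi * \<i> * (J z + (if Im z > 0 then f z else 0))" .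
  qed
qed

section \<open>Jump of the transform across the segment, and its growth at the inner
  endpoint\<close>

context boundary_ray
begin

lemma integrable_transform_on:
  assumes I: "I \<in> sets borel" "I \<subseteq> {0<..l}"
    and \<delta>: "\<delta> > 0" "\<And>t. t \<in> I \<Longrightarrow> \<delta> \<le> norm (w t - z) \<and> \<delta> \<le> norm (b t - z)"
  shows "integrable lborel (\<lambda>t. indicator I t *\<^sub>R (of_real t * f (w t)) / ((w t - z) * (b t - z)))"
proof (rule integrable_two_pole[OF integrable_ray_subset[OF I] _ _ \<delta>(1)])
  show "w \<in> borel_measurable lborel" "b \<in> borel_measurable lborel"
    unfolding w_def b_def by measurable
qed (use \<delta>(2) in \<open>auto simp: indicator_def split: if_splits\<close>)

lemma transform_on_split:
  assumes I: "I \<in> sets borel" "I' \<in> sets borel" "I \<inter> I' = {}" "I \<union> I' \<subseteq> {0<..l}"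
    and \<delta>: "\<delta> > 0" "\<And>t. t \<in> I \<union> I' \<Longrightarrow> \<delta> \<le> norm (w t - z) \<and> \<delta> \<le> norm (b t - z)"
  shows "transform_on (I \<union> I') z = transform_on I z + transform_on I' z"
proof -
  have "indicator (I \<union> I') t *\<^sub>R (of_real t * f (w t)) / ((w t - z) * (b t - z)) =
     indicator I t *\<^sub>R (of_real t * f (w t)) / ((w t - z) * (b t - z))
     + indicator I' t *\<^sub>R (of_real t * f (w t)) / ((w t - z) * (b t - z))" for t
    using I(3) by (auto simp: indicator_def)
  then show ?thesis unfolding transform_on_def
    using integrable_transform_on[of I, OF I(1) _ \<delta>(1)] integrable_transform_on[of I', OF I(2) _ \<delta>(1)] I(4) \<delta>(2)
    by (simp add: distrib_right add_divide_distrib)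
qed

text \<open>The interval stays away from 0, so partial fractions may undo the combined kernel and
  both single-pole integrals converge. The substitution z = w t0 + \<eta> e \<zeta> carries the
  first one to the segment from -1 to 1. The function \<open>J\<close> enters by hypothesis because
  it must not depend on \<open>z\<close>.\<close>

lemma transform_jump_middle:
  assumes \<eta>: "0 < \<eta>" "\<eta> < t0" "t0 + \<eta> < l" and sub: "ball (w t0) (2 * \<eta>) \<subseteq> D"
    and z: "z \<in> ball (w t0) (\<eta> / 2)" "Im ((z - a) / e) \<noteq> 0"
    and J: "\<And>\<zeta>. \<zeta> \<in> ball 0 (1/2) \<Longrightarrow> Im \<zeta> \<noteq> 0 \<Longrightarrow>
      contour_integral (linepath (-1) 1) (\<lambda>u. f (w t0 + of_real \<eta> * e * u) / (u - \<zeta>))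
        = 2 * pi * \<i> * (J \<zeta> + (if Im \<zeta> > 0 then f (w t0 + of_real \<eta> * e * \<zeta>) else 0))"
    and \<delta>: "\<delta> > 0" "\<And>t. t \<in> {t0 - \<eta>..t0 + \<eta>} \<Longrightarrow> \<delta> \<le> norm (w t - z) \<and> \<delta> \<le> norm (b t - z)"
  shows "transform_on {t0 - \<eta>..t0 + \<eta>} z = J ((z - w t0) / (of_real \<eta> * e))
     + (if Im ((z - a) / e) > 0 then f z else 0)
     - (\<integral>t. indicator {t0 - \<eta>..t0 + \<eta>} t *\<^sub>R f (w t) / (b t - z) \<partial>lborel) * (e / (2 * pi * \<i>))"
proof -
  define I where "I = {t0 - \<eta>..t0 + \<eta>}"
  define \<zeta> where "\<zeta> = (z - w t0) / (of_real \<eta> * e)"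
  have e0: "e \<noteq> 0" using norm_e by auto
  have z_eq: "w t0 + of_real \<eta> * e * \<zeta> = z" using e0 \<eta> by (simp add: \<zeta>_def)
  have "norm \<zeta> = norm (z - w t0) / \<eta>" using \<eta> norm_e by (simp add: \<zeta>_def norm_divide norm_mult)
  also have "\<dots> < 1 / 2" using z(1) \<eta> by (simp add: dist_norm norm_minus_commute divide_less_eq)
  finally have \<zeta>: "\<zeta> \<in> ball 0 (1/2)" by simp
  have Im\<zeta>: "Im ((z - a) / e) = \<eta> * Im \<zeta>"
  proof -
    have "(z - a) / e = of_real t0 + of_real \<eta> * \<zeta>" using e0 z_eq[symmetric] by (simp add: w_def field_simps)
    then show ?thesis by simp
  qed
  have bm: "w \<in> borel_measurable borel" "b \<in> borel_measurable borel" unfolding w_def b_def by measurable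
  have I: "I \<subseteq> {0<..l}" "I \<in> sets borel" using \<eta> by (auto simp: I_def)
  have fI: "integrable lborel (\<lambda>t. indicator I t *\<^sub>R f (w t))"
    using borel_integrable_atLeastAtMost'[of "t0 - \<eta>" "t0 + \<eta>" "\<lambda>t. f (w t)"] continuous_on_subset[OF continuous_fw I(1)]
    by (simp add: set_integrable_def I_def)
  have int1: "integrable lborel (\<lambda>t. indicator I t *\<^sub>R f (w t) / (w t - z))"
    and int2: "integrable lborel (\<lambda>t. indicator I t *\<^sub>R f (w t) / (b t - z))"
  proof -
    \<comment> \<open>The factor is 1: a second pole at \<open>z + 1\<close> is added so that the
      two-pole integrability lemma covers a single pole.\<close>
    have "integrable lborel (\<lambda>t. (z + 1 - z) * (indicator I t *\<^sub>R f (w t) / ((w t - z) * (z + 1 - z))))"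
      by (intro integrable_mult_right integrable_two_pole[OF fI, of _ _ "min 1 \<delta>"])
         (use bm \<delta> in \<open>auto simp: I_def min_le_iff_disj indicator_def split: if_splits\<close>)
    then show "integrable lborel (\<lambda>t. indicator I t *\<^sub>R f (w t) / (w t - z))" by simp
    have "integrable lborel (\<lambda>t. (z + 1 - z) * (indicator I t *\<^sub>R f (w t) / ((b t - z) * (z + 1 - z))))"
      by (intro integrable_mult_right integrable_two_pole[OF fI, of _ _ "min 1 \<delta>"])
         (use bm \<delta> in \<open>auto simp: I_def min_le_iff_disj indicator_def split: if_splits\<close>)
    then show "integrable lborel (\<lambda>t. indicator I t *\<^sub>R f (w t) / (b t - z))" by simp
  qed
  have pf: "indicator I t *\<^sub>R (of_real t * f (w t)) / ((w t - z) * (b t - z))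
     = (indicator I t *\<^sub>R f (w t) / (b t - z) - indicator I t *\<^sub>R f (w t) / (w t - z)) / (2 * e)" for t
  proof (cases "t \<in> I")
    case True
    then have nz: "w t - z \<noteq> 0" "b t - z \<noteq> 0" using \<delta>(2)[of t] \<delta>(1) by (auto simp: I_def)
    have "1 / (b t - z) - 1 / (w t - z) = (w t - b t) / ((w t - z) * (b t - z))"
      using nz by (simp add: field_simps)
    also have "w t - b t = of_real t * (2 * e)" by (simp add: w_def b_def)
    finally have "of_real t / ((w t - z) * (b t - z)) = (1 / (b t - z) - 1 / (w t - z)) / (2 * e)"
      using e0 by simp
    then have "f (w t) * (of_real t / ((w t - z) * (b t - z))) = f (w t) * ((1 / (b t - z) - 1 / (w t - z)) / (2 * e))"
      by simp
    then show ?thesis using True by (simp add: right_diff_distrib diff_divide_distrib mult.commute)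
  qed auto
  have "transform_on I z = ((\<integral>t. indicator I t *\<^sub>R f (w t) / (b t - z) \<partial>lborel)
     - (\<integral>t. indicator I t *\<^sub>R f (w t) / (w t - z) \<partial>lborel)) / (2 * e) * (\<i> * e\<^sup>2 / of_real pi)"
    unfolding transform_on_def pf using int1 int2 by simp
  also have "\<dots> = ((\<integral>t. indicator I t *\<^sub>R f (w t) / (w t - z) \<partial>lborel) * e) / (2 * pi * \<i>)
     - (\<integral>t. indicator I t *\<^sub>R f (w t) / (b t - z) \<partial>lborel) * (e / (2 * pi * \<i>))"
    using e0 by (simp add: field_simps power2_eq_square)
  also have "(\<integral>t. indicator I t *\<^sub>R f (w t) / (w t - z) \<partial>lborel) * e
     = contour_integral (linepath (-1) 1) (\<lambda>u. f (w t0 + of_real \<eta> * e * u) / (u - \<zeta>))"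
  proof -
    define g where "g x = f (w (t0 - \<eta> + (2 * \<eta>) * x)) / (of_real (2 * x - 1) - \<zeta>) * 2" for x
    have ww: "w (t0 - \<eta> + (2 * \<eta>) * x) = w t0 + of_real \<eta> * e * of_real (2 * x - 1)" for x
      by (simp add: w_def algebra_simps)
    have wz: "w (t0 - \<eta> + (2 * \<eta>) * x) - z = of_real \<eta> * e * (of_real (2 * x - 1) - \<zeta>)" for x
      unfolding ww by (subst z_eq[symmetric]) (simp add: algebra_simps)
    have nz: "of_real (2 * x - 1) - \<zeta> \<noteq> 0" for x
      using z(2) Im\<zeta> by (metis Im_complex_of_real eq_iff_diff_eq_0 mult_zero_right)
    have "(\<integral>t. indicator I t *\<^sub>R f (w t) / (w t - z) \<partial>lborel) * e
      = ((2 * \<eta>) *\<^sub>R (\<integral>x. indicator I (t0 - \<eta> + (2 * \<eta>) * x) *\<^sub>R f (w (t0 - \<eta> + (2 * \<eta>) * x)) / (w (t0 - \<eta> + (2 * \<eta>) * x) - z) \<partial>lborel)) * e"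
      using \<eta> by (subst lborel_integral_real_affine[where c = "2 * \<eta>" and t = "t0 - \<eta>"]) auto
    also have "\<dots> = (\<integral>x. (2 * \<eta>) *\<^sub>R (indicator I (t0 - \<eta> + (2 * \<eta>) * x) *\<^sub>R f (w (t0 - \<eta> + (2 * \<eta>) * x)) / (w (t0 - \<eta> + (2 * \<eta>) * x) - z)) * e \<partial>lborel)"
      by (simp only: integral_mult_left_zero integral_scaleR_right)
    also have "\<dots> = (LINT x:{0..1}|lborel. g x)"
      unfolding set_lebesgue_integral_def
    proof (intro Bochner_Integration.integral_cong refl)
      fix x :: real
      have "t0 - \<eta> + (2 * \<eta>) * x \<in> I \<longleftrightarrow> x \<in> {0..1}"
        using \<eta> by (auto simp: I_def zero_le_mult_iff)
      then have ind: "indicator I (t0 - \<eta> + (2 * \<eta>) * x) = (indicator {0..1} x :: real)" by (simp add: indicator_def)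
      show "(2 * \<eta>) *\<^sub>R (indicator I (t0 - \<eta> + (2 * \<eta>) * x) *\<^sub>R f (w (t0 - \<eta> + (2 * \<eta>) * x)) / (w (t0 - \<eta> + (2 * \<eta>) * x) - z)) * e
         = indicator {0..1} x *\<^sub>R g x"
        unfolding ind wz g_def using \<eta> e0 nz[of x] by (simp add: scaleR_conv_of_real)
    qed
    also have "\<dots> = integral {0..1} g"
    proof (rule set_borel_integral_eq_integral(2), rule borel_integrable_atLeastAtMost')
      have "continuous_on {0..1} (\<lambda>x. f (w (t0 - \<eta> + (2 * \<eta>) * x)))"
      proof (rule continuous_on_compose2[OF continuous_on_subset[OF continuous_fw I(1)]])
        show "(\<lambda>x. t0 - \<eta> + (2 * \<eta>) * x) ` {0..1} \<subseteq> I" using \<eta> by (auto simp: I_def)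
      qed (auto intro!: continuous_intros)
      then show "continuous_on {0..1} g" unfolding g_def using nz by (intro continuous_intros) auto
    qed
    also have "\<dots> = contour_integral (linepath (-1) 1) (\<lambda>u. f (w t0 + of_real \<eta> * e * u) / (u - \<zeta>))"
    proof -
      have "linepath (-1) 1 x = complex_of_real (2 * x - 1)" for x
        by (simp add: linepath_def scaleR_conv_of_real algebra_simps)
      then show ?thesis unfolding contour_integral_integral g_def ww by simp
    qed
    finally show ?thesis .
  qed
  also have "\<dots> = 2 * pi * \<i> * (J \<zeta> + (if Im \<zeta> > 0 then f (w t0 + of_real \<eta> * e * \<zeta>) else 0))"
    using z(2) Im\<zeta> by (intro J \<zeta>) auto
  also have "\<dots> / (2 * pi * \<i>) = J \<zeta> + (if Im ((z - a) / e) > 0 then f z else 0)"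
    unfolding z_eq Im\<zeta> using \<eta> by (simp add: zero_less_mult_iff)
  finally show ?thesis by (simp add: I_def \<zeta>_def)
qed

text \<open>Positive \<open>Im ((z - a) / e)\<close> is the left side of the ray, looking from
  \<open>a\<close> towards \<open>c\<close>. \<open>H\<close> collects all that continues across the
  segment: the distant parts of the segment, the closing sides of the triangle and the reflected
  pole.\<close>

lemma transform_jump:
  assumes \<Omega>: "convex \<Omega>" "D \<subseteq> \<Omega>" "a \<notin> \<Omega>" and t0: "0 < t0" "t0 < l"
  obtains \<delta> H where "\<delta> > 0" "ball (w t0) \<delta> \<subseteq> D" "H holomorphic_on ball (w t0) \<delta>"
    "\<And>z. z \<in> ball (w t0) \<delta> \<Longrightarrow> Im ((z - a) / e) \<noteq> 0 \<Longrightarrow>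
       transform z = H z + (if Im ((z - a) / e) > 0 then f z else 0)"
proof -
  have e0: "e \<noteq> 0" using norm_e by auto
  obtain R where R: "R > 0" "ball (w t0) R \<subseteq> D"
    using open_contains_ball_eq[OF open_D] w_in[of t0] t0 by auto
  \<comment> \<open>Half of \<open>R\<close>, because the normalised jump lemma needs
    \<open>f\<close> on a disc of twice the half-length of the segment; the other two terms keep the
    segment strictly between \<open>a\<close> and \<open>c\<close>.\<close>
  define \<eta> where "\<eta> = min (R / 2) (min (t0 / 2) ((l - t0) / 2))"
  have \<eta>: "0 < \<eta>" "\<eta> < t0" "t0 + \<eta> < l" "2 * \<eta> \<le> R" using R t0 by (auto simp: \<eta>_def min_def field_simps)
  have sub: "ball (w t0) (2 * \<eta>) \<subseteq> D" using R(2) \<eta>(4) by (meson subset_ball subset_trans)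
  define fh where "fh \<zeta> = f (w t0 + of_real \<eta> * e * \<zeta>)" for \<zeta>
  have "fh holomorphic_on ball 0 2"
    unfolding fh_def
  proof (rule holomorphic_on_compose_gen[OF _ hol, unfolded o_def])
    show "(\<lambda>\<zeta>. w t0 + of_real \<eta> * e * \<zeta>) holomorphic_on ball 0 2" by (intro holomorphic_intros)
    show "(\<lambda>\<zeta>. w t0 + of_real \<eta> * e * \<zeta>) ` ball 0 2 \<subseteq> D"
      using sub \<eta> norm_e by (auto simp: dist_norm norm_mult subset_iff)
  qed
  then obtain J where J: "J holomorphic_on ball 0 (1/2)"
    "\<And>\<zeta>. \<zeta> \<in> ball 0 (1/2) \<Longrightarrow> Im \<zeta> \<noteq> 0 \<Longrightarrow>
      contour_integral (linepath (-1) 1) (\<lambda>u. fh u / (u - \<zeta>)) = 2 * pi * \<i> * (J \<zeta> + (if Im \<zeta> > 0 then fh \<zeta> else 0))"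
    using segment_jump_normalized by blast
  define I1 where "I1 = {0<..<t0 - \<eta>}"
  define I2 where "I2 = {t0 - \<eta>..t0 + \<eta>}"
  define I3 where "I3 = {t0 + \<eta><..l}"
  have Isub: "I1 \<union> I3 \<subseteq> {0<..l}" "I2 \<subseteq> {0<..l}" using \<eta> by (auto simp: I1_def I2_def I3_def)
  have Ieq: "{0<..l} = (I1 \<union> I3) \<union> I2" using \<eta> by (auto simp: I1_def I2_def I3_def)
  define V where "V = ball (w t0) (\<eta> / 2)"
  have VD: "V \<subseteq> D" using sub \<eta> by (auto simp: V_def)
  have far: "\<eta> / 2 \<le> norm (w t - z)" if "t \<in> I1 \<union> I3" "z \<in> V" for t z
  proof -
    have "w t - w t0 = of_real (t - t0) * e" by (simp add: w_def algebra_simps)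
    then have "norm (w t - w t0) = \<bar>t - t0\<bar>" using norm_e by (simp add: norm_mult del: of_real_diff)
    then have "norm (w t - w t0) \<ge> \<eta>" using that(1) by (auto simp: I1_def I3_def)
    then show ?thesis using that(2) norm_triangle_ineq[of "w t - z" "z - w t0"] by (simp add: V_def dist_norm norm_minus_commute)
  qed
  have refl: "\<exists>\<delta>>0. \<forall>t\<in>{0<..l}. \<delta> \<le> norm (b t - z)" if "z \<in> V" for z
    using reflected_separation[OF \<Omega>, of z] that VD \<Omega>(2) by blast
  define H where "H z = transform_on (I1 \<union> I3) z + (J ((z - w t0) / (of_real \<eta> * e))
     - (\<integral>t. indicator I2 t *\<^sub>R f (w t) / (b t - z) \<partial>lborel) * (e / (2 * pi * \<i>)))" for z
  show thesis
  proof (rule that[of "\<eta> / 2" H])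
    show "\<eta> / 2 > 0" using \<eta> by simp
    show "ball (w t0) (\<eta> / 2) \<subseteq> D" using VD by (simp add: V_def)
    have h1: "transform_on (I1 \<union> I3) holomorphic_on V"
    proof (rule holomorphic_transform_on[OF _ Isub(1)])
      fix z assume z: "z \<in> V"
      then obtain \<delta> where "\<delta> > 0" "\<forall>t\<in>{0<..l}. \<delta> \<le> norm (b t - z)" using refl by blast
      then show "\<exists>\<delta>>0. \<forall>t\<in>I1 \<union> I3. \<delta> \<le> norm (w t - z) \<and> \<delta> \<le> norm (b t - z)"
        using far[OF _ z] \<eta>(1) Isub(1)
        by (intro exI[of _ "min \<delta> (\<eta> / 2)"]) (auto simp: min_le_iff_disj subset_iff)
    qed (auto simp: I1_def I3_def)
    have h2: "(\<lambda>z. J ((z - w t0) / (of_real \<eta> * e))) holomorphic_on V"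
    proof (rule holomorphic_on_compose_gen[OF _ J(1), unfolded o_def])
      show "(\<lambda>z. (z - w t0) / (of_real \<eta> * e)) holomorphic_on V" using \<eta> e0 by (intro holomorphic_intros) auto
      show "(\<lambda>z. (z - w t0) / (of_real \<eta> * e)) ` V \<subseteq> ball 0 (1/2)"
        using \<eta> norm_e by (auto simp: V_def dist_norm norm_divide norm_mult norm_minus_commute divide_less_eq)
    qed
    have h3: "(\<lambda>z. \<integral>t. indicator I2 t *\<^sub>R f (w t) / (b t - z) \<partial>lborel) holomorphic_on V"
    proof (rule holomorphic_on_pole_integral)
      show "integrable lborel (\<lambda>t. indicator I2 t *\<^sub>R f (w t))"
        using borel_integrable_atLeastAtMost'[of "t0 - \<eta>" "t0 + \<eta>" "\<lambda>t. f (w t)"] continuous_on_subset[OF continuous_fw Isub(2)]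
        by (simp add: set_integrable_def I2_def)
      show "b \<in> borel_measurable lborel" unfolding b_def by measurable
      fix z assume z: "z \<in> V"
      then obtain \<delta> where "\<delta> > 0" "\<forall>t\<in>{0<..l}. \<delta> \<le> norm (b t - z)" using refl by blast
      then show "\<exists>\<delta>>0. \<forall>t. indicator I2 t *\<^sub>R f (w t) \<noteq> 0 \<longrightarrow> \<delta> \<le> norm (b t - z)"
        using Isub(2) by (intro exI[of _ \<delta>]) (auto simp: indicator_def)
    qed
    show "H holomorphic_on ball (w t0) (\<eta> / 2)"
      unfolding H_def V_def[symmetric] by (intro holomorphic_intros h1 h2 h3)
    fix z assume z: "z \<in> ball (w t0) (\<eta> / 2)" "Im ((z - a) / e) \<noteq> 0"
    then have zV: "z \<in> V" by (simp add: V_def)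
    obtain \<delta> where \<delta>: "\<delta> > 0" "\<forall>t\<in>{0<..l}. \<delta> \<le> norm (b t - z)" using refl[OF zV] by blast
    define \<delta>' where "\<delta>' = min \<delta> \<bar>Im ((z - a) / e)\<bar>"
    have \<delta>': "\<delta>' > 0" using \<delta> z by (simp add: \<delta>'_def)
    have sep: "\<delta>' \<le> norm (w t - z) \<and> \<delta>' \<le> norm (b t - z)" if "t \<in> {0<..l}" for t
    proof -
      have "(z - w t) / e = (z - a) / e - of_real t" using e0 by (simp add: w_def field_simps)
      then have "\<bar>Im ((z - a) / e)\<bar> = \<bar>Im ((z - w t) / e)\<bar>" by simp
      also have "\<dots> \<le> norm ((z - w t) / e)" by (rule abs_Im_le_cmod)
      also have "\<dots> = norm (w t - z)" using norm_e by (simp add: norm_divide norm_minus_commute)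
      finally show ?thesis using \<delta>(2) that by (auto simp: \<delta>'_def min_le_iff_disj)
    qed
    have "transform z = transform_on (I1 \<union> I3) z + transform_on I2 z"
      unfolding transform_def Ieq
    proof (rule transform_on_split[OF _ _ _ _ \<delta>'])
      show "(I1 \<union> I3) \<inter> I2 = {}" using \<eta> by (auto simp: I1_def I2_def I3_def)
    qed (use Isub sep in \<open>auto simp: I1_def I2_def I3_def\<close>)
    also have "transform_on I2 z = J ((z - w t0) / (of_real \<eta> * e))
     + (if Im ((z - a) / e) > 0 then f z else 0)
     - (\<integral>t. indicator I2 t *\<^sub>R f (w t) / (b t - z) \<partial>lborel) * (e / (2 * pi * \<i>))"
      unfolding I2_def
      by (rule transform_jump_middle[OF \<eta>(1-3) sub z _ \<delta>'])
         (use J(2) sep Isub(2) in \<open>auto simp: fh_def I2_def\<close>)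
    finally show "transform z = H z + (if Im ((z - a) / e) > 0 then f z else 0)" by (simp add: H_def)
  qed
qed

text \<open>Dominated convergence. All poles \<open>w t\<close> lie on one line, whose distance from
  \<open>zs n\<close> is \<open>\<bar>Im ((zs n - c) / e)\<bar>\<close>; the cone condition
  therefore bounds |zs n - c| / |w t - zs n| by 1/\<kappa>. The condition \<open>near\<close> keeps
  \<open>zs n\<close> away from \<open>a\<close>, hence from the reflected poles. The result
  excludes a residue at \<open>c\<close>.\<close>

lemma transform_nontangential:
  fixes zs :: "nat \<Rightarrow> complex"
  assumes \<Omega>: "convex \<Omega>" "D \<subseteq> \<Omega>" "a \<notin> \<Omega>" and zs: "zs \<longlonglongrightarrow> c" "\<And>n. zs n \<in> \<Omega>"
    and \<kappa>: "\<kappa> > 0" "\<And>n. \<kappa> * norm (zs n - c) \<le> \<bar>Im ((zs n - c) / e)\<bar>"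
    and near: "\<And>n. norm (zs n - c) \<le> l / 2"
  shows "(\<lambda>n. (zs n - c) * transform (zs n)) \<longlonglongrightarrow> 0"
proof -
  have e0: "e \<noteq> 0" using norm_e by auto
  define \<phi> where "\<phi> t = indicator {0<..l} t *\<^sub>R (of_real t * f (w t))" for t
  have \<phi>: "integrable lborel \<phi>" using integrable_ray by (simp add: \<phi>_def[abs_def] set_integrable_def)
  note [measurable] = borel_measurable_integrable[OF \<phi>]
  have bm[measurable]: "w \<in> borel_measurable borel" "b \<in> borel_measurable borel" unfolding w_def b_def by measurable
  define Q where "Q = 1 + 2 * l / r"
  have Q: "Q > 0" using l_pos r by (simp add: Q_def add_pos_pos)
  have b_ge: "l / 2 / Q \<le> norm (b t - zs n)" if "t \<in> {0<..l}" for t n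
  proof -
    have "l \<le> norm (zs n - a) + norm (zs n - c)"
      unfolding l_def using norm_triangle_ineq[of "c - zs n" "zs n - a"] by (simp add: norm_minus_commute)
    then have "l / 2 \<le> t + norm (zs n - a)" using near[of n] that by auto
    also have "\<dots> \<le> Q * norm (b t - zs n)"
      unfolding Q_def using reflected_dist2[OF \<Omega> zs(2), of t n] that by auto
    finally show ?thesis using Q by (simp add: divide_le_eq mult.commute)
  qed
  have w_ge: "norm (zs n - c) * \<kappa> \<le> norm (w t - zs n)" for t n
  proof -
    have "(w t - zs n) / e = of_real (t - l) - (zs n - c) / e"
    proof -
      have "c = a + of_real l * e" using w_l by (simp add: w_def)
      then have "c / e = a / e + of_real l" using e0 by (metis add_divide_distrib nonzero_mult_div_cancel_right)
      then show ?thesis using e0 by (simp add: w_def diff_divide_distrib add_divide_distrib)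
    qed
    then have "\<bar>Im ((zs n - c) / e)\<bar> = \<bar>Im ((w t - zs n) / e)\<bar>" by simp
    also have "\<dots> \<le> norm ((w t - zs n) / e)" by (rule abs_Im_le_cmod)
    finally show ?thesis using norm_e \<kappa>(2)[of n] by (simp add: norm_divide mult.commute)
  qed
  define s where "s n t = \<phi> t / ((w t - zs n) * (b t - zs n)) * (zs n - c)" for n t
  have "(\<lambda>n. \<integral>t. s n t \<partial>lborel) \<longlonglongrightarrow> (\<integral>t. 0 \<partial>(lborel :: real measure))"
  proof (rule integral_dominated_convergence[where w = "\<lambda>t. (2 * Q / (l * \<kappa>)) * norm (\<phi> t)"])
    show "(\<lambda>t. 0) \<in> borel_measurable lborel" by simp
    show "s n \<in> borel_measurable lborel" for n unfolding s_def by measurable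
    show "integrable lborel (\<lambda>t. (2 * Q / (l * \<kappa>)) * norm (\<phi> t))" using \<phi> by simp
    have "AE t in lborel. t \<noteq> l" by (rule AE_lborel_singleton)
    then show "AE t in lborel. (\<lambda>n. s n t) \<longlonglongrightarrow> 0"
    proof eventually_elim
      fix t assume t: "t \<noteq> l"
      show "(\<lambda>n. s n t) \<longlonglongrightarrow> 0"
      proof (cases "t \<in> {0<..l}")
        case True
        have "w t \<noteq> w l" using t e0 by (simp add: w_def)
        then have "w t \<noteq> c" by (simp add: w_l)
        moreover have "b t \<noteq> c"
        proof
          assume "b t = c"
          then have "b t = w l" by (simp add: w_l)
          then have "of_real (t + l) * e = 0" by (simp add: w_def b_def algebra_simps)
          then show False using e0 True l_pos by (simp del: of_real_add)
        qed
        ultimately have "(\<lambda>n. s n t) \<longlonglongrightarrow> \<phi> t / ((w t - c) * (b t - c)) * (c - c)"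
          unfolding s_def by (intro tendsto_intros zs) auto
        then show ?thesis by simp
      qed (simp add: s_def \<phi>_def)
    qed
    show "AE t in lborel. norm (s n t) \<le> (2 * Q / (l * \<kappa>)) * norm (\<phi> t)" for n
    proof (intro AE_I2)
      fix t
      show "norm (s n t) \<le> (2 * Q / (l * \<kappa>)) * norm (\<phi> t)"
      proof (cases "t \<in> {0<..l} \<and> zs n \<noteq> c")
        case True
        define d where "d = norm (zs n - c)"
        have d: "d > 0" using True by (simp add: d_def)
        have B: "l / 2 / Q > 0" using l_pos Q by simp
        have "(d * \<kappa>) * (l / 2 / Q) \<le> norm (w t - zs n) * norm (b t - zs n)"
          using w_ge[of n t] b_ge[of t n] True d \<kappa>(1) B by (intro mult_mono) (auto simp: d_def)
        then have "d / (norm (w t - zs n) * norm (b t - zs n)) \<le> d / ((d * \<kappa>) * (l / 2 / Q))"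
          using mult_pos_pos[OF mult_pos_pos[OF d \<kappa>(1)] B] d by (intro frac_le) auto
        also have "\<dots> = 2 * Q / (l * \<kappa>)" using d by simp
        finally have "norm (\<phi> t) * (d / (norm (w t - zs n) * norm (b t - zs n))) \<le> norm (\<phi> t) * (2 * Q / (l * \<kappa>))"
          by (intro mult_left_mono) auto
        then show ?thesis by (simp add: s_def norm_mult norm_divide d_def mult_ac)
      qed (use Q l_pos \<kappa>(1) in \<open>auto simp: s_def \<phi>_def\<close>)
    qed
  qed
  then have "(\<lambda>n. (\<integral>t. s n t \<partial>lborel) * (\<i> * e\<^sup>2 / of_real pi)) \<longlonglongrightarrow> 0 * (\<i> * e\<^sup>2 / of_real pi)"
    by (intro tendsto_intros) simp
  moreover have "(zs n - c) * transform (zs n) = (\<integral>t. s n t \<partial>lborel) * (\<i> * e\<^sup>2 / of_real pi)" for n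
    unfolding transform_def transform_on_def s_def \<phi>_def by (subst integral_mult_left_zero) simp
  ultimately show ?thesis by simp
qed

end

section \<open>Gluing and removable singularities\<close>

lemma null_setsI_negligible:
  assumes "negligible S" "closed S"
  shows "S \<in> null_sets lborel"
proof -
  have "S \<in> null_sets (completion lborel)" using assms(1) by (simp only: negligible_iff_null_sets)
  then show ?thesis using assms(2) by (subst (asm) null_sets_completion_iff) auto
qed

lemma null_set_imp_islimpt_Compl:
  fixes R :: "complex set"
  assumes "R \<in> null_sets lborel"
  shows "x islimpt (- R)"
  unfolding islimpt_def
proof (intro allI impI)
  fix U :: "complex set" assume U: "x \<in> U" "open U"
  have "open (U - {x})" using U by (simp add: open_Diff)
  moreover have "U - {x} \<noteq> {}"
  proof
    assume "U - {x} = {}"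
    then have "U = {x}" using U by auto
    then show False using U not_open_singleton[of x] by simp
  qed
  ultimately have "\<not> negligible (U - {x})" by (simp add: open_not_negligible)
  moreover have "negligible R" using assms negligible_iff_null_sets null_sets_completionI by blast
  ultimately have "\<not> U - {x} \<subseteq> R" using negligible_subset by blast
  then show "\<exists>y\<in>- R. y \<in> U \<and> y \<noteq> x" by blast
qed

text \<open>The value of \<open>G\<close> is the limit of \<open>g\<close> through the complement of
  \<open>R\<close>, which accumulates at every point because \<open>R\<close> is null. Every local
  extension has this limit, so different extensions need not be compared on overlaps.\<close>

lemma holomorphic_glue:
  fixes g :: "complex \<Rightarrow> complex"
  assumes R: "R \<in> null_sets lborel" and S: "open S"
    and loc: "\<And>x. x \<in> S \<Longrightarrow> \<exists>d>0. \<exists>h. h holomorphic_on ball x d \<and> (\<forall>y\<in>ball x d - R. g y = h y)"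
  obtains G where "G holomorphic_on S" "\<And>y. y \<in> S - R \<Longrightarrow> G y = g y"
proof -
  define G where "G x = Lim (at x within - R) g" for x
  have G: "G y = h y" if h: "h holomorphic_on ball x d" "\<forall>y\<in>ball x d - R. g y = h y" and y: "y \<in> ball x d" for x d h y
  proof -
    have "(h \<longlongrightarrow> h y) (at y within - R)"
    proof (rule tendsto_within_subset[OF _ subset_UNIV])
      have "isCont h y"
        using holomorphic_on_imp_continuous_on[OF h(1)] y by (simp add: continuous_on_eq_continuous_at)
      then show "(h \<longlongrightarrow> h y) (at y)" by (simp add: isCont_def)
    qed
    moreover have "eventually (\<lambda>z. g z = h z) (at y within - R)"
      unfolding eventually_at_topological using y h(2) by (intro exI[of _ "ball x d"]) auto
    ultimately have "(g \<longlongrightarrow> h y) (at y within - R)" by (simp add: tendsto_cong)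
    then show ?thesis unfolding G_def
      using null_set_imp_islimpt_Compl[OF R, of y] by (intro tendsto_Lim) (auto simp: trivial_limit_within)
  qed
  show thesis
  proof (rule that[of G])
    show "G holomorphic_on S"
    proof (rule holomorphic_onI)
      fix x assume "x \<in> S"
      then obtain d h where d: "d > 0" "h holomorphic_on ball x d" "\<forall>y\<in>ball x d - R. g y = h y" using loc by blast
      have "G holomorphic_on ball x d"
        by (rule holomorphic_transform[OF d(2)]) (use G[OF d(2,3)] in simp)
      then show "G field_differentiable at x within S"
        using d(1) by (meson centre_in_ball field_differentiable_at_within holomorphic_on_imp_differentiable_at open_ball)
    qed
    fix y assume y: "y \<in> S - R"
    then obtain d h where "d > 0" "h holomorphic_on ball y d" "\<forall>z\<in>ball y d - R. g z = h z" using loc by blast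
    then show "G y = g y" using G[of h y d y] y by simp
  qed
qed

text \<open>The open disc around z of radius |z - c| avoids \<open>c\<close>, so the mean value
  bound gives growth at most |z - c|^(-2/p). As 2/p < 2, multiplying by (z - c)^2 gives limit 0,
  hence (z - c) G extends holomorphically. Its value at \<open>c\<close> is the residue, which is
  read off along the sequence.\<close>

lemma removable_singularity_Lp:
  assumes p: "1 < p" and S: "open S" "c \<in> S" and hol: "G holomorphic_on (S - {c})"
    and Lp: "(\<integral>\<^sup>+z\<in>S - {c}. ennreal (norm (G z) powr p) \<partial>lborel) < \<infinity>"
    and zs: "zs \<longlonglongrightarrow> c" "\<And>n. zs n \<in> S - {c}" "(\<lambda>n. (zs n - c) * G (zs n)) \<longlonglongrightarrow> 0"
  obtains G' where "G' holomorphic_on S" "\<And>z. z \<in> S - {c} \<Longrightarrow> G' z = G z"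
proof -
  obtain R0 where R0: "R0 > 0" "ball c R0 \<subseteq> S" using S open_contains_ball_eq[OF S(1)] by blast
  define m where "m = enn2real (\<integral>\<^sup>+z\<in>S - {c}. ennreal (norm (G z) powr p) \<partial>lborel)"
  have m: "m \<ge> 0" "(\<integral>\<^sup>+z\<in>S - {c}. ennreal (norm (G z) powr p) \<partial>lborel) = ennreal m"
    using Lp by (simp_all add: m_def)
  define K where "K = 16 powr p * pi powr (p - 1)"
  have K: "K \<ge> 0" by (simp add: K_def)
  define C where "C = (K * m) powr (1 / p)"
  have bound: "norm ((z - c) * ((z - c) * G z)) \<le> C * norm (z - c) powr (2 - 2 / p)"
    if z: "z \<noteq> c" "norm (z - c) < R0 / 2" for z
  proof -
    define \<rho> where "\<rho> = norm (z - c)"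
    have \<rho>: "\<rho> > 0" using z by (simp add: \<rho>_def)
    have sub: "ball z \<rho> \<subseteq> S - {c}"
    proof
      fix y assume y: "y \<in> ball z \<rho>"
      have "norm (y - c) \<le> norm (y - z) + norm (z - c)" using norm_triangle_ineq[of "y - z" "z - c"] by simp
      then have "y \<in> ball c R0" using y z by (simp add: \<rho>_def dist_norm norm_minus_commute)
      moreover have "y \<noteq> c" using y by (auto simp: \<rho>_def dist_norm)
      ultimately show "y \<in> S - {c}" using R0 by auto
    qed
    have "ennreal (\<rho>\<^sup>2 * norm (G z) powr p) \<le> ennreal K * (\<integral>\<^sup>+w\<in>ball z \<rho>. ennreal (norm (G w) powr p) \<partial>lborel)"
      unfolding K_def by (rule holomorphic_Lp_bound[OF holomorphic_on_subset[OF hol sub] \<rho> p])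
    also have "\<dots> \<le> ennreal K * ennreal m"
      unfolding m(2)[symmetric] using sub by (intro mult_left_mono nn_integral_mono) (auto simp: indicator_def)
    finally have "\<rho>\<^sup>2 * norm (G z) powr p \<le> K * m" using K m by (simp add: ennreal_mult[symmetric])
    then have "norm (G z) powr p \<le> K * m / \<rho>\<^sup>2" using \<rho> by (simp add: field_simps)
    then have "(norm (G z) powr p) powr (1 / p) \<le> (K * m / \<rho>\<^sup>2) powr (1 / p)"
      using p by (intro powr_mono2) auto
    also have "(norm (G z) powr p) powr (1 / p) = norm (G z)" using p by (simp add: powr_powr)
    also have "(K * m / \<rho>\<^sup>2) powr (1 / p) = C * \<rho> powr - (2 / p)"
    proof -
      have "(\<rho>\<^sup>2) powr (1 / p) = \<rho> powr (2 / p)"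
        using \<rho> by (simp add: powr_powr flip: powr_numeral)
      then show ?thesis using K m \<rho> by (simp add: C_def powr_divide powr_minus_divide)
    qed
    finally have "\<rho>\<^sup>2 * norm (G z) \<le> \<rho>\<^sup>2 * (C * \<rho> powr - (2 / p))" by (rule mult_left_mono) simp
    also have "\<dots> = C * \<rho> powr (2 - 2 / p)"
      using \<rho> by (simp add: powr_diff powr_minus divide_inverse)
    finally show ?thesis by (simp add: \<rho>_def norm_mult power2_eq_square mult.assoc)
  qed
  define F where "F z = (z - c) * G z" for z
  have holF: "F holomorphic_on (S - {c})" unfolding F_def by (intro holomorphic_intros hol)
  have cint: "c \<in> interior S" using S by (simp add: interior_open)
  have "((\<lambda>z. (z - c) * F z) \<longlongrightarrow> 0) (at c)"
  proof (rule Lim_null_comparison)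
    show "\<forall>\<^sub>F z in at c. norm ((z - c) * F z) \<le> C * norm (z - c) powr (2 - 2 / p)"
      unfolding eventually_at using bound R0(1) by (intro exI[of _ "R0 / 2"]) (auto simp: F_def dist_norm)
    have "((\<lambda>z. norm (z - c) powr (2 - 2 / p)) \<longlongrightarrow> 0) (at c)"
      using p by (intro tendsto_zero_powrI[of _ _ _ "2 - 2 / p"]) (auto intro!: tendsto_eq_intros simp: field_simps)
    then show "((\<lambda>z. C * norm (z - c) powr (2 - 2 / p)) \<longlongrightarrow> 0) (at c)" by (rule tendsto_mult_right_zero)
  qed
  then obtain h where h: "h holomorphic_on S" "\<forall>z\<in>S - {c}. h z = F z"
    using holomorphic_on_extend_lim[OF holF cint] by blast
  have hc: "isCont h c" using h(1) S by (meson continuous_on_eq_continuous_at holomorphic_on_imp_continuous_on)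
  have "(\<lambda>n. h (zs n)) \<longlonglongrightarrow> h c" by (rule isCont_tendsto_compose[OF hc zs(1)])
  moreover have "(\<lambda>n. h (zs n)) \<longlonglongrightarrow> 0" using zs(3) h(2) zs(2) by (simp add: F_def)
  ultimately have "h c = 0" by (rule LIMSEQ_unique)
  have "(F \<longlongrightarrow> 0) (at c)"
  proof (rule Lim_transform_eventually)
    show "(h \<longlongrightarrow> 0) (at c)" using hc \<open>h c = 0\<close> by (simp add: isCont_def)
    show "\<forall>\<^sub>F x in at c. h x = F x"
      using h(2) S unfolding eventually_at_topological by blast
  qed
  then show thesis
    using holomorphic_on_extend_lim[OF hol cint] that unfolding F_def by blast
qed

text \<open>Membership in the Bergman space without the normalisation off the set, so that sums,
  restrictions and functions known only on a smaller set need no adjustment.\<close>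

definition Lp_holomorphic :: "real \<Rightarrow> complex set \<Rightarrow> (complex \<Rightarrow> complex) \<Rightarrow> bool" where
  "Lp_holomorphic p S f \<longleftrightarrow> f holomorphic_on S \<and> (\<integral>\<^sup>+z\<in>S. ennreal (norm (f z) powr p) \<partial>lborel) < \<infinity>"

section \<open>Closure properties of p-integrable holomorphic functions\<close>

lemma Lp_holomorphic_cong:
  assumes "\<And>z. z \<in> S \<Longrightarrow> f z = g z"
  shows "Lp_holomorphic p S f \<longleftrightarrow> Lp_holomorphic p S g"
proof -
  have "(\<integral>\<^sup>+z\<in>S. ennreal (norm (f z) powr p) \<partial>lborel) = (\<integral>\<^sup>+z\<in>S. ennreal (norm (g z) powr p) \<partial>lborel)"
    using assms by (intro nn_integral_cong) (auto simp: indicator_def)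
  then show ?thesis using assms by (simp add: Lp_holomorphic_def cong: holomorphic_cong)
qed

lemma Lp_holomorphic_subset:
  assumes "Lp_holomorphic p S f" "T \<subseteq> S"
  shows "Lp_holomorphic p T f"
proof -
  have "(\<integral>\<^sup>+z\<in>T. ennreal (norm (f z) powr p) \<partial>lborel) \<le> (\<integral>\<^sup>+z\<in>S. ennreal (norm (f z) powr p) \<partial>lborel)"
    using assms(2) by (intro nn_integral_mono) (auto simp: indicator_def)
  then show ?thesis using assms holomorphic_on_subset unfolding Lp_holomorphic_def by (auto intro: le_less_trans)
qed

lemma Lp_holomorphic_add:
  assumes f: "Lp_holomorphic p S f" and g: "Lp_holomorphic p S g" and S: "open S" and p: "0 \<le> p"
  shows "Lp_holomorphic p S (\<lambda>z. f z + g z)"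
proof -
  have hol: "f holomorphic_on S" "g holomorphic_on S" using f g by (auto simp: Lp_holomorphic_def)
  have [measurable]: "(\<lambda>z. ennreal (norm (f z) powr p) * indicator S z) \<in> borel_measurable borel"
    "(\<lambda>z. ennreal (norm (g z) powr p) * indicator S z) \<in> borel_measurable borel"
    using hol S by (auto intro: borel_measurable_norm_powr_indicator)
  have "(\<integral>\<^sup>+z\<in>S. ennreal (norm (f z + g z) powr p) \<partial>lborel)
    \<le> (\<integral>\<^sup>+z. ennreal (2 powr p) * (ennreal (norm (f z) powr p) * indicator S z + ennreal (norm (g z) powr p) * indicator S z) \<partial>lborel)"
  proof (intro nn_integral_mono)
    fix z
    have "norm (f z + g z) powr p \<le> 2 powr p * (norm (f z) powr p + norm (g z) powr p)"
    proof -
      define x where "x = max (norm (f z)) (norm (g z))"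
      have "norm (f z + g z) \<le> 2 * x" using norm_triangle_ineq[of "f z" "g z"] by (auto simp: x_def)
      then have "norm (f z + g z) powr p \<le> (2 * x) powr p" using p by (intro powr_mono2) auto
      also have "\<dots> = 2 powr p * x powr p" by (simp add: powr_mult x_def)
      also have "x powr p \<le> norm (f z) powr p + norm (g z) powr p" by (auto simp: x_def max_def)
      finally show ?thesis by simp
    qed
    then show "ennreal (norm (f z + g z) powr p) * indicator S z
      \<le> ennreal (2 powr p) * (ennreal (norm (f z) powr p) * indicator S z + ennreal (norm (g z) powr p) * indicator S z)"
      by (auto simp: indicator_def ennreal_mult'[symmetric] ennreal_plus[symmetric] ennreal_leI simp del: ennreal_plus)
  qed
  also have "\<dots> = ennreal (2 powr p) * ((\<integral>\<^sup>+z\<in>S. ennreal (norm (f z) powr p) \<partial>lborel) + (\<integral>\<^sup>+z\<in>S. ennreal (norm (g z) powr p) \<partial>lborel))"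
    by (simp add: nn_integral_cmult nn_integral_add)
  also have "\<dots> < \<infinity>" using f g by (simp add: Lp_holomorphic_def ennreal_mult_less_top)
  finally show ?thesis using hol by (simp add: Lp_holomorphic_def holomorphic_on_add)
qed

lemma Lp_holomorphic_cmult:
  assumes f: "Lp_holomorphic p S f" and S: "open S"
  shows "Lp_holomorphic p S (\<lambda>z. k * f z)"
proof -
  have hol: "f holomorphic_on S" using f by (auto simp: Lp_holomorphic_def)
  have [measurable]: "(\<lambda>z. ennreal (norm (f z) powr p) * indicator S z) \<in> borel_measurable borel"
    using hol S by (auto intro: borel_measurable_norm_powr_indicator)
  have "(\<integral>\<^sup>+z\<in>S. ennreal (norm (k * f z) powr p) \<partial>lborel)
     = (\<integral>\<^sup>+z. ennreal (norm k powr p) * (ennreal (norm (f z) powr p) * indicator S z) \<partial>lborel)"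
    by (intro nn_integral_cong) (simp add: norm_mult powr_mult ennreal_mult' mult.assoc)
  also have "\<dots> = ennreal (norm k powr p) * (\<integral>\<^sup>+z\<in>S. ennreal (norm (f z) powr p) \<partial>lborel)"
    by (rule nn_integral_cmult) measurable
  also have "\<dots> < \<infinity>" using f by (simp add: Lp_holomorphic_def ennreal_mult_less_top)
  finally show ?thesis using hol by (simp add: Lp_holomorphic_def holomorphic_on_mult)
qed

lemma Lp_holomorphic_sum:
  assumes "finite A" "\<And>a. a \<in> A \<Longrightarrow> Lp_holomorphic p S (f a)" and S: "open S" and p: "0 < p"
  shows "Lp_holomorphic p S (\<lambda>z. \<Sum>a\<in>A. f a z)"
  using assms(1,2)
proof (induction rule: finite_induct)
  case empty then show ?case using p by (simp add: Lp_holomorphic_def)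
next
  case (insert a A)
  then show ?case using S p by (simp add: Lp_holomorphic_add)
qed

lemma set_nn_integral_null_diff:
  assumes "R \<in> null_sets lborel" "\<And>z. z \<in> S - R \<Longrightarrow> f z = g z"
  shows "(\<integral>\<^sup>+z\<in>S. f z \<partial>lborel) = (\<integral>\<^sup>+z\<in>S - R. g z \<partial>lborel)"
proof (rule nn_integral_cong_AE)
  show "AE z in lborel. f z * indicator S z = g z * indicator (S - R) z"
    using AE_not_in[OF assms(1)] by eventually_elim (use assms(2) in \<open>auto simp: indicator_def\<close>)
qed

section \<open>Splitting along finitely many rays\<close>

context boundary_ray
begin

lemma cnj_e: "cnj e = 1 / e"
proof -
  have "e * cnj e = 1" using complex_norm_square[of e] norm_e by simp
  moreover from this have "e \<noteq> 0" by auto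
  ultimately show ?thesis by (metis nonzero_eq_divide_eq mult.commute)
qed

lemma line_null: "{z. Im ((z - a) / e) = 0} \<in> null_sets lborel"
proof (rule null_setsI_negligible)
  have "Im ((z - a) / e) = (\<i> * e) \<bullet> z - (\<i> * e) \<bullet> a" for z
  proof -
    have "(z - a) / e = (z - a) * cnj e" unfolding cnj_e by simp
    then have "Im ((z - a) / e) = Im ((z - a) * cnj e)" by (simp only:)
    then show ?thesis by (simp add: inner_complex_def algebra_simps)
  qed
  then have eq: "{z. Im ((z - a) / e) = 0} = {z. (\<i> * e) \<bullet> z = (\<i> * e) \<bullet> a}" by auto
  have "e \<noteq> 0" using norm_e by auto
  then show "negligible {z. Im ((z - a) / e) = 0}" unfolding eq by (intro negligible_hyperplane) auto
  show "closed {z. Im ((z - a) / e) = 0}" unfolding eq by (rule closed_hyperplane)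
qed

lemma on_line_iff: "Im ((z - a) / e) = 0 \<longleftrightarrow> (\<exists>t. z = w t)"
proof
  have e0: "e \<noteq> 0" using norm_e by auto
  show "\<exists>t. z = w t" if "Im ((z - a) / e) = 0"
  proof
    have "(z - a) / e = of_real (Re ((z - a) / e))" using that by (simp add: complex_eq_iff)
    then have "z - a = of_real (Re ((z - a) / e)) * e" using e0 by (metis nonzero_divide_eq_eq)
    then show "z = w (Re ((z - a) / e))" unfolding w_def by (metis add.commute diff_add_cancel)
  qed
  show "Im ((z - a) / e) = 0" if "\<exists>t. z = w t"
    using that e0 by (auto simp: w_def)
qed

lemma segment_null: "closed_segment a c \<in> null_sets lborel"
proof (rule null_sets_subset[OF line_null])
  show "closed_segment a c \<subseteq> {z. Im ((z - a) / e) = 0}" unfolding segment_eq using on_line_iff by blast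
qed auto

lemma transform_Lp_holomorphic:
  assumes \<Omega>: "convex \<Omega>" "D \<subseteq> \<Omega>" "a \<notin> \<Omega>" and S: "S \<subseteq> \<Omega> - closed_segment a c"
  shows "Lp_holomorphic p S transform"
  unfolding Lp_holomorphic_def
proof
  show "transform holomorphic_on S" by (rule holomorphic_on_subset[OF holomorphic_transform[OF \<Omega>] S])
  have "(\<integral>\<^sup>+z\<in>S. ennreal (norm (transform z) powr p) \<partial>lborel)
      = (\<integral>\<^sup>+z\<in>S - {z. Im ((z - a) / e) = 0}. ennreal (norm (transform z) powr p) \<partial>lborel)"
    by (rule set_nn_integral_null_diff[OF line_null]) simp
  also have "\<dots> < \<infinity>"
    by (rule transform_Lp[OF \<Omega>]) (use S on_line_iff in auto)
  finally show "(\<integral>\<^sup>+z\<in>S. ennreal (norm (transform z) powr p) \<partial>lborel) < \<infinity>" .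
qed

text \<open>The coordinate seen from \<open>c\<close> towards \<open>a\<close> reverses the one seen
  from \<open>a\<close> towards \<open>c\<close>. Hence the left side of the ray appears with
  negative imaginary part in \<open>sector_jump\<close>.\<close>

lemma sector_coordinate: "(z - c) / (a - c) = 1 - (z - a) / e / of_real l"
proof -
  have "a - c \<noteq> 0" using l_pos by (auto simp: l_def)
  then have "(z - c) / (a - c) = 1 + (z - a) / (a - c)"
    by (simp add: add_divide_distrib[symmetric] divide_eq_eq) (simp add: field_simps)
  also have "(z - a) / (a - c) = - ((z - a) / (c - a))" by (metis minus_diff_eq minus_divide_right)
  also have "(z - a) / (c - a) = (z - a) / e / of_real l" using l_pos by (simp add: e_def)
  finally show ?thesis by simp
qed

end

text \<open>The point \<open>c\<close> is inserted separately because the union is empty when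
  \<open>T\<close> is empty, and the indicator may fail to be locally constant at \<open>c\<close>
  even then.\<close>

definition rays :: "complex \<Rightarrow> complex set \<Rightarrow> complex set" where
  "rays c T = insert c (\<Union>a\<in>T. closed_segment a c)"

text \<open>\<open>s\<close> is the value of \<open>\<psi>\<close> on the left of the ray minus the value on its right, looking from \<open>a\<close> towards \<open>c\<close>.\<close>

definition sector_jump :: "complex set \<Rightarrow> complex \<Rightarrow> (complex \<Rightarrow> complex) \<Rightarrow> complex \<Rightarrow> complex \<Rightarrow> bool" where
  "sector_jump D c \<psi> a s \<longleftrightarrow> (\<exists>\<epsilon>>0. \<exists>k. \<forall>z\<in>D.
       (0 < - Im ((z - c) / (a - c)) \<and> - Im ((z - c) / (a - c)) < \<epsilon> * Re ((z - c) / (a - c)) \<longrightarrow> \<psi> z = k + s) \<and>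
       (0 < Im ((z - c) / (a - c)) \<and> Im ((z - c) / (a - c)) < \<epsilon> * Re ((z - c) / (a - c)) \<longrightarrow> \<psi> z = k))"

text \<open>The set \<Omega> stands for either of the two domains: the locale serves once with an
  indicator of sectors and once with its complement in \<open>D\<close> and the negated jumps. The
  condition \<open>\<psi>_out\<close> lets \<open>\<psi> * f\<close> continue by 0 across the part
  of the frontier of \<open>D\<close> inside \<Omega>.\<close>

locale cut_domain =
  fixes D :: "complex set" and f :: "complex \<Rightarrow> complex" and p :: real and c :: complex and r :: real
    and T :: "complex set" and \<psi> :: "complex \<Rightarrow> complex" and \<sigma> :: "complex \<Rightarrow> complex" and \<Omega> :: "complex set"
  assumes open_D: "open D" and convex_D: "convex D" and r: "0 < r" and ball_D: "ball c r \<subseteq> D"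
    and p: "1 < p" and f: "Lp_holomorphic p D f"
    and T: "finite T" "T \<subseteq> closure D" "T \<inter> \<Omega> = {}"
    and \<Omega>: "open \<Omega>" "convex \<Omega>" "D \<subseteq> \<Omega>"
    and \<psi>_le: "\<And>z. norm (\<psi> z) \<le> 1"
    and \<psi>_loc: "\<And>x. x \<in> D - rays c T \<Longrightarrow> \<exists>d>0. \<forall>y\<in>ball x d. \<psi> y = \<psi> x"
    and \<psi>_out: "\<And>x. x \<in> \<Omega> - D \<Longrightarrow> \<exists>d>0. \<forall>y\<in>ball x d. \<psi> y = 0"
    and jump: "\<And>a. a \<in> T \<Longrightarrow> sector_jump D c \<psi> a (\<sigma> a)"
begin

abbreviation "tr \<equiv> boundary_ray.transform f"
abbreviation "R \<equiv> rays c T"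

lemma ray:
  assumes "a \<in> T"
  shows "boundary_ray D f p a c r"
proof -
  have "a \<in> closure D" "a \<notin> D" using assms T \<Omega> by auto
  then show ?thesis using open_D convex_D r ball_D p f by (simp add: boundary_ray_def Lp_holomorphic_def)
qed

definition g :: "complex \<Rightarrow> complex" where
  "g z = \<psi> z * f z - (\<Sum>a\<in>T. \<sigma> a * tr a c z)"

lemma c_in: "c \<in> D" using ball_D r by auto

lemma closed_R: "closed R" unfolding rays_def using T by (intro closed_insert closed_UN) auto

lemma R_null: "R \<in> null_sets lborel"
proof -
  have "(\<Union>a\<in>T. closed_segment a c) \<in> null_sets lborel"
    using T(1) boundary_ray.segment_null[OF ray] by (intro null_sets_UN' countable_finite) auto
  moreover have "{c} \<in> null_sets lborel" by (simp add: null_setsI)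
  ultimately have "{c} \<union> (\<Union>a\<in>T. closed_segment a c) \<in> null_sets lborel" by (rule null_sets.Un[rotated])
  then show ?thesis by (simp add: rays_def)
qed

text \<open>If two points of \<open>T\<close> lay on one ray from \<open>c\<close>, the nearer one
  would be on the open segment from \<open>c\<close> to a point of the closure, hence in
  \<open>D\<close>, which \<open>T\<close> avoids.\<close>

lemma segments_disjoint:
  assumes "a \<in> T" "a' \<in> T" "a \<noteq> a'" "x \<in> closed_segment a c" "x \<in> closed_segment a' c"
  shows "x = c"
proof (rule ccontr)
  assume "x \<noteq> c"
  have *: False if a: "a \<in> T" "a' \<in> T" "a \<noteq> a'" "norm (a - c) \<le> norm (a' - c)"
    and u: "0 < u" "0 < u'" "of_real u * (a - c) = of_real u' * (a' - c)" for a a' :: complex and u u' :: real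
  proof -
    interpret boundary_ray D f p a c r by (rule ray[OF a(1)])
    have ac: "norm (a - c) > 0" using l_pos by (simp add: l_def norm_minus_commute)
    define s where "s = u' / u"
    have s: "s > 0" "a - c = of_real s * (a' - c)" using u by (auto simp: s_def field_simps)
    then have ns: "norm (a - c) = s * norm (a' - c)" by (simp add: norm_mult)
    have "s \<noteq> 1" using s a(3) by auto
    moreover have "s \<le> 1"
    proof (rule ccontr)
      assume "\<not> s \<le> 1"
      moreover have "norm (a' - c) > 0" using ac ns s(1) by (simp add: zero_less_mult_iff)
      ultimately have "1 * norm (a' - c) < s * norm (a' - c)" by (intro mult_strict_right_mono) auto
      then show False using ns a(4) by simp
    qed
    ultimately have s1: "s < 1" by simp
    have "open_segment c a' \<subseteq> interior D"
      by (rule in_interior_closure_convex_segment[OF convex_D]) (use c_in open_D a T in \<open>auto simp: interior_open\<close>)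
    moreover have "a \<in> open_segment c a'" unfolding in_segment
    proof (intro conjI exI[of _ s])
      show "c \<noteq> a'" using s ac by auto
      show "a = (1 - s) *\<^sub>R c + s *\<^sub>R a'" using s(2) by (simp add: scaleR_conv_of_real algebra_simps)
    qed (use s s1 in auto)
    ultimately show False using a(1) T \<Omega>(3) interior_subset by blast
  qed
  obtain u where u: "0 \<le> u" "u \<le> 1" "x = (1 - u) *\<^sub>R a + u *\<^sub>R c" using assms(4) by (auto simp: in_segment)
  obtain u' where u': "0 \<le> u'" "u' \<le> 1" "x = (1 - u') *\<^sub>R a' + u' *\<^sub>R c" using assms(5) by (auto simp: in_segment)
  have x1: "x - c = of_real (1 - u) * (a - c)" using u(3) by (simp add: scaleR_conv_of_real algebra_simps)
  have x2: "x - c = of_real (1 - u') * (a' - c)" using u'(3) by (simp add: scaleR_conv_of_real algebra_simps)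
  have "1 - u > 0" using u \<open>x \<noteq> c\<close> x1 by (cases "u = 1") auto
  moreover have "1 - u' > 0" using u' \<open>x \<noteq> c\<close> x2 by (cases "u' = 1") auto
  ultimately show False
    using *[of a a' "1 - u" "1 - u'"] *[of a' a "1 - u'" "1 - u"] assms(1-3) x1 x2 by (metis linear)
qed

text \<open>The values of \<open>f\<close> outside \<open>D\<close> are arbitrary; they do not
  matter because \<psi> vanishes on a neighbourhood of each point of
  \<open>\<Omega> - D\<close>.\<close>

lemma \<psi>f_Lp: "Lp_holomorphic p (\<Omega> - R) (\<lambda>z. \<psi> z * f z)"
  unfolding Lp_holomorphic_def
proof
  show "(\<lambda>z. \<psi> z * f z) holomorphic_on \<Omega> - R"
  proof (rule holomorphic_onI)
    fix x assume x: "x \<in> \<Omega> - R"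
    have "\<exists>d>0. (\<lambda>z. \<psi> z * f z) holomorphic_on ball x d"
    proof (cases "x \<in> D")
      case True
      then obtain d1 where d1: "d1 > 0" "\<forall>y\<in>ball x d1. \<psi> y = \<psi> x" using \<psi>_loc x by blast
      obtain d2 where d2: "d2 > 0" "ball x d2 \<subseteq> D" using open_contains_ball_eq[OF open_D] True by blast
      have "f holomorphic_on ball x (min d1 d2)"
      proof (rule holomorphic_on_subset)
        show "f holomorphic_on D" using f by (simp add: Lp_holomorphic_def)
        show "ball x (min d1 d2) \<subseteq> D" using d2(2) by auto
      qed
      then have "(\<lambda>z. \<psi> x * f z) holomorphic_on ball x (min d1 d2)" by (intro holomorphic_intros)
      then have "(\<lambda>z. \<psi> z * f z) holomorphic_on ball x (min d1 d2)"
      proof (rule holomorphic_transform)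
        fix y assume "y \<in> ball x (min d1 d2)"
        then have "\<psi> y = \<psi> x" using bspec[OF d1(2), of y] by simp
        then show "\<psi> x * f y = \<psi> y * f y" by simp
      qed
      moreover have "min d1 d2 > 0" using d1 d2 by simp
      ultimately show ?thesis by blast
    next
      case False
      then obtain d where d: "d > 0" "\<forall>y\<in>ball x d. \<psi> y = 0" using \<psi>_out x by blast
      have "(\<lambda>z. \<psi> z * f z) holomorphic_on ball x d"
        by (rule holomorphic_transform[of "\<lambda>z. 0"]) (use d in auto)
      then show ?thesis using d by blast
    qed
    then show "(\<lambda>z. \<psi> z * f z) field_differentiable at x within \<Omega> - R"
      by (meson centre_in_ball field_differentiable_at_within holomorphic_on_imp_differentiable_at open_ball)
  qed
  have "(\<integral>\<^sup>+z\<in>\<Omega> - R. ennreal (norm (\<psi> z * f z) powr p) \<partial>lborel)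
    \<le> (\<integral>\<^sup>+z\<in>D. ennreal (norm (f z) powr p) \<partial>lborel)"
  proof (intro nn_integral_mono)
    fix z
    have 1: "\<psi> z = 0" if "z \<in> \<Omega> - D" using \<psi>_out[OF that] by auto
    have "norm (\<psi> z) * norm (f z) \<le> 1 * norm (f z)" by (intro mult_right_mono \<psi>_le) auto
    then have "norm (\<psi> z * f z) powr p \<le> norm (f z) powr p" using p by (intro powr_mono2) (auto simp: norm_mult)
    then show "ennreal (norm (\<psi> z * f z) powr p) * indicator (\<Omega> - R) z \<le> ennreal (norm (f z) powr p) * indicator D z"
      using 1 p by (auto simp: indicator_def ennreal_leI)
  qed
  also have "\<dots> < \<infinity>" using f by (simp add: Lp_holomorphic_def)
  finally show "(\<integral>\<^sup>+z\<in>\<Omega> - R. ennreal (norm (\<psi> z * f z) powr p) \<partial>lborel) < \<infinity>" .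
qed

lemma tr_Lp:
  assumes "a \<in> T" "S \<subseteq> \<Omega> - closed_segment a c"
  shows "Lp_holomorphic p S (tr a c)"
proof -
  have "a \<notin> \<Omega>" using assms T by auto
  then show ?thesis by (rule boundary_ray.transform_Lp_holomorphic[OF ray[OF assms(1)] \<Omega>(2,3) _ assms(2)])
qed

lemma g_Lp: "Lp_holomorphic p (\<Omega> - R) g"
proof -
  have o: "open (\<Omega> - R)" using \<Omega>(1) closed_R by (rule open_Diff)
  have "Lp_holomorphic p (\<Omega> - R) (\<lambda>z. \<psi> z * f z + (\<Sum>a\<in>T. - \<sigma> a * tr a c z))"
    using p by (intro Lp_holomorphic_add \<psi>f_Lp Lp_holomorphic_sum Lp_holomorphic_cmult T o tr_Lp) (auto simp: rays_def)
  then show ?thesis by (simp add: g_def[abs_def] sum_negf)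
qed

text \<open>Across the segment from \<open>a\<close>, the product \<open>\<psi> * f\<close> jumps by
  \<open>\<sigma> a\<close> times \<open>f\<close> and the transform by \<open>f\<close>, so the
  combination continues as \<open>k * f - \<sigma> a * H\<close>. The other transforms are
  holomorphic there because the segments meet only at \<open>c\<close>.\<close>

lemma g_extends_locally:
  assumes x: "x \<in> \<Omega>" "x \<noteq> c"
  shows "\<exists>d>0. \<exists>h. h holomorphic_on ball x d \<and> (\<forall>y\<in>ball x d - R. g y = h y)"
proof (cases "x \<in> R")
  case False
  have "open (\<Omega> - R)" using \<Omega>(1) closed_R by (rule open_Diff)
  moreover have "x \<in> \<Omega> - R" using x False by simp
  ultimately obtain d where "d > 0" "ball x d \<subseteq> \<Omega> - R" by (rule openE)
  moreover have "g holomorphic_on \<Omega> - R" using g_Lp by (simp add: Lp_holomorphic_def)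
  ultimately have "g holomorphic_on ball x d" by (blast intro: holomorphic_on_subset)
  then show ?thesis using \<open>d > 0\<close> by blast
next
  case True
  then obtain a where a: "a \<in> T" "x \<in> closed_segment a c" using x by (auto simp: rays_def)
  interpret boundary_ray D f p a c r by (rule ray[OF a(1)])
  have a\<Omega>: "a \<notin> \<Omega>" using a T by auto
  obtain t0 where t0: "0 \<le> t0" "t0 \<le> l" "x = w t0" using a(2) unfolding segment_eq by auto
  have "t0 \<noteq> 0" using t0 a\<Omega> x by (auto simp: w_def)
  moreover have "t0 \<noteq> l" using t0 x w_l by auto
  ultimately have t0': "0 < t0" "t0 < l" using t0 by auto
  obtain d1 H where H: "d1 > 0" "ball (w t0) d1 \<subseteq> D" "H holomorphic_on ball (w t0) d1"
    "\<And>z. z \<in> ball (w t0) d1 \<Longrightarrow> Im ((z - a) / e) \<noteq> 0 \<Longrightarrow> tr a c z = H z + (if Im ((z - a) / e) > 0 then f z else 0)"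
    using transform_jump[OF \<Omega>(2,3) a\<Omega> t0'] by blast
  obtain \<epsilon> k where \<epsilon>: "\<epsilon> > 0" "\<And>z. z \<in> D \<Longrightarrow> 0 < - Im ((z - c) / (a - c)) \<Longrightarrow> - Im ((z - c) / (a - c)) < \<epsilon> * Re ((z - c) / (a - c)) \<Longrightarrow> \<psi> z = k + \<sigma> a"
    "\<And>z. z \<in> D \<Longrightarrow> 0 < Im ((z - c) / (a - c)) \<Longrightarrow> Im ((z - c) / (a - c)) < \<epsilon> * Re ((z - c) / (a - c)) \<Longrightarrow> \<psi> z = k"
    using jump[OF a(1)] unfolding sector_jump_def by blast
  have "closed (\<Union>a'\<in>T - {a}. closed_segment a' c)" using T(1) by (intro closed_UN) auto
  then have "open (\<Omega> - (\<Union>a'\<in>T - {a}. closed_segment a' c))" using \<Omega>(1) by (intro open_Diff)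
  moreover have "x \<in> \<Omega> - (\<Union>a'\<in>T - {a}. closed_segment a' c)" using x a segments_disjoint by blast
  ultimately obtain d2 where d2: "d2 > 0" "ball x d2 \<subseteq> \<Omega> - (\<Union>a'\<in>T - {a}. closed_segment a' c)"
    by (rule openE)
  \<comment> \<open>The bounds by \<open>t0\<close> and \<open>l - t0\<close> ensure that a point of
    the disc on the line lies on the segment. The last bound is equivalent to
    \<open>d \<le> \<epsilon> * (l - t0 - d)\<close> and keeps the disc, off the line, inside the
    two thin sectors where \<psi> is constant.\<close>
  define d where "d = min (min d1 d2) (min (min t0 (l - t0)) (\<epsilon> * (l - t0) / (1 + \<epsilon>)))"
  have d: "d > 0" "d \<le> d1" "d \<le> d2" "d \<le> t0" "d \<le> l - t0" "d \<le> \<epsilon> * (l - t0) / (1 + \<epsilon>)"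
    using H(1) d2(1) t0' \<epsilon>(1) by (auto simp: d_def)
  define h where "h z = k * f z - \<sigma> a * H z - (\<Sum>a'\<in>T - {a}. \<sigma> a' * tr a' c z)" for z
  show ?thesis
  proof (intro exI[of _ d] exI[of _ h] conjI ballI d(1))
    have sub: "ball x d \<subseteq> D" "ball x d \<subseteq> ball (w t0) d1" using H(2) d t0(3) by auto
    show "h holomorphic_on ball x d"
      unfolding h_def
    proof (intro holomorphic_intros)
      show "f holomorphic_on ball x d" by (rule holomorphic_on_subset[OF hol sub(1)])
      show "H holomorphic_on ball x d" by (rule holomorphic_on_subset[OF H(3) sub(2)])
      fix a' assume a': "a' \<in> T - {a}"
      have "ball x d \<subseteq> \<Omega> - closed_segment a' c" using d2(2) d(3) a' subset_ball[of d d2 x] by blast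
      then show "tr a' c holomorphic_on ball x d" using tr_Lp a' by (auto simp: Lp_holomorphic_def)
    qed
    fix z assume z: "z \<in> ball x d - R"
    define \<zeta> where "\<zeta> = (z - a) / e"
    have zD: "z \<in> D" using z sub by auto
    have e0: "e \<noteq> 0" using norm_e by auto
    have "\<zeta> - of_real t0 = (z - x) / e" using e0 t0(3) by (simp add: \<zeta>_def w_def field_simps)
    then have "norm (\<zeta> - of_real t0) = norm (z - x)" using norm_e by (simp add: norm_divide)
    then have n: "norm (\<zeta> - of_real t0) < d" using z by (simp add: dist_norm norm_minus_commute)
    have re: "\<bar>Re \<zeta> - t0\<bar> < d" and im: "\<bar>Im \<zeta>\<bar> < d"
      using abs_Re_le_cmod[of "\<zeta> - of_real t0"] abs_Im_le_cmod[of "\<zeta> - of_real t0"] n by auto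
    have Im0: "Im \<zeta> \<noteq> 0"
    proof
      assume "Im \<zeta> = 0"
      then obtain t where t: "z = w t" using on_line_iff unfolding \<zeta>_def by blast
      then have "\<zeta> = of_real t" using e0 by (simp add: \<zeta>_def w_def)
      then have "0 \<le> t" "t \<le> l" using re d(4,5) by (auto simp: abs_less_iff)
      then have "z \<in> R" using t a(1) segment_eq by (auto simp: rays_def)
      then show False using z by simp
    qed
    have sc: "Im ((z - c) / (a - c)) = - Im \<zeta> / l" "Re ((z - c) / (a - c)) = 1 - Re \<zeta> / l"
      unfolding sector_coordinate \<zeta>_def[symmetric] by simp_all
    have "d * (1 + \<epsilon>) \<le> \<epsilon> * (l - t0)" using d(6) \<epsilon>(1) by (simp add: le_divide_eq)
    then have "d \<le> \<epsilon> * (l - t0 - d)" by (simp add: algebra_simps)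
    also have "\<dots> \<le> \<epsilon> * (l - Re \<zeta>)" using re \<epsilon>(1) by (intro mult_left_mono) (auto simp: abs_less_iff)
    finally have "\<bar>Im \<zeta>\<bar> < \<epsilon> * (l - Re \<zeta>)" using im by simp
    then have "\<bar>Im \<zeta>\<bar> / l < \<epsilon> * (l - Re \<zeta>) / l" using l_pos by (rule divide_strict_right_mono)
    also have "\<dots> = \<epsilon> * (1 - Re \<zeta> / l)" using l_pos by (simp add: field_simps)
    finally have sec: "\<bar>Im \<zeta>\<bar> / l < \<epsilon> * (1 - Re \<zeta> / l)" .
    have "z \<in> ball (w t0) d1" using z sub by auto
    from H(4)[OF this] have tr: "tr a c z = H z + (if Im \<zeta> > 0 then f z else 0)" using Im0 by (simp add: \<zeta>_def)
    have "\<psi> z = k + (if Im \<zeta> > 0 then \<sigma> a else 0)"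
    proof (cases "Im \<zeta> > 0")
      case True then show ?thesis using \<epsilon>(2)[OF zD] sec l_pos unfolding sc by simp
    next
      case False then show ?thesis using \<epsilon>(3)[OF zD] sec l_pos Im0 unfolding sc by (simp add: divide_less_0_iff)
    qed
    then have "\<psi> z * f z - \<sigma> a * tr a c z = k * f z - \<sigma> a * H z"
      unfolding tr by (simp add: algebra_simps)
    moreover have "(\<Sum>a\<in>T. \<sigma> a * tr a c z) = \<sigma> a * tr a c z + (\<Sum>a'\<in>T - {a}. \<sigma> a' * tr a' c z)"
      using T(1) a(1) by (rule sum.remove)
    ultimately show "g z = h z" by (simp add: g_def h_def algebra_simps)
  qed
qed

lemma nontangential_direction:
  obtains d where "norm d = 1" "\<And>a. a \<in> T \<Longrightarrow> Im (d / boundary_ray.e a c) \<noteq> 0"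
proof -
  \<comment> \<open>The slopes to be avoided. A vertical ray contributes the default quotient 0,
    which is harmless: the direction \<open>Complex 1 x\<close> is never vertical.\<close>
  define B where "B = (\<lambda>a. Im (boundary_ray.e a c) / Re (boundary_ray.e a c)) ` T"
  have "finite B" using T(1) by (simp add: B_def)
  then obtain x :: real where x: "x \<notin> B" using ex_new_if_finite infinite_UNIV_char_0 by blast
  define d0 where "d0 = Complex 1 x"
  have n0: "norm d0 > 0" by (simp add: d0_def complex_eq_iff)
  show thesis
  proof (rule that[of "d0 / of_real (norm d0)"])
    show "norm (d0 / of_real (norm d0)) = 1" using n0 by (simp add: norm_divide)
    fix a assume a: "a \<in> T"
    interpret boundary_ray D f p a c r by (rule ray[OF a])
    have "Im (d0 * cnj e) = x * Re e - Im e" by (simp add: d0_def)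
    also have "\<dots> \<noteq> 0"
    proof (cases "Re e = 0")
      case True
      then have "Im e \<noteq> 0" using norm_e by (auto simp: cmod_def)
      then show ?thesis using True by simp
    next
      case False
      have "x \<noteq> Im e / Re e" using x a by (auto simp: B_def)
      then show ?thesis using False by (simp add: field_simps)
    qed
    finally have nz: "Im (d0 / e) \<noteq> 0" unfolding cnj_e by simp
    have eq: "d0 / of_real (norm d0) / e = d0 / e / of_real (norm d0)"
      by (simp only: divide_divide_eq_left mult.commute)
    show "Im (d0 / of_real (norm d0) / e) \<noteq> 0"
      unfolding eq Im_divide_of_real using n0 nz by simp
  qed
qed

text \<open>The segments form a null set that the area integrals do not see, so p-integrability of
  \<open>g\<close> off the segments passes to the glued function and then to its extension over
  \<open>c\<close>.\<close>

lemma extension: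
  obtains G where "Lp_holomorphic p \<Omega> G" "\<And>z. z \<in> \<Omega> - R \<Longrightarrow> G z = g z"
proof -
  have c\<Omega>: "c \<in> \<Omega>" using c_in \<Omega>(3) by auto
  obtain G1 where G1: "G1 holomorphic_on (\<Omega> - {c})" "\<And>z. z \<in> \<Omega> - {c} - R \<Longrightarrow> G1 z = g z"
    using holomorphic_glue[OF R_null, of "\<Omega> - {c}" g] g_extends_locally \<Omega>(1) by (auto simp: open_Diff)
  have "(\<integral>\<^sup>+z\<in>\<Omega> - {c}. ennreal (norm (G1 z) powr p) \<partial>lborel) = (\<integral>\<^sup>+z\<in>\<Omega> - {c} - R. ennreal (norm (g z) powr p) \<partial>lborel)"
    by (rule set_nn_integral_null_diff[OF R_null]) (simp add: G1(2))
  also have "\<Omega> - {c} - R = \<Omega> - R" by (auto simp: rays_def)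
  finally have Lp1: "(\<integral>\<^sup>+z\<in>\<Omega> - {c}. ennreal (norm (G1 z) powr p) \<partial>lborel) < \<infinity>"
    using g_Lp by (simp add: Lp_holomorphic_def)
  obtain d where d: "norm d = 1" "\<And>a. a \<in> T \<Longrightarrow> Im (d / boundary_ray.e a c) \<noteq> 0"
    using nontangential_direction by blast
  \<comment> \<open>Steps of length at most \<open>r / 2\<close> stay in the ball around
    \<open>c\<close>, and since \<open>r \<le> l\<close> they also meet the condition
    \<open>near\<close> of \<open>transform_nontangential\<close> for every ray at once.\<close>
  define s where "s n = r / 2 / real (Suc n)" for n
  define zs where "zs n = c + of_real (s n) * d" for n
  have s: "0 < s n" "s n \<le> r / 2" for n using r by (auto simp: s_def field_simps)
  have s0: "s \<longlonglongrightarrow> 0" unfolding s_def by (rule lim_const_over_n[THEN LIMSEQ_Suc])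
  have zn: "norm (zs n - c) = s n" for n using s[of n] d(1) by (simp add: zs_def norm_mult)
  have zs_lim: "zs \<longlonglongrightarrow> c"
    unfolding zs_def by (rule tendsto_eq_intros tendsto_of_real s0 refl)+ simp
  have zsD: "zs n \<in> D" for n
    using zn[of n] s[of n] r ball_D by (auto simp: dist_norm norm_minus_commute intro!: subsetD[OF ball_D])
  have im: "Im ((zs n - c) / boundary_ray.e a c) = s n * Im (d / boundary_ray.e a c)" for n a
  proof -
    have "(zs n - c) / boundary_ray.e a c = of_real (s n) * (d / boundary_ray.e a c)" by (simp add: zs_def)
    then show ?thesis by (simp only: Re_complex_of_real Im_complex_of_real times_complex.sel mult_zero_left add_0_right)
  qed
  have zsR: "zs n \<notin> R" for n
  proof
    assume "zs n \<in> R"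
    moreover have "zs n \<noteq> c" using zn[of n] s[of n] by auto
    ultimately obtain a where a: "a \<in> T" "zs n \<in> closed_segment a c" by (auto simp: rays_def)
    interpret boundary_ray D f p a c r by (rule ray[OF a(1)])
    obtain t where "zs n = w t" using a(2) unfolding segment_eq by auto
    then have "zs n - c = w t - w l" by (simp add: w_l)
    also have "\<dots> = of_real (t - l) * e" by (simp add: w_def algebra_simps)
    finally have "(zs n - c) / e = of_real (t - l)" using norm_e by auto
    then have "Im ((zs n - c) / e) = 0" by simp
    then show False using im[of n a] d(2)[OF a(1)] s[of n] by simp
  qed
  have "(\<lambda>n. (zs n - c) * G1 (zs n)) \<longlonglongrightarrow> 0"
  proof -
    have "isCont f c" using f c_in open_D
      by (auto simp: Lp_holomorphic_def continuous_on_eq_continuous_at dest: holomorphic_on_imp_continuous_on)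
    then have "(\<lambda>n. f (zs n)) \<longlonglongrightarrow> f c" using zs_lim by (rule isCont_tendsto_compose)
    then have "(\<lambda>n. (zs n - c) * f (zs n)) \<longlonglongrightarrow> (c - c) * f c" by (intro tendsto_intros zs_lim)
    then have "(\<lambda>n. norm ((zs n - c) * f (zs n))) \<longlonglongrightarrow> 0" by (simp add: tendsto_norm_zero)
    then have 1: "(\<lambda>n. \<psi> (zs n) * ((zs n - c) * f (zs n))) \<longlonglongrightarrow> 0"
    proof (rule Lim_null_comparison[rotated], intro always_eventually allI)
      fix n show "norm (\<psi> (zs n) * ((zs n - c) * f (zs n))) \<le> norm ((zs n - c) * f (zs n))"
        using mult_right_mono[OF \<psi>_le[of "zs n"], of "norm ((zs n - c) * f (zs n))"] by (simp add: norm_mult)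
    qed
    have 2: "(\<lambda>n. (zs n - c) * tr a c (zs n)) \<longlonglongrightarrow> 0" if a: "a \<in> T" for a
    proof -
      interpret boundary_ray D f p a c r by (rule ray[OF a])
      show ?thesis
      proof (rule transform_nontangential[OF \<Omega>(2,3) _ zs_lim, where \<kappa> = "\<bar>Im (d / e)\<bar>"])
        show "a \<notin> \<Omega>" using a T by auto
        show "zs n \<in> \<Omega>" for n using zsD \<Omega>(3) by auto
        show "\<bar>Im (d / e)\<bar> > 0" using d(2)[OF a] by simp
        show "\<bar>Im (d / e)\<bar> * norm (zs n - c) \<le> \<bar>Im ((zs n - c) / e)\<bar>" for n
          unfolding im zn using s[of n] by (simp add: abs_mult)
        show "norm (zs n - c) \<le> l / 2" for n unfolding zn using s[of n] r_le_l by simp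
      qed
    qed
    have "(\<lambda>n. \<psi> (zs n) * ((zs n - c) * f (zs n)) - (\<Sum>a\<in>T. \<sigma> a * ((zs n - c) * tr a c (zs n)))) \<longlonglongrightarrow> 0 - (\<Sum>a\<in>T. \<sigma> a * 0)"
      by (intro tendsto_intros 1 2)
    moreover have "(zs n - c) * G1 (zs n) = \<psi> (zs n) * ((zs n - c) * f (zs n)) - (\<Sum>a\<in>T. \<sigma> a * ((zs n - c) * tr a c (zs n)))" for n
    proof -
      have "zs n \<in> \<Omega> - {c} - R" using zsD[of n] zsR[of n] \<Omega>(3) by (auto simp: rays_def)
      then show ?thesis by (simp add: G1(2) g_def right_diff_distrib sum_distrib_left mult_ac)
    qed
    ultimately show ?thesis by simp
  qed
  moreover have "zs n \<in> \<Omega> - {c}" for n using zsD[of n] zsR[of n] \<Omega>(3) by (auto simp: rays_def)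
  ultimately obtain G where G: "G holomorphic_on \<Omega>" "\<And>z. z \<in> \<Omega> - {c} \<Longrightarrow> G z = G1 z"
    using removable_singularity_Lp[OF p \<Omega>(1) c\<Omega> G1(1) Lp1 zs_lim] by blast
  have eq: "G z = g z" if "z \<in> \<Omega> - R" for z
    using that G(2)[of z] G1(2)[of z] by (auto simp: rays_def)
  have "(\<integral>\<^sup>+z\<in>\<Omega>. ennreal (norm (G z) powr p) \<partial>lborel) = (\<integral>\<^sup>+z\<in>\<Omega> - R. ennreal (norm (g z) powr p) \<partial>lborel)"
    by (rule set_nn_integral_null_diff[OF R_null]) (simp add: eq)
  then have "Lp_holomorphic p \<Omega> G" using g_Lp G(1) by (simp add: Lp_holomorphic_def)
  then show thesis using that eq by blast
qed

end

section \<open>Boundary curves of bounded convex domains\<close>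

locale bounded_convex_domain =
  fixes D :: "complex set" and c :: complex
  assumes open_D: "open D" and convex_D: "convex D" and bounded_D: "bounded D" and c_in: "c \<in> D"
begin

lemma frontier_disjoint: "v \<in> frontier D \<Longrightarrow> v \<notin> D"
  using open_D by (simp add: frontier_def interior_open)

lemma frontier_not_c: "v \<in> frontier D \<Longrightarrow> v \<noteq> c"
  using frontier_disjoint c_in by auto

lemma segment_in_D:
  assumes "v \<in> frontier D" "0 \<le> s" "s < 1"
  shows "c + of_real s * (v - c) \<in> D"
proof (cases "s = 0")
  case False
  have "open_segment c v \<subseteq> interior D"
    by (rule in_interior_closure_convex_segment[OF convex_D])
       (use c_in open_D assms(1) in \<open>auto simp: interior_open frontier_def\<close>)
  moreover have "c + of_real s * (v - c) \<in> open_segment c v" unfolding in_segment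
  proof (intro conjI exI[of _ s])
    show "c \<noteq> v" using frontier_not_c[OF assms(1)] by auto
    show "c + of_real s * (v - c) = (1 - s) *\<^sub>R c + s *\<^sub>R v" by (simp add: scaleR_conv_of_real algebra_simps)
  qed (use assms False in auto)
  ultimately show ?thesis using interior_subset by blast
qed (use c_in in simp)

lemma frontier_unique:
  assumes "v \<in> frontier D" "v' \<in> frontier D" "v - c = of_real s * (v' - c)" "s > 0"
  shows "v = v'"
proof (rule ccontr)
  assume "v \<noteq> v'"
  then have "s \<noteq> 1" using assms(3) by auto
  then consider "s < 1" | "1 / s < 1" using assms(4) by (cases "s < 1") auto
  then show False
  proof cases
    case 1
    have "c + of_real s * (v' - c) \<in> D" using assms 1 by (intro segment_in_D) auto
    then show False using frontier_disjoint[OF assms(1)] assms(3) by (metis add_diff_cancel_left' diff_add_cancel add.commute)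
  next
    case 2
    have "c + of_real (1 / s) * (v - c) \<in> D" using assms 2 by (intro segment_in_D) auto
    moreover have "of_real (1 / s) * (v - c) = v' - c" unfolding assms(3) using assms(4) by simp
    ultimately show False using frontier_disjoint[OF assms(2)] by simp
  qed
qed

text \<open>Every direction from \<open>c\<close> meets the frontier, by boundedness, and only once,
  by \<open>frontier_unique\<close>; compactness of the frontier makes the inverse
  continuous.\<close>

lemma dir_homeomorphism: "\<exists>g. homeomorphism (frontier D) (sphere 0 1) (\<lambda>v. sgn (v - c)) g"
proof (rule homeomorphism_compact)
  show "compact (frontier D)" using bounded_D by (simp add: compact_frontier_bounded)
  show "continuous_on (frontier D) (\<lambda>v. sgn (v - c))"
    unfolding sgn_div_norm using frontier_not_c by (intro continuous_intros) auto
  show "(\<lambda>v. sgn (v - c)) ` frontier D = sphere 0 1"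
  proof (intro equalityI subsetI)
    fix x assume "x \<in> (\<lambda>v. sgn (v - c)) ` frontier D"
    then show "x \<in> sphere 0 1" using frontier_not_c by (auto simp: norm_sgn)
  next
    fix x :: complex assume x: "x \<in> sphere 0 1"
    then have x0: "x \<noteq> 0" by auto
    obtain d where d: "0 < d" "c + d *\<^sub>R x \<in> frontier D"
      using ray_to_frontier[OF bounded_D _ x0, of c] c_in open_D by (auto simp: interior_open)
    have "sgn (d *\<^sub>R x) = x" using d(1) x by (simp add: sgn_div_norm)
    then show "x \<in> (\<lambda>v. sgn (v - c)) ` frontier D" using d(2) by (intro image_eqI[of _ _ "c + d *\<^sub>R x"]) auto
  qed
  show "inj_on (\<lambda>v. sgn (v - c)) (frontier D)"
  proof (rule inj_onI)
    fix v v' assume v: "v \<in> frontier D" "v' \<in> frontier D" "sgn (v - c) = sgn (v' - c)"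
    have n: "norm (v - c) > 0" "norm (v' - c) > 0" using v frontier_not_c by auto
    have "v - c = of_real (norm (v - c)) * sgn (v - c)" using n by (simp add: sgn_div_norm scaleR_conv_of_real)
    also have "\<dots> = of_real (norm (v - c) / norm (v' - c)) * (v' - c)"
      unfolding v(3) by (simp add: sgn_div_norm scaleR_conv_of_real divide_inverse)
    finally show "v = v'" by (rule frontier_unique[OF v(1,2)]) (use n in simp)
  qed
qed

lemma radial_projection:
  obtains \<pi> where "continuous_on (- {c}) \<pi>" "\<And>z. z \<noteq> c \<Longrightarrow> \<pi> z \<in> frontier D"
    "\<And>z. z \<noteq> c \<Longrightarrow> \<exists>s>0. z - c = of_real s * (\<pi> z - c)" "\<And>v. v \<in> frontier D \<Longrightarrow> \<pi> v = v"
proof -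
  obtain g where g: "homeomorphism (frontier D) (sphere 0 1) (\<lambda>v. sgn (v - c)) g" using dir_homeomorphism by blast
  have sph: "sgn (z - c) \<in> sphere 0 1" if "z \<noteq> c" for z using that by (simp add: norm_sgn)
  show thesis
  proof (rule that[of "\<lambda>z. g (sgn (z - c))"])
    show "continuous_on (- {c}) (\<lambda>z. g (sgn (z - c)))"
    proof (rule continuous_on_compose2[of "sphere 0 1" g])
      show "continuous_on (sphere 0 1) g" using g by (simp add: homeomorphism_def)
      show "continuous_on (- {c}) (\<lambda>z. sgn (z - c))" unfolding sgn_div_norm by (intro continuous_intros) auto
      show "(\<lambda>z. sgn (z - c)) ` (- {c}) \<subseteq> sphere 0 1" using sph by blast
    qed
    show fr: "g (sgn (z - c)) \<in> frontier D" if "z \<noteq> c" for z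
      using g sph[OF that] unfolding homeomorphism_def by blast
    show "\<exists>s>0. z - c = of_real s * (g (sgn (z - c)) - c)" if z: "z \<noteq> c" for z
    proof -
      define v where "v = g (sgn (z - c))"
      have "sgn (v - c) = sgn (z - c)" using g sph[OF z] unfolding homeomorphism_def v_def by blast
      moreover have "norm (v - c) > 0" "norm (z - c) > 0" using fr[OF z] frontier_not_c z by (auto simp: v_def)
      moreover have "z - c = of_real (norm (z - c)) * sgn (z - c)" using z by (simp add: sgn_div_norm scaleR_conv_of_real)
      ultimately have "z - c = of_real (norm (z - c)) * sgn (v - c)" by simp
      also have "\<dots> = of_real (norm (z - c) / norm (v - c)) * (v - c)"
        by (simp add: sgn_div_norm scaleR_conv_of_real divide_inverse)
      finally show ?thesis using \<open>norm (v - c) > 0\<close> \<open>norm (z - c) > 0\<close> unfolding v_def[symmetric]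
        by (intro exI[of _ "norm (z - c) / norm (v - c)"]) auto
    qed
    show "g (sgn (v - c)) = v" if "v \<in> frontier D" for v
      using g that unfolding homeomorphism_def by blast
  qed
qed

text \<open>Removing a point flattens the closed boundary curve to the real line, where compact
  connected sets are intervals. This is how components of \<open>E\<close> are recognised as points
  or arcs.\<close>

lemma punctured_frontier_homeomorphic:
  assumes "y \<in> frontier D"
  shows "(frontier D - {y}) homeomorphic (UNIV :: real set)"
proof -
  obtain g where g: "homeomorphism (frontier D) (sphere 0 1) (\<lambda>v. sgn (v - c)) g" using dir_homeomorphism by blast
  have y1: "sgn (y - c) \<in> sphere 0 1" using assms frontier_not_c by (simp add: norm_sgn)
  have "homeomorphism (frontier D - {y}) (sphere 0 1 - {sgn (y - c)}) (\<lambda>v. sgn (v - c)) g"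
  proof (rule homeomorphism_of_subsets[OF g])
    have "g (sgn (v - c)) = v" if "v \<in> frontier D" for v using g that unfolding homeomorphism_def by blast
    then have "inj_on (\<lambda>v. sgn (v - c)) (frontier D)" by (rule inj_on_inverseI)
    then have "(\<lambda>v. sgn (v - c)) ` (frontier D - {y}) = (\<lambda>v. sgn (v - c)) ` frontier D - (\<lambda>v. sgn (v - c)) ` {y}"
      using assms by (intro inj_on_image_set_diff) auto
    moreover have "(\<lambda>v. sgn (v - c)) ` frontier D = sphere 0 1" using g unfolding homeomorphism_def by blast
    ultimately show "(\<lambda>v. sgn (v - c)) ` (frontier D - {y}) = sphere 0 1 - {sgn (y - c)}" by simp
  qed auto
  then have "(frontier D - {y}) homeomorphic (sphere 0 1 - {sgn (y - c)})" unfolding homeomorphic_def by blast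
  also have "\<dots> homeomorphic (UNIV :: real set)"
    by (rule homeomorphic_punctured_sphere_affine[OF _ y1]) auto
  finally show ?thesis .
qed

text \<open>If \<open>x\<close> were interior to an arc that is its component in \<open>E\<close>, it would have a neighbourhood
  in the boundary curve that lies in \<open>E\<close>.\<close>

lemma frontier_limit_in_curve_boundary:
  assumes E: "E \<subseteq> frontier D" "closed E" and x: "x \<in> E" "x \<in> closure (frontier D - E)"
  shows "x \<in> curve_boundary E"
proof -
  \<comment> \<open>Such a point exists because \<open>x\<close> is in the closure of
    \<open>frontier D - E\<close>. As it lies outside \<open>E\<close>, deleting it does not disturb
    the component of \<open>x\<close>.\<close>
  obtain y where y: "y \<in> frontier D" "y \<notin> E" using x(2) by (cases "frontier D - E = {}") auto
  obtain h k where hk: "homeomorphism (frontier D - {y}) (UNIV :: real set) h k"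
    using punctured_frontier_homeomorphic[OF y(1)] unfolding homeomorphic_def by blast
  define K where "K = connected_component_set E x"
  have "compact (frontier D \<inter> E)" using bounded_D E(2) by (intro compact_Int_closed compact_frontier_bounded)
  then have compE: "compact E" using E(1) by (simp add: Int_absorb1)
  have K: "K \<in> components E" using x(1) by (simp add: K_def componentsI)
  have KE: "K \<subseteq> E" "compact K" "connected K" "x \<in> K"
    using K compE x(1) by (auto simp: in_components_connected compact_components K_def dest: in_components_subset)
  have KG: "K \<subseteq> frontier D - {y}" using KE(1) E(1) y(2) by auto
  have ch: "continuous_on K h" using hk KG by (auto simp: homeomorphism_def intro: continuous_on_subset)
  then obtain \<alpha> \<beta> where ab: "h ` K = {\<alpha>..\<beta>}"
    using KE(2,3) connected_compact_interval_1[of "h ` K"] by (auto simp: compact_continuous_image connected_continuous_image)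
  have kh: "k (h v) = v" if "v \<in> frontier D - {y}" for v using hk that by (auto simp: homeomorphism_def)
  have hkt: "h (k t) = t" for t using hk by (auto simp: homeomorphism_def)
  have Kk: "K = k ` {\<alpha>..\<beta>}"
    unfolding ab[symmetric] image_image using kh KG by force
  have ck: "continuous_on UNIV k" using hk by (simp add: homeomorphism_def)
  have injk: "inj k" using hkt by (metis injI)
  have hx: "h x \<in> {\<alpha>..\<beta>}" using KE(4) ab by blast
  show ?thesis
  proof (cases "\<alpha> = \<beta>")
    case True
    then have "K = {x}" using Kk KE(4) by auto
    then show ?thesis using K by (simp add: curve_boundary_def)
  next
    case False
    then have lt: "\<alpha> < \<beta>" using hx by auto
    define \<gamma> where "\<gamma> = k \<circ> linepath \<alpha> \<beta>"
    have arc: "arc \<gamma>"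
      unfolding arc_def
    proof
      show "path \<gamma>" unfolding \<gamma>_def
        by (intro path_continuous_image) (auto intro: continuous_on_subset[OF ck])
      have "inj_on (linepath \<alpha> \<beta>) {0..1}" using arc_linepath[OF False] by (simp add: arc_def)
      then show "inj_on \<gamma> {0..1}" unfolding \<gamma>_def using injk by (intro comp_inj_on) (auto intro: inj_on_subset)
    qed
    have pim: "path_image \<gamma> = K"
      unfolding \<gamma>_def path_image_compose Kk using lt by (simp add: closed_segment_eq_real_ivl)
    have "x = k \<alpha> \<or> x = k \<beta>"
    proof (rule ccontr)
      assume "\<not> ?thesis"
      moreover have "x = k (h x)" using kh[OF subsetD[OF KG KE(4)]] by simp
      ultimately have "h x \<in> {\<alpha><..<\<beta>}" using hx by force
      define U where "U = k ` {\<alpha><..<\<beta>}"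
      have "U = (frontier D - {y}) \<inter> h -` {\<alpha><..<\<beta>}"
      proof (intro equalityI subsetI)
        fix v assume "v \<in> U"
        then obtain t where t: "t \<in> {\<alpha><..<\<beta>}" "v = k t" by (auto simp: U_def)
        have "k t \<in> frontier D - {y}" using hk unfolding homeomorphism_def by blast
        then show "v \<in> (frontier D - {y}) \<inter> h -` {\<alpha><..<\<beta>}" using t hkt[of t] by simp
      next
        fix v assume v: "v \<in> (frontier D - {y}) \<inter> h -` {\<alpha><..<\<beta>}"
        then have "v = k (h v)" using kh[of v] by simp
        then show "v \<in> U" using v unfolding U_def by blast
      qed
      moreover have "continuous_on (frontier D - {y}) h" using hk by (simp add: homeomorphism_def)
      ultimately have "openin (top_of_set (frontier D - {y})) U"
        by (simp add: continuous_openin_preimage_gen)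
      moreover have "openin (top_of_set (frontier D)) (frontier D - {y})"
        by (simp add: openin_delete)
      ultimately have "openin (top_of_set (frontier D)) U" by (rule openin_trans)
      then obtain W where W: "open W" "U = frontier D \<inter> W" by (auto simp: openin_open)
      have "x \<in> U" using \<open>h x \<in> {\<alpha><..<\<beta>}\<close> \<open>x = k (h x)\<close> by (auto simp: U_def)
      then have "W \<inter> (frontier D - E) \<noteq> {}"
        using x(2) W by (metis Int_iff Int_commute closure_iff_nhds_not_empty order_refl)
      moreover have "frontier D \<inter> W \<subseteq> E"
      proof -
        have "U \<subseteq> K" unfolding U_def Kk by (rule image_mono) auto
        then show ?thesis using W(2) KE(1) by blast
      qed
      ultimately show False by auto
    qed
    then have "x = pathstart \<gamma> \<or> x = pathfinish \<gamma>" by (simp add: \<gamma>_def pathstart_compose pathfinish_compose)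
    then show ?thesis unfolding curve_boundary_def using arc pim K by blast
  qed
qed

end

section \<open>Constancy of an indicator on thin sectors beside each ray\<close>

lemma convex_sector: "convex {\<zeta>. 0 < s * Im \<zeta> \<and> s * Im \<zeta> < \<epsilon> * Re \<zeta>}"
proof -
  have "{\<zeta>. 0 < s * Im \<zeta> \<and> s * Im \<zeta> < \<epsilon> * Re \<zeta>} = {\<zeta>. Complex 0 (- s) \<bullet> \<zeta> < 0} \<inter> {\<zeta>. Complex (- \<epsilon>) s \<bullet> \<zeta> < 0}"
    by (auto simp: inner_complex_def)
  then show ?thesis by (simp add: convex_Int convex_halfspace_lt)
qed

text \<open>Finitely many rays leave, on each side of a given one, a thin sector with apex
  \<open>c\<close> that meets no ray. Its intersection with \<open>D\<close> is convex, hence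
  connected, and a locally constant function is constant on it.\<close>

lemma sector_jumps_exist:
  fixes \<psi> :: "complex \<Rightarrow> complex"
  assumes convex: "convex D" and T: "finite T" "c \<notin> T"
    and loc: "\<And>x. x \<in> D - rays c T \<Longrightarrow> \<exists>d>0. \<forall>y\<in>ball x d. \<psi> y = \<psi> x"
  obtains \<sigma> where "\<And>a. a \<in> T \<Longrightarrow> sector_jump D c \<psi> a (\<sigma> a)"
proof -
  have "\<exists>\<sigma>. sector_jump D c \<psi> a \<sigma>"
    if a: "a \<in> T" for a
  proof -
    have ac: "a - c \<noteq> 0" using a T by auto
    \<comment> \<open>The slope of another ray relative to the ray of \<open>a\<close>. Rays that
      point backwards or along the axis never enter the open thin sectors; they get the neutral
      value 1, so the minimum below is positive.\<close>
    define m where "m \<tau> = (if Im \<tau> \<noteq> 0 \<and> Re \<tau> > 0 then \<bar>Im \<tau>\<bar> / Re \<tau> else 1)" for \<tau>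
    define A where "A = insert 1 ((\<lambda>a'. m ((a' - c) / (a - c))) ` T)"
    have finA: "finite A" "A \<noteq> {}" using T by (auto simp: A_def)
    define \<epsilon> where "\<epsilon> = Min A"
    have "\<forall>x\<in>A. x > 0" by (auto simp: A_def m_def)
    then have \<epsilon>: "\<epsilon> > 0" using finA by (simp add: \<epsilon>_def)
    have \<epsilon>_le: "\<epsilon> \<le> m ((a' - c) / (a - c))" if "a' \<in> T" for a'
      unfolding \<epsilon>_def using finA that by (intro Min_le) (auto simp: A_def)
    define N where "N s = {z \<in> D. 0 < s * Im ((z - c) / (a - c)) \<and> s * Im ((z - c) / (a - c)) < \<epsilon> * Re ((z - c) / (a - c))}" for s
    have off: "N s \<inter> rays c T = {}" if s: "s = 1 \<or> s = -1" for s
    proof (rule ccontr)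
      assume "N s \<inter> rays c T \<noteq> {}"
      then obtain z where z: "z \<in> N s" "z \<in> rays c T" by auto
      have "z \<noteq> c" using z(1) by (auto simp: N_def)
      then obtain a' where a': "a' \<in> T" "z \<in> closed_segment a' c" using z(2) by (auto simp: rays_def)
      then obtain u where u: "0 \<le> u" "u \<le> 1" "z = (1 - u) *\<^sub>R a' + u *\<^sub>R c" by (auto simp: in_segment)
      define \<tau> where "\<tau> = (a' - c) / (a - c)"
      have "z - c = of_real (1 - u) * (a' - c)" using u(3) by (simp add: scaleR_conv_of_real algebra_simps)
      then have zt: "(z - c) / (a - c) = of_real (1 - u) * \<tau>" by (simp add: \<tau>_def)
      have i: "0 < s * ((1 - u) * Im \<tau>)" "s * ((1 - u) * Im \<tau>) < \<epsilon> * ((1 - u) * Re \<tau>)"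
      proof -
        have "0 < s * Im ((z - c) / (a - c)) \<and> s * Im ((z - c) / (a - c)) < \<epsilon> * Re ((z - c) / (a - c))"
          using z(1) by (simp add: N_def)
        then show "0 < s * ((1 - u) * Im \<tau>)" "s * ((1 - u) * Im \<tau>) < \<epsilon> * ((1 - u) * Re \<tau>)"
          unfolding zt by (simp_all del: of_real_diff)
      qed
      have u1: "1 - u > 0" using u i(1) by (cases "u = 1") auto
      have "0 < (1 - u) * (s * Im \<tau>)" using i(1) by (simp add: mult_ac)
      then have j1: "0 < s * Im \<tau>" using u1 by (simp add: zero_less_mult_iff)
      have "(1 - u) * (s * Im \<tau>) < (1 - u) * (\<epsilon> * Re \<tau>)" using i(2) by (simp add: mult_ac)
      then have j2: "s * Im \<tau> < \<epsilon> * Re \<tau>" using u1 by (simp only: mult_less_cancel_left_pos)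
      have "\<epsilon> * Re \<tau> > 0" using j1 j2 by linarith
      then have re: "Re \<tau> > 0" using \<epsilon> by (simp add: zero_less_mult_iff)
      have im: "Im \<tau> \<noteq> 0" "s * Im \<tau> = \<bar>Im \<tau>\<bar>" using j1 s by auto
      have "\<epsilon> \<le> \<bar>Im \<tau>\<bar> / Re \<tau>" using \<epsilon>_le[OF a'(1)] re im by (simp add: m_def \<tau>_def[symmetric])
      then have "\<epsilon> * Re \<tau> \<le> \<bar>Im \<tau>\<bar>" using re by (simp add: pos_le_divide_eq)
      then show False using j2 im(2) by linarith
    qed
    have const: "\<exists>k. \<forall>z\<in>N s. \<psi> z = k" if s: "s = 1 \<or> s = -1" for s
    proof -
      have "N s = D \<inter> (\<lambda>\<zeta>. c + (a - c) * \<zeta>) ` {\<zeta>. 0 < s * Im \<zeta> \<and> s * Im \<zeta> < \<epsilon> * Re \<zeta>}"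
      proof -
        have "z \<in> (\<lambda>\<zeta>. c + (a - c) * \<zeta>) ` {\<zeta>. 0 < s * Im \<zeta> \<and> s * Im \<zeta> < \<epsilon> * Re \<zeta>}" if "z \<in> N s" for z
          using that ac by (intro image_eqI[of _ _ "(z - c) / (a - c)"]) (simp_all add: N_def)
        moreover have "(c + (a - c) * \<zeta> - c) / (a - c) = \<zeta>" for \<zeta> using ac by simp
        ultimately show ?thesis unfolding N_def by auto
      qed
      also have "(\<lambda>\<zeta>. c + (a - c) * \<zeta>) ` {\<zeta>. 0 < s * Im \<zeta> \<and> s * Im \<zeta> < \<epsilon> * Re \<zeta>}
        = (+) c ` ((*) (a - c) ` {\<zeta>. 0 < s * Im \<zeta> \<and> s * Im \<zeta> < \<epsilon> * Re \<zeta>})" by (simp add: image_image)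
      finally have "convex (N s)"
        using convex convex_sector by (simp add: convex_Int convex_translation convex_linear_image linear_times)
      then have "connected (N s)" by (rule convex_connected)
      then have "\<psi> constant_on N s"
      proof (rule locally_constant_imp_constant)
        fix x assume x: "x \<in> N s"
        then have "x \<in> D - rays c T" using off[OF s] by (auto simp: N_def)
        then obtain d where d: "d > 0" "\<forall>y\<in>ball x d. \<psi> y = \<psi> x" using loc by blast
        show "\<exists>V. openin (top_of_set (N s)) V \<and> x \<in> V \<and> (\<forall>y\<in>V. \<psi> y = \<psi> x)"
        proof (intro exI[of _ "N s \<inter> ball x d"] conjI)
          show "openin (top_of_set (N s)) (N s \<inter> ball x d)" by (simp add: openin_open_Int)
          show "\<forall>y\<in>N s \<inter> ball x d. \<psi> y = \<psi> x" using d(2) by blast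
        qed (use x d in auto)
      qed
      then show ?thesis by (simp add: constant_on_def)
    qed
    obtain kR where kR: "\<forall>z\<in>N 1. \<psi> z = kR" using const[of 1] by auto
    obtain kL where kL: "\<forall>z\<in>N (-1). \<psi> z = kL" using const[of "-1"] by auto
    \<comment> \<open>In this coordinate \<open>N (-1)\<close> is the left sector and
      \<open>N 1\<close> the right one, so the jump is \<open>kL - kR\<close> over the base value
      \<open>kR\<close>.\<close>
    show ?thesis
      unfolding sector_jump_def using kR kL \<epsilon> by (intro exI[of _ "kL - kR"] exI[of _ \<epsilon>] conjI exI[of _ kR]) (auto simp: N_def)
  qed
  then show thesis using that by metis
qed

lemma bergman_space_iff: "f \<in> bergman_space p \<Omega> \<longleftrightarrow> f \<in> extensional \<Omega> \<and> Lp_holomorphic p \<Omega> f"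
  by (simp add: bergman_space_def Lp_holomorphic_def)

lemma bergman_sum_subset:
  assumes "1 < p" "open \<Omega>1" "open \<Omega>2"
  shows "bergman_sum p \<Omega>1 \<Omega>2 \<subseteq> bergman_space p (\<Omega>1 \<inter> \<Omega>2)"
proof
  fix f assume "f \<in> bergman_sum p \<Omega>1 \<Omega>2"
  then obtain f1 f2 where f: "f = (\<lambda>z\<in>\<Omega>1 \<inter> \<Omega>2. f1 z + f2 z)" and "f1 \<in> bergman_space p \<Omega>1" "f2 \<in> bergman_space p \<Omega>2"
    unfolding bergman_sum_def by blast
  then have "Lp_holomorphic p (\<Omega>1 \<inter> \<Omega>2) f1" "Lp_holomorphic p (\<Omega>1 \<inter> \<Omega>2) f2"
    by (auto simp: bergman_space_iff intro: Lp_holomorphic_subset)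
  then have "Lp_holomorphic p (\<Omega>1 \<inter> \<Omega>2) (\<lambda>z. f1 z + f2 z)"
    using assms by (intro Lp_holomorphic_add) auto
  moreover have "Lp_holomorphic p (\<Omega>1 \<inter> \<Omega>2) f \<longleftrightarrow> Lp_holomorphic p (\<Omega>1 \<inter> \<Omega>2) (\<lambda>z. f1 z + f2 z)"
    by (rule Lp_holomorphic_cong) (simp add: f)
  moreover have "f \<in> extensional (\<Omega>1 \<inter> \<Omega>2)" unfolding f by simp
  ultimately show "f \<in> bergman_space p (\<Omega>1 \<inter> \<Omega>2)" by (simp only: bergman_space_iff)
qed

section \<open>The decomposition\<close>

lemma Lp_holomorphic_decomposition:
  assumes p: "1 < p" and O1: "open \<Omega>1" "convex \<Omega>1" and O2: "open \<Omega>2" "convex \<Omega>2"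
    and ne: "\<Omega>1 \<inter> \<Omega>2 \<noteq> {}" and bdd: "bounded (\<Omega>1 \<inter> \<Omega>2)"
    and fin: "finite (curve_boundary (frontier \<Omega>1 \<inter> frontier \<Omega>2))"
    and f: "Lp_holomorphic p (\<Omega>1 \<inter> \<Omega>2) f"
  obtains G1 G2 where "Lp_holomorphic p \<Omega>1 G1" "Lp_holomorphic p \<Omega>2 G2"
    "\<And>z. z \<in> \<Omega>1 \<inter> \<Omega>2 \<Longrightarrow> f z = G1 z + G2 z"
proof -
  define D where "D = \<Omega>1 \<inter> \<Omega>2"
  have D: "open D" "convex D" "bounded D" using O1 O2 bdd by (auto simp: D_def convex_Int)
  obtain c where c: "c \<in> D" using ne by (auto simp: D_def)
  interpret bounded_convex_domain D c by unfold_locales (use D c in auto)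
  obtain r where r: "r > 0" "ball c r \<subseteq> D" using open_contains_ball_eq[OF D(1)] c by blast
  define E where "E = frontier \<Omega>1 \<inter> frontier \<Omega>2"
  define V where "V = frontier D \<inter> \<Omega>2"
  define T where "T = closure V - V"
  \<comment> \<open>Valid because the two open convex sets meet. It puts \<open>E\<close> inside the
    frontier of \<open>D\<close> and leaves only three kinds of frontier points: in \<Omega>1, in
    \<Omega>2, or in \<open>E\<close>.\<close>
  have clo: "closure D = closure \<Omega>1 \<inter> closure \<Omega>2"
    unfolding D_def using O1 O2 ne by (intro closure_Int_convex) (simp_all add: rel_interior_open)
  have fr: "frontier D = closure D - D" "frontier \<Omega>1 = closure \<Omega>1 - \<Omega>1" "frontier \<Omega>2 = closure \<Omega>2 - \<Omega>2"
    using D O1 O2 by (simp_all add: frontier_def interior_open)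
  have E_sub: "E \<subseteq> frontier D" unfolding E_def fr clo by (auto simp: D_def)
  have E_clo: "closed E" unfolding E_def by (intro closed_Int frontier_closed)
  have outside: "x \<in> \<Omega>1 \<or> x \<in> \<Omega>2 \<or> x \<in> E" if "x \<in> frontier D" for x
    using that unfolding E_def fr clo by auto
  have V_clo: "closure V \<subseteq> frontier D" unfolding V_def by (intro closure_minimal frontier_closed) auto
  \<comment> \<open>\<Omega>1 is an open set disjoint from \<open>V\<close>, since a common point
    would lie in \<open>D\<close>. With the relative openness of \<open>V\<close> this forces
    \<open>T\<close> into \<open>E\<close>.\<close>
  have V1: "x \<notin> closure V" if "x \<in> \<Omega>1" for x
  proof -
    have "\<Omega>1 \<inter> V = {}" using fr(1) by (auto simp: V_def D_def)
    then show ?thesis using open_Int_closure_eq_empty[OF O1(1), of V] that by auto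
  qed
  have T_E: "T \<subseteq> E"
  proof
    fix x assume x: "x \<in> T"
    then have "x \<in> frontier D" "x \<notin> \<Omega>1" "x \<notin> \<Omega>2" using V_clo V1 by (auto simp: T_def V_def)
    then show "x \<in> E" using outside by blast
  qed
  have "T \<subseteq> curve_boundary E"
  proof
    fix x assume x: "x \<in> T"
    have "V \<subseteq> frontier D - E" using fr(3) by (auto simp: V_def E_def)
    then have "x \<in> closure (frontier D - E)" using x closure_mono by (auto simp: T_def)
    then show "x \<in> curve_boundary E" using frontier_limit_in_curve_boundary[OF E_sub E_clo] x T_E by blast
  qed
  then have T_fin: "finite T" using fin finite_subset by (auto simp: E_def)
  have T_fr: "T \<subseteq> frontier D" using T_E E_sub by blast
  have c_T: "c \<notin> T" using T_fr frontier_not_c by blast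
  obtain \<pi> where \<pi>: "continuous_on (- {c}) \<pi>" "\<And>z. z \<noteq> c \<Longrightarrow> \<pi> z \<in> frontier D"
    "\<And>z. z \<noteq> c \<Longrightarrow> \<exists>s>0. z - c = of_real s * (\<pi> z - c)" "\<And>v. v \<in> frontier D \<Longrightarrow> \<pi> v = v"
    using radial_projection by blast
  \<comment> \<open>Points seen from \<open>c\<close> in the direction of \<open>V\<close>, and, in
    \<open>N\<close>, in a direction off its closure. Both sets are open, and of all directions only
    those of \<open>T\<close> are left out.\<close>
  define P where "P = - {c} \<inter> \<pi> -` \<Omega>2"
  define N where "N = - {c} \<inter> \<pi> -` (- closure V)"
  have PN: "open P" "open N" unfolding P_def N_def
    using O2(1) by (auto intro!: continuous_open_preimage[OF \<pi>(1)])
  have P_V: "\<pi> z \<in> V" if "z \<in> P" for z using that \<pi>(2)[of z] by (auto simp: P_def V_def)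
  have N_V: "\<pi> z \<notin> V" if "z \<in> N" for z using that closure_subset[of V] by (auto simp: N_def)
  \<comment> \<open>At \<open>c\<close>, which has no direction, \<psi>1 is 0 and \<psi>2 is 1, so
    that the two add up to 1 on all of \<open>D\<close>.\<close>
  define \<psi>1 :: "complex \<Rightarrow> complex" where "\<psi>1 z = (if z \<in> D \<and> z \<noteq> c \<and> \<pi> z \<in> V then 1 else 0)" for z
  define \<psi>2 :: "complex \<Rightarrow> complex" where "\<psi>2 z = (if z \<in> D \<and> \<not> (z \<noteq> c \<and> \<pi> z \<in> V) then 1 else 0)" for z
  have loc: "\<exists>d>0. \<forall>y\<in>ball x d. \<psi>1 y = \<psi>1 x \<and> \<psi>2 y = \<psi>2 x" if x: "x \<in> D - rays c T" for x
  proof -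
    have xc: "x \<noteq> c" "x \<in> D" using x by (auto simp: rays_def)
    \<comment> \<open>Otherwise \<open>x\<close>, being in \<open>D\<close>, would come strictly
      before the frontier point \<open>\<pi> x\<close> on the ray from \<open>c\<close>, hence lie
      on one of the removed segments.\<close>
    have "\<pi> x \<notin> T"
    proof
      assume a: "\<pi> x \<in> T"
      obtain s where s: "s > 0" "x - c = of_real s * (\<pi> x - c)" using \<pi>(3)[OF xc(1)] by blast
      have "s < 1"
      proof (rule ccontr)
        assume "\<not> s < 1"
        then have "\<pi> x = (1 - 1 / s) *\<^sub>R c + (1 / s) *\<^sub>R x"
        proof -
          have "of_real (1 / s) * (x - c) = \<pi> x - c" unfolding s(2) using s(1) by simp
          then have "\<pi> x = c + of_real (1 / s) * (x - c)" by simp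
          also have "\<dots> = (1 - 1 / s) *\<^sub>R c + (1 / s) *\<^sub>R x"
            by (simp only: scaleR_conv_of_real) (simp add: algebra_simps diff_divide_distrib)
          finally show ?thesis .
        qed
        also have "\<dots> \<in> D" using D(2) c xc(2) s \<open>\<not> s < 1\<close> by (intro convexD) auto
        finally show False using a T_fr frontier_disjoint by blast
      qed
      have "x = (1 - (1 - s)) *\<^sub>R \<pi> x + (1 - s) *\<^sub>R c"
        using s(2) by (simp add: scaleR_conv_of_real algebra_simps)
      then have "x \<in> closed_segment (\<pi> x) c" unfolding in_segment using s \<open>s < 1\<close> by (intro exI[of _ "1 - s"]) auto
      then show False using x a by (auto simp: rays_def)
    qed
    then have "x \<in> P \<or> x \<in> N" using \<pi>(2)[OF xc(1)] xc by (auto simp: P_def N_def T_def V_def)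
    then obtain d where d: "d > 0" "ball x d \<subseteq> D \<inter> P \<or> ball x d \<subseteq> D \<inter> N"
      using openE[of "D \<inter> P" x] openE[of "D \<inter> N" x] D(1) PN xc(2) by (metis IntI open_Int)
    have "\<psi>1 y = \<psi>1 x \<and> \<psi>2 y = \<psi>2 x" if y: "y \<in> ball x d" for y
    proof -
      have "x \<in> ball x d" using d(1) by simp
      then consider "x \<in> D \<inter> P" "y \<in> D \<inter> P" | "x \<in> D \<inter> N" "y \<in> D \<inter> N" using d(2) y by blast
      then show ?thesis
        by cases (use P_V[of x] P_V[of y] N_V[of x] N_V[of y] in \<open>auto simp: \<psi>1_def \<psi>2_def P_def\<close>)
    qed
    then show ?thesis using d(1) by blast
  qed
  have out1: "\<exists>d>0. \<forall>y\<in>ball x d. \<psi>1 y = 0" if x: "x \<in> \<Omega>1 - D" for x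
  proof -
    \<comment> \<open>A point of \<Omega>1 in the closure of \<open>D\<close> but not in
      \<open>D\<close> is a frontier point, which \<pi> fixes, and it is off
      \<open>closure V\<close> by \<open>V1\<close>.\<close>
    have "x \<in> - closure D \<or> x \<in> N"
      using x c V1[of x] \<pi>(4)[of x] fr(1) by (auto simp: N_def)
    then obtain d where d: "d > 0" "ball x d \<subseteq> - closure D \<or> ball x d \<subseteq> N"
      using openE[of "- closure D" x] openE[of N x] PN by (metis closed_closure open_Compl)
    have "\<psi>1 y = 0" if "y \<in> ball x d" for y
      using d(2) that N_V[of y] closure_subset[of D] by (auto simp: \<psi>1_def)
    then show ?thesis using d(1) by blast
  qed
  have out2: "\<exists>d>0. \<forall>y\<in>ball x d. \<psi>2 y = 0" if x: "x \<in> \<Omega>2 - D" for x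
  proof -
    have "x \<in> - closure D \<or> x \<in> P"
      using x c \<pi>(4)[of x] fr(1) by (auto simp: P_def)
    then obtain d where d: "d > 0" "ball x d \<subseteq> - closure D \<or> ball x d \<subseteq> P"
      using openE[of "- closure D" x] openE[of P x] PN by (metis closed_closure open_Compl)
    have "\<psi>2 y = 0" if y: "y \<in> ball x d" for y
    proof (cases "y \<in> P")
      case True then show ?thesis using P_V[of y] by (simp add: \<psi>2_def P_def)
    next
      case False then show ?thesis using d(2) y closure_subset[of D] by (auto simp: \<psi>2_def)
    qed
    then show ?thesis using d(1) by blast
  qed
  have loc1: "\<exists>d>0. \<forall>y\<in>ball x d. \<psi>1 y = \<psi>1 x" and loc2: "\<exists>d>0. \<forall>y\<in>ball x d. \<psi>2 y = \<psi>2 x"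
    if "x \<in> D - rays c T" for x using loc[OF that] by blast+
  obtain \<sigma> where \<sigma>: "\<And>a. a \<in> T \<Longrightarrow> sector_jump D c \<psi>1 a (\<sigma> a)"
    using sector_jumps_exist[OF D(2) T_fin c_T loc1] by blast
  have sum1: "\<psi>2 z = 1 - \<psi>1 z" if "z \<in> D" for z using that by (simp add: \<psi>1_def \<psi>2_def)
  \<comment> \<open>Passing to \<open>1 - \<psi>1\<close> negates the jump, so the same transforms
    occur with opposite signs in the two corrected functions and cancel in their sum.\<close>
  have \<sigma>2: "sector_jump D c \<psi>2 a (- \<sigma> a)"
    if a: "a \<in> T" for a
  proof -
    obtain \<epsilon> k where ek: "\<epsilon> > 0" "\<forall>z\<in>D.
       (0 < - Im ((z - c) / (a - c)) \<and> - Im ((z - c) / (a - c)) < \<epsilon> * Re ((z - c) / (a - c)) \<longrightarrow> \<psi>1 z = k + \<sigma> a) \<and>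
       (0 < Im ((z - c) / (a - c)) \<and> Im ((z - c) / (a - c)) < \<epsilon> * Re ((z - c) / (a - c)) \<longrightarrow> \<psi>1 z = k)"
      using \<sigma>[OF a] unfolding sector_jump_def by blast
    show ?thesis unfolding sector_jump_def
      by (intro exI[of _ \<epsilon>] exI[of _ "1 - k"] conjI ballI ek(1)) (use ek(2) sum1 in auto)
  qed
  have T_clo: "T \<subseteq> closure D" using T_fr fr(1) by blast
  have fD: "Lp_holomorphic p D f" using f by (simp add: D_def)
  interpret C1: cut_domain D f p c r T \<psi>1 \<sigma> \<Omega>1
  proof
    show "T \<inter> \<Omega>1 = {}" using T_E fr by (auto simp: E_def)
    show "norm (\<psi>1 z) \<le> 1" for z by (simp add: \<psi>1_def)
  qed (use D r p fD T_fin T_clo O1 loc1 out1 \<sigma> in \<open>simp_all add: D_def\<close>)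
  interpret C2: cut_domain D f p c r T \<psi>2 "\<lambda>a. - \<sigma> a" \<Omega>2
  proof
    show "T \<inter> \<Omega>2 = {}" using T_E fr by (auto simp: E_def)
    show "norm (\<psi>2 z) \<le> 1" for z by (simp add: \<psi>2_def)
  qed (use D r p fD T_fin T_clo O2 loc2 out2 \<sigma>2 in \<open>simp_all add: D_def\<close>)
  obtain G1 where G1: "Lp_holomorphic p \<Omega>1 G1" "\<And>z. z \<in> \<Omega>1 - rays c T \<Longrightarrow> G1 z = C1.g z" using C1.extension by blast
  obtain G2 where G2: "Lp_holomorphic p \<Omega>2 G2" "\<And>z. z \<in> \<Omega>2 - rays c T \<Longrightarrow> G2 z = C2.g z" using C2.extension by blast
  have off: "f z = G1 z + G2 z" if z: "z \<in> D - rays c T" for z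
  proof -
    have "G1 z = C1.g z" "G2 z = C2.g z" using z G1(2) G2(2) by (auto simp: D_def)
    then show ?thesis using sum1[of z] z
      by (simp add: C1.g_def C2.g_def sum_negf left_diff_distrib)
  qed
  \<comment> \<open>On the segments the identity follows by continuity, since their complement
    accumulates at every point.\<close>
  have eq: "f z = G1 z + G2 z" if z: "z \<in> D" for z
  proof -
    define h where "h x = f x - (G1 x + G2 x)" for x
    have "h holomorphic_on D" unfolding h_def using fD G1(1) G2(1)
      by (intro holomorphic_intros) (auto simp: Lp_holomorphic_def D_def intro: holomorphic_on_subset)
    then have "continuous_on D h" by (rule holomorphic_on_imp_continuous_on)
    then have "isCont h z" using z continuous_on_eq_continuous_at[OF D(1)] by blast
    then have "(h \<longlongrightarrow> h z) (at z)" by (simp add: isCont_def)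
    then have 1: "(h \<longlongrightarrow> h z) (at z within - rays c T)" by (rule tendsto_within_subset) simp
    have "eventually (\<lambda>x. 0 = h x) (at z within - rays c T)"
      unfolding eventually_at_topological using z D(1) off by (intro exI[of _ D]) (auto simp: h_def)
    then have 2: "(h \<longlongrightarrow> 0) (at z within - rays c T)"
      by (rule Lim_transform_eventually[OF tendsto_const])
    have "at z within - rays c T \<noteq> bot"
      using null_set_imp_islimpt_Compl[OF C1.R_null, of z] by (simp add: trivial_limit_within)
    then have "h z = 0" using tendsto_unique 1 2 by blast
    then show ?thesis by (simp add: h_def)
  qed
  show thesis using that[OF G1(1) G2(1)] eq by (simp add: D_def)
qed

theorem theorem1p7:
  fixes p :: real and \<Omega>1 \<Omega>2 :: "complex set"
  assumes "1 < p"
    and "open \<Omega>1" and "convex \<Omega>1"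
    and "open \<Omega>2" and "convex \<Omega>2"
    and "\<Omega>1 \<inter> \<Omega>2 \<noteq> {}" and "bounded (\<Omega>1 \<inter> \<Omega>2)"
    and "finite (curve_boundary (frontier \<Omega>1 \<inter> frontier \<Omega>2))"
  shows "bergman_space p (\<Omega>1 \<inter> \<Omega>2) = bergman_sum p \<Omega>1 \<Omega>2"
proof (rule equalityI[OF _ bergman_sum_subset[OF assms(1,2,4)]], rule subsetI)
  fix f assume f: "f \<in> bergman_space p (\<Omega>1 \<inter> \<Omega>2)"
  then obtain G1 G2 where G: "Lp_holomorphic p \<Omega>1 G1" "Lp_holomorphic p \<Omega>2 G2"
    "\<And>z. z \<in> \<Omega>1 \<inter> \<Omega>2 \<Longrightarrow> f z = G1 z + G2 z"
    using Lp_holomorphic_decomposition[OF assms] unfolding bergman_space_iff by blast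
  have "f = (\<lambda>z\<in>\<Omega>1 \<inter> \<Omega>2. restrict G1 \<Omega>1 z + restrict G2 \<Omega>2 z)"
  proof (rule extensionalityI)
    show "f \<in> extensional (\<Omega>1 \<inter> \<Omega>2)" using f by (simp add: bergman_space_iff)
  qed (use G(3) in auto)
  moreover have "restrict G1 \<Omega>1 \<in> bergman_space p \<Omega>1" "restrict G2 \<Omega>2 \<in> bergman_space p \<Omega>2"
    using G(1,2) Lp_holomorphic_cong[of \<Omega>1 "restrict G1 \<Omega>1" G1 p] Lp_holomorphic_cong[of \<Omega>2 "restrict G2 \<Omega>2" G2 p]
    by (simp_all add: bergman_space_iff)
  ultimately show "f \<in> bergman_sum p \<Omega>1 \<Omega>2" unfolding bergman_sum_def by blast
qed

end
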